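(* Let $H_1$ and $H_2$ be bialgebras over $\Bbbk$. Then any quasitriangular structure $\mathcal{S}$ on the tensor product bialgebra $H_1\otimes H_2$ is cohomologous to a quasitriangular structure on $H_1\otimes H_2$ of the form $$\mathcal{R}_\otimes:=(1_{H_1}\otimes\mathcal{Q}\otimes1_{H_2})\big((\mathrm{Id}_{H_1}\otimes\tau\otimes\mathrm{Id}_{H_2})(\mathcal{R}_1\otimes\mathcal{R}_2)\big),$$ where $\mathcal{R}_1\in H_1\otimes H_1$ and $\mathcal{R}_2\in H_2\otimes H_2$ are quasitriangular structures of $H_1$ and $H_2$, respectively, and $\mathcal{Q}\in H_2\otimes H_1$ is a central weak $\mathcal{R}$-matrix of $(H_2,H_1)$. Explicitly, the triple $(\mathcal{R}_1,\mathcal{R}_2,\mathcal{Q})$ associated with $\mathcal{S}$ is given by $$\mathcal{R}_1=(\mathrm{Id}\otimes\varepsilon\otimes\mathrm{Id}\otimes\varepsilon)(\mathcal{S}),\qquad \mathcal{R}_2=(\varepsilon\otimes\mathrm{Id}\otimes\varepsilon\otimes\mathrm{Id})(\mathcal{S}),\qquad \mathcal{Q}=\mathcal{H}(\mathcal{G}^{\mathrm{op}})^{-1},$$ where $\mathcal{G}:=(\mathrm{Id}\otimes\varepsilon\otimes\varepsilon\otimes\mathrm{Id})(\mathcal{S})\in H_1\otimes H_2$ and $\mathcal{H}:=(\varepsilon\otimes\mathrm{Id}\otimes\mathrm{Id}\otimes\varepsilon)(\mathcal{S})\in H_2\otimes H_1$.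
   Context: $\Bbbk$ is an arbitrary field; bialgebras and tensor products are over $\Bbbk$. $\tau$ denotes the canonical flip of vector spaces, $\varepsilon$ the counit, $H^\times$ the set of multiplicatively invertible elements of $H$. For $T=T^i\otimes T_i\in A\otimes B$ (summation understood), $T^{\mathrm{op}}:=\tau(T)=T_i\otimes T^i$. The tensor product bialgebra $H_1\otimes H_2$ has componentwise multiplication, unit $1\otimes 1$, comultiplication $(\mathrm{Id}\otimes\tau\otimes\mathrm{Id})(\Delta_{H_1}\otimes\Delta_{H_2})$ and counit $\varepsilon\otimes\varepsilon$. A quasitriangular structure (universal $\mathcal{R}$-matrix) on a bialgebra $H$ is an invertible $\mathcal{R}\in H\otimes H$ with $\Delta^{\mathrm{op}}(\cdot)=\mathcal{R}\Delta(\cdot)\mathcal{R}^{-1}$, $(\mathrm{Id}\otimes\Delta)(\mathcal{R})=\mathcal{R}_{13}\mathcal{R}_{12}$ and $(\Delta\otimes\mathrm{Id})(\mathcal{R})=\mathcal{R}_{13}\mathcal{R}_{23}$ (usual leg notation). A twist on $H$ is an invertible $\mathcal{F}\in H\otimes H$ with $(\mathcal{F}\otimes1)(\Delta\otimes\mathrm{Id})(\mathcal{F})=(1\otimes\mathcal{F})(\mathrm{Id}\otimes\Delta)(\mathcal{F})$ and $(\varepsilon\otimes\mathrm{Id})(\mathcal{F})=1=(\mathrm{Id}\otimes\varepsilon)(\mathcal{F})$; every quasitriangular structure is a twist. For a twist $\mathcal{F}$ on $H$ and $h\in H^\times$ put $\mathcal{F}^h:=(h\otimes h)\mathcal{F}\Delta(h^{-1})$.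 Two twists $\mathcal{F}',\mathcal{F}$ on $H$ are cohomologous if $(\mathcal{F}')^h=\mathcal{F}$ for some $h\in H^\times$. For bialgebras $A,B$, an invertible element $\mathcal{R}\in A\otimes B$ is a weak $\mathcal{R}$-matrix of $(A,B)$ if $(\mathrm{Id}_A\otimes\Delta_B)(\mathcal{R})=\mathcal{R}_{13}\mathcal{R}_{12}$ in $A\otimes B\otimes B$ and $(\Delta_A\otimes\mathrm{Id}_B)(\mathcal{R})=\mathcal{R}_{13}\mathcal{R}_{23}$ in $A\otimes A\otimes B$. It is central if it lies in the center of the algebra $A\otimes B$. *)

theory Defs
  imports "HOL-Algebra.Module" "HOL-Algebra.AbelCoset"
begin

section \<open>Tensor products of modules\<close>

text \<open>
  The usual construction: the free module on \<open>A \<times> B\<close> modulo the bilinearity relations. Elements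
  of the tensor product are cosets, hence sets of finitely supported functions.
\<close>

type_synonym ('k, 'a, 'b) tens = "(('a \<times> 'b) \<Rightarrow> 'k) set"

text \<open>Modules are records that also have the two ring fields; for records that are only modules
  these are left undefined.\<close>

definition free_module :: "('k, 'm) ring_scheme \<Rightarrow> 'x set \<Rightarrow> ('k, 'x \<Rightarrow> 'k) module" where
  "free_module K X =
    \<lparr>carrier = {f. (\<forall>x. f x \<in> carrier K) \<and> finite {x. f x \<noteq> \<zero>\<^bsub>K\<^esub>} \<and> {x. f x \<noteq> \<zero>\<^bsub>K\<^esub>} \<subseteq> X},
     mult = undefined, one = undefined,
     zero = (\<lambda>x. \<zero>\<^bsub>K\<^esub>), add = (\<lambda>f g x. f x \<oplus>\<^bsub>K\<^esub> g x),
     smult = (\<lambda>c f x. c \<otimes>\<^bsub>K\<^esub> f x)\<rparr>"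

definition basis_elt :: "('k, 'm) ring_scheme \<Rightarrow> 'x \<Rightarrow> 'x \<Rightarrow> 'k" where
  "basis_elt K x = (\<lambda>y. if y = x then \<one>\<^bsub>K\<^esub> else \<zero>\<^bsub>K\<^esub>)"

abbreviation free_on_pairs ::
    "('k, 'm) ring_scheme \<Rightarrow> ('k, 'a, 'p) module_scheme \<Rightarrow> ('k, 'b, 'q) module_scheme
      \<Rightarrow> ('k, 'a \<times> 'b \<Rightarrow> 'k) module" where
  "free_on_pairs K A B \<equiv> free_module K (carrier A \<times> carrier B)"

definition bilinearity_relators ::
    "('k, 'm) ring_scheme \<Rightarrow> ('k, 'a, 'p) module_scheme \<Rightarrow> ('k, 'b, 'q) module_scheme
      \<Rightarrow> ('a \<times> 'b \<Rightarrow> 'k) set" where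
  "bilinearity_relators K A B =
    (let F = free_on_pairs K A B; e = basis_elt K in
      {e (a \<oplus>\<^bsub>A\<^esub> a', b) \<ominus>\<^bsub>F\<^esub> (e (a, b) \<oplus>\<^bsub>F\<^esub> e (a', b)) | a a' b.
          a \<in> carrier A \<and> a' \<in> carrier A \<and> b \<in> carrier B} \<union>
      {e (a, b \<oplus>\<^bsub>B\<^esub> b') \<ominus>\<^bsub>F\<^esub> (e (a, b) \<oplus>\<^bsub>F\<^esub> e (a, b')) | a b b'.
          a \<in> carrier A \<and> b \<in> carrier B \<and> b' \<in> carrier B} \<union>
      {e (c \<odot>\<^bsub>A\<^esub> a, b) \<ominus>\<^bsub>F\<^esub> c \<odot>\<^bsub>F\<^esub> e (a, b) | a b c.
          a \<in> carrier A \<and> b \<in> carrier B \<and> c \<in> carrier K} \<union>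
      {e (a, c \<odot>\<^bsub>B\<^esub> b) \<ominus>\<^bsub>F\<^esub> c \<odot>\<^bsub>F\<^esub> e (a, b) | a b c.
          a \<in> carrier A \<and> b \<in> carrier B \<and> c \<in> carrier K})"

definition bilinearity_submodule ::
    "('k, 'm) ring_scheme \<Rightarrow> ('k, 'a, 'p) module_scheme \<Rightarrow> ('k, 'b, 'q) module_scheme
      \<Rightarrow> ('a \<times> 'b \<Rightarrow> 'k) set" where
  "bilinearity_submodule K A B =
    \<Inter>{N. submodule N K (free_on_pairs K A B) \<and> bilinearity_relators K A B \<subseteq> N}"

definition tensor_module ::
    "('k, 'm) ring_scheme \<Rightarrow> ('k, 'a, 'p) module_scheme \<Rightarrow> ('k, 'b, 'q) module_scheme
      \<Rightarrow> ('k, ('k, 'a, 'b) tens) module" where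
  "tensor_module K A B =
    (let F = free_on_pairs K A B; N = bilinearity_submodule K A B in
      \<lparr>carrier = a_rcosets\<^bsub>F\<^esub> N,
       mult = undefined, one = undefined,
       zero = N, add = (\<lambda>X Y. X <+>\<^bsub>F\<^esub> Y),
       smult = (\<lambda>c X. \<Union>f\<in>X. N +>\<^bsub>F\<^esub> (c \<odot>\<^bsub>F\<^esub> f))\<rparr>)"

definition pure_tensor ::
    "('k, 'm) ring_scheme \<Rightarrow> ('k, 'a, 'p) module_scheme \<Rightarrow> ('k, 'b, 'q) module_scheme
      \<Rightarrow> 'a \<Rightarrow> 'b \<Rightarrow> ('k, 'a, 'b) tens" where
  "pure_tensor K A B a b =
    bilinearity_submodule K A B +>\<^bsub>free_on_pairs K A B\<^esub> basis_elt K (a, b)"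

text \<open>The linear map on the tensor product with values in \<open>M\<close> that is induced by \<open>\<phi>\<close>. It is
  computed on an arbitrary representative of the coset, which is legitimate only for \<open>\<phi>\<close>
  bilinear on the carriers; all uses below are of this kind.\<close>

definition tensor_lift ::
    "('k, 'm) ring_scheme \<Rightarrow> ('k, 'c, 'r) module_scheme \<Rightarrow> ('a \<Rightarrow> 'b \<Rightarrow> 'c)
      \<Rightarrow> ('k, 'a, 'b) tens \<Rightarrow> 'c" where
  "tensor_lift K M \<phi> X =
    (let f = (SOME f. f \<in> X) in
      (\<Oplus>\<^bsub>M\<^esub>p \<in> {p. f p \<noteq> \<zero>\<^bsub>K\<^esub>}. f p \<odot>\<^bsub>M\<^esub> \<phi> (fst p) (snd p)))"


section \<open>Tensor products of algebras\<close>

definition tensor_algebra ::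
    "('k, 'm) ring_scheme \<Rightarrow> ('k, 'a, 'p) module_scheme \<Rightarrow> ('k, 'b, 'q) module_scheme
      \<Rightarrow> ('k, ('k, 'a, 'b) tens) module" where
  "tensor_algebra K A B =
    (let T = tensor_module K A B in
      T\<lparr>mult := (\<lambda>X Y.
            tensor_lift K T (\<lambda>a b.
              tensor_lift K T (\<lambda>a' b'. pure_tensor K A B (a \<otimes>\<^bsub>A\<^esub> a') (b \<otimes>\<^bsub>B\<^esub> b')) Y) X),
        one := pure_tensor K A B \<one>\<^bsub>A\<^esub> \<one>\<^bsub>B\<^esub>\<rparr>)"

text \<open>\<open>f \<otimes> g : A \<otimes> B \<rightarrow> C \<otimes> D\<close> for linear maps \<open>f : A \<rightarrow> C\<close> and \<open>g : B \<rightarrow> D\<close>; only the codomains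
  are needed as arguments.\<close>

definition tensor_map ::
    "('k, 'm) ring_scheme \<Rightarrow> ('k, 'c, 'p) module_scheme \<Rightarrow> ('k, 'd, 'q) module_scheme
      \<Rightarrow> ('a \<Rightarrow> 'c) \<Rightarrow> ('b \<Rightarrow> 'd) \<Rightarrow> ('k, 'a, 'b) tens \<Rightarrow> ('k, 'c, 'd) tens" where
  "tensor_map K C D f g =
    tensor_lift K (tensor_algebra K C D) (\<lambda>a b. pure_tensor K C D (f a) (g b))"

text \<open>The flip \<open>\<tau> : A \<otimes> B \<rightarrow> B \<otimes> A\<close>.\<close>

definition flip ::
    "('k, 'm) ring_scheme \<Rightarrow> ('k, 'a, 'p) module_scheme \<Rightarrow> ('k, 'b, 'q) module_scheme
      \<Rightarrow> ('k, 'a, 'b) tens \<Rightarrow> ('k, 'b, 'a) tens" where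
  "flip K A B = tensor_lift K (tensor_algebra K B A) (\<lambda>a b. pure_tensor K B A b a)"

text \<open>The canonical isomorphism \<open>(A \<otimes> B) \<otimes> C \<rightarrow> A \<otimes> (B \<otimes> C)\<close>.\<close>

definition assoc ::
    "('k, 'm) ring_scheme \<Rightarrow> ('k, 'a, 'p) module_scheme \<Rightarrow> ('k, 'b, 'q) module_scheme
      \<Rightarrow> ('k, 'c, 'r) module_scheme
      \<Rightarrow> ('k, ('k, 'a, 'b) tens, 'c) tens \<Rightarrow> ('k, 'a, ('k, 'b, 'c) tens) tens" where
  "assoc K A B C =
    (let M = tensor_algebra K A (tensor_algebra K B C) in
      tensor_lift K M (\<lambda>t c. tensor_lift K M (\<lambda>a b.
        pure_tensor K A (tensor_algebra K B C) a (pure_tensor K B C b c)) t))"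

text \<open>The map \<open>Id \<otimes> \<tau> \<otimes> Id : (A \<otimes> B) \<otimes> (C \<otimes> D) \<rightarrow> (A \<otimes> C) \<otimes> (B \<otimes> D)\<close>.\<close>

definition middle_flip ::
    "('k, 'm) ring_scheme \<Rightarrow> ('k, 'a, 'p) module_scheme \<Rightarrow> ('k, 'b, 'q) module_scheme
      \<Rightarrow> ('k, 'c, 'r) module_scheme \<Rightarrow> ('k, 'd, 's) module_scheme
      \<Rightarrow> ('k, ('k, 'a, 'b) tens, ('k, 'c, 'd) tens) tens
      \<Rightarrow> ('k, ('k, 'a, 'c) tens, ('k, 'b, 'd) tens) tens" where
  "middle_flip K A B C D =
    (let AC = tensor_algebra K A C; BD = tensor_algebra K B D; M = tensor_algebra K AC BD in
      tensor_lift K M (\<lambda>t u. tensor_lift K M (\<lambda>a b. tensor_lift K M (\<lambda>c d.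
        pure_tensor K AC BD (pure_tensor K A C a c) (pure_tensor K B D b d)) u) t))"

text \<open>\<open>Id \<otimes> e\<close> and \<open>e \<otimes> Id\<close> for a linear functional \<open>e\<close>, with \<open>A \<otimes> \<kk>\<close> and \<open>\<kk> \<otimes> B\<close> identified
  with \<open>A\<close> and \<open>B\<close>.\<close>

definition apply_right ::
    "('k, 'm) ring_scheme \<Rightarrow> ('k, 'a, 'p) module_scheme \<Rightarrow> ('b \<Rightarrow> 'k) \<Rightarrow> ('k, 'a, 'b) tens \<Rightarrow> 'a" where
  "apply_right K A e = tensor_lift K A (\<lambda>a b. e b \<odot>\<^bsub>A\<^esub> a)"

definition apply_left ::
    "('k, 'm) ring_scheme \<Rightarrow> ('k, 'b, 'p) module_scheme \<Rightarrow> ('a \<Rightarrow> 'k) \<Rightarrow> ('k, 'a, 'b) tens \<Rightarrow> 'b" where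
  "apply_left K B e = tensor_lift K B (\<lambda>a b. e a \<odot>\<^bsub>B\<^esub> b)"


section \<open>Bialgebras\<close>

record ('k, 'a) bialg = "('k, 'a) module" +
  comult :: "'a \<Rightarrow> ('k, 'a, 'a) tens"
  counit :: "'a \<Rightarrow> 'k"

locale bialgebra = K: field K + H: ring H + V: module K H
  for K :: "('k, 'm) ring_scheme" and H :: "('k, 'a) bialg" +
  assumes smult_mult_left:
      "\<lbrakk>c \<in> carrier K; x \<in> carrier H; y \<in> carrier H\<rbrakk>
        \<Longrightarrow> (c \<odot>\<^bsub>H\<^esub> x) \<otimes>\<^bsub>H\<^esub> y = c \<odot>\<^bsub>H\<^esub> (x \<otimes>\<^bsub>H\<^esub> y)"
    and smult_mult_right:
      "\<lbrakk>c \<in> carrier K; x \<in> carrier H; y \<in> carrier H\<rbrakk>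
        \<Longrightarrow> x \<otimes>\<^bsub>H\<^esub> (c \<odot>\<^bsub>H\<^esub> y) = c \<odot>\<^bsub>H\<^esub> (x \<otimes>\<^bsub>H\<^esub> y)"
    and comult_hom: "comult H \<in> ring_hom H (tensor_algebra K H H)"
    and comult_smult:
      "\<lbrakk>c \<in> carrier K; x \<in> carrier H\<rbrakk>
        \<Longrightarrow> comult H (c \<odot>\<^bsub>H\<^esub> x) = c \<odot>\<^bsub>tensor_algebra K H H\<^esub> comult H x"
    and counit_hom: "counit H \<in> ring_hom H K"
    and counit_smult:
      "\<lbrakk>c \<in> carrier K; x \<in> carrier H\<rbrakk> \<Longrightarrow> counit H (c \<odot>\<^bsub>H\<^esub> x) = c \<otimes>\<^bsub>K\<^esub> counit H x"
    and coassoc: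
      "x \<in> carrier H \<Longrightarrow>
        assoc K H H H (tensor_map K (tensor_algebra K H H) H (comult H) id (comult H x))
        = tensor_map K H (tensor_algebra K H H) id (comult H) (comult H x)"
    and counit_left: "x \<in> carrier H \<Longrightarrow> apply_left K H (counit H) (comult H x) = x"
    and counit_right: "x \<in> carrier H \<Longrightarrow> apply_right K H (counit H) (comult H x) = x"

definition tensor_bialgebra ::
    "('k, 'm) ring_scheme \<Rightarrow> ('k, 'a) bialg \<Rightarrow> ('k, 'b) bialg
      \<Rightarrow> ('k, ('k, 'a, 'b) tens) bialg" where
  "tensor_bialgebra K A B =
    (let T = tensor_algebra K A B in
      \<lparr>carrier = carrier T, mult = mult T, one = one T, zero = zero T, add = add T,
       smult = smult T,
       comult = (\<lambda>x. middle_flip K A A B B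
          (tensor_map K (tensor_algebra K A A) (tensor_algebra K B B) (comult A) (comult B) x)),
       counit = tensor_lift K \<lparr>carrier = carrier K, mult = mult K, one = one K, zero = zero K,
            add = add K, smult = mult K\<rparr> (\<lambda>a b. counit A a \<otimes>\<^bsub>K\<^esub> counit B b)\<rparr>)"


section \<open>Universal R-matrices, twists and weak R-matrices\<close>

text \<open>Threefold tensor products are bracketed as they come out of \<open>Id \<otimes> \<Delta>\<close> and \<open>\<Delta> \<otimes> Id\<close>: the first
  identity lives in \<open>A \<otimes> (B \<otimes> B)\<close>, the second one in \<open>(A \<otimes> A) \<otimes> B\<close>. The tensor maps applied to
  \<open>R\<close> on the right-hand sides are the leg embeddings, e.g. \<open>a \<otimes> b \<mapsto> a \<otimes> (1 \<otimes> b)\<close> for \<open>R\<^sub>1\<^sub>3\<close>.\<close>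

definition weak_R_matrix ::
    "('k, 'm) ring_scheme \<Rightarrow> ('k, 'a) bialg \<Rightarrow> ('k, 'b) bialg \<Rightarrow> ('k, 'a, 'b) tens \<Rightarrow> bool" where
  "weak_R_matrix K A B R \<longleftrightarrow>
    (let AA = tensor_algebra K A A; BB = tensor_algebra K B B;
         A_BB = tensor_algebra K A BB; AA_B = tensor_algebra K AA B in
      R \<in> Units (tensor_algebra K A B) \<and>
      tensor_map K A BB id (comult B) R
        = tensor_map K A BB id (pure_tensor K B B \<one>\<^bsub>B\<^esub>) R
            \<otimes>\<^bsub>A_BB\<^esub> tensor_map K A BB id (\<lambda>b. pure_tensor K B B b \<one>\<^bsub>B\<^esub>) R \<and>
      tensor_map K AA B (comult A) id R
        = tensor_map K AA B (\<lambda>a. pure_tensor K A A a \<one>\<^bsub>A\<^esub>) id R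
            \<otimes>\<^bsub>AA_B\<^esub> tensor_map K AA B (pure_tensor K A A \<one>\<^bsub>A\<^esub>) id R)"

definition central :: "('a, 'm) ring_scheme \<Rightarrow> 'a \<Rightarrow> bool" where
  "central A z \<longleftrightarrow> z \<in> carrier A \<and> (\<forall>x \<in> carrier A. z \<otimes>\<^bsub>A\<^esub> x = x \<otimes>\<^bsub>A\<^esub> z)"

definition quasitriangular ::
    "('k, 'm) ring_scheme \<Rightarrow> ('k, 'a) bialg \<Rightarrow> ('k, 'a, 'a) tens \<Rightarrow> bool" where
  "quasitriangular K H R \<longleftrightarrow>
    (let HH = tensor_algebra K H H in
      weak_R_matrix K H H R \<and>
      (\<forall>x \<in> carrier H. flip K H H (comult H x) = R \<otimes>\<^bsub>HH\<^esub> comult H x \<otimes>\<^bsub>HH\<^esub> inv\<^bsub>HH\<^esub> R))"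

definition twist ::
    "('k, 'm) ring_scheme \<Rightarrow> ('k, 'a) bialg \<Rightarrow> ('k, 'a, 'a) tens \<Rightarrow> bool" where
  "twist K H F \<longleftrightarrow>
    (let HH = tensor_algebra K H H; HH_H = tensor_algebra K HH H; H_HH = tensor_algebra K H HH in
      F \<in> Units HH \<and>
      assoc K H H H (pure_tensor K HH H F \<one>\<^bsub>H\<^esub> \<otimes>\<^bsub>HH_H\<^esub> tensor_map K HH H (comult H) id F)
        = pure_tensor K H HH \<one>\<^bsub>H\<^esub> F \<otimes>\<^bsub>H_HH\<^esub> tensor_map K H HH id (comult H) F \<and>
      apply_left K H (counit H) F = \<one>\<^bsub>H\<^esub> \<and>
      apply_right K H (counit H) F = \<one>\<^bsub>H\<^esub>)"

definition gauge_transform ::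
    "('k, 'm) ring_scheme \<Rightarrow> ('k, 'a) bialg \<Rightarrow> 'a \<Rightarrow> ('k, 'a, 'a) tens \<Rightarrow> ('k, 'a, 'a) tens" where
  "gauge_transform K H h F =
    (let HH = tensor_algebra K H H in
      pure_tensor K H H h h \<otimes>\<^bsub>HH\<^esub> F \<otimes>\<^bsub>HH\<^esub> comult H (inv\<^bsub>H\<^esub> h))"

definition cohomologous ::
    "('k, 'm) ring_scheme \<Rightarrow> ('k, 'a) bialg \<Rightarrow> ('k, 'a, 'a) tens \<Rightarrow> ('k, 'a, 'a) tens \<Rightarrow> bool" where
  "cohomologous K H F' F \<longleftrightarrow>
    twist K H F' \<and> twist K H F \<and> (\<exists>h \<in> Units H. gauge_transform K H h F' = F)"

text \<open>\<open>(1 \<otimes> Q \<otimes> 1) ((Id \<otimes> \<tau> \<otimes> Id)(R1 \<otimes> R2))\<close>, an element of \<open>(A \<otimes> B) \<otimes> (A \<otimes> B)\<close> for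
  \<open>R1\<close> in \<open>A \<otimes> A\<close>, \<open>R2\<close> in \<open>B \<otimes> B\<close> and \<open>Q\<close> in \<open>B \<otimes> A\<close>.\<close>

definition R_tensor ::
    "('k, 'm) ring_scheme \<Rightarrow> ('k, 'a) bialg \<Rightarrow> ('k, 'b) bialg
      \<Rightarrow> ('k, 'a, 'a) tens \<Rightarrow> ('k, 'b, 'b) tens \<Rightarrow> ('k, 'b, 'a) tens
      \<Rightarrow> ('k, ('k, 'a, 'b) tens, ('k, 'a, 'b) tens) tens" where
  "R_tensor K A B R1 R2 Q =
    (let AB = tensor_algebra K A B in
      tensor_map K AB AB (pure_tensor K A B \<one>\<^bsub>A\<^esub>) (\<lambda>a. pure_tensor K A B a \<one>\<^bsub>B\<^esub>) Q
        \<otimes>\<^bsub>tensor_algebra K AB AB\<^esub>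
      middle_flip K A A B B
        (pure_tensor K (tensor_algebra K A A) (tensor_algebra K B B) R1 R2))"

end

theory Submission
  imports Defs
begin

text \<open>
  Write \<open>A\<close>, \<open>B\<close> for the two bialgebras, \<open>H = A \<otimes> B\<close>, and number the four tensor factors of
  \<open>H \<otimes> H\<close> from 1 to 4. The projections \<open>p = Id \<otimes> \<epsilon> : H \<rightarrow> A\<close> and \<open>q = \<epsilon> \<otimes> Id : H \<rightarrow> B\<close> are
  bialgebra homomorphisms, so the components \<open>R1 = (p \<otimes> p)(S)\<close>, \<open>R2 = (q \<otimes> q)(S)\<close>,
  \<open>G = (p \<otimes> q)(S)\<close> and \<open>H' = (q \<otimes> p)(S)\<close> are weak R-matrices, and \<open>R1\<close>, \<open>R2\<close> are even
  quasitriangular (\<open>weak_R_matrix_image\<close>, \<open>quasitriangular_image\<close>).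

  The key observation is that \<open>p \<otimes> q\<close> undoes both the coproduct and the opposite coproduct of
  \<open>H\<close> (\<open>pr_comult\<close>, \<open>pr_flip_comult\<close>). Applied to \<open>\<Delta>\<^sup>o\<^sup>p(x) S = S \<Delta>(x)\<close> it shows that
  \<open>G\<close> is central in \<open>A \<otimes> B\<close>; in the same way \<open>H'\<close> is central in \<open>B \<otimes> A\<close>. Applied to both legs of
  \<open>(\<Delta> \<otimes> \<Delta>)(S)\<close>, which the hexagon identities expand into four factors, it yields
  \<open>S = G\<^sub>1\<^sub>4 (R1)\<^sub>1\<^sub>3 (R2)\<^sub>2\<^sub>4 H'\<^sub>2\<^sub>3\<close> (\<open>S_factorization\<close>), where \<open>G\<^sub>1\<^sub>4\<close> and
  \<open>H'\<^sub>2\<^sub>3\<close> are central in \<open>H \<otimes> H\<close>.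

  The hexagon identities of \<open>G\<close> give \<open>\<Delta>(G) = G\<^sub>1\<^sub>4 (G \<otimes> G) G\<^sub>3\<^sub>2\<close> (\<open>comult_G\<close>). All these factors
  are central, so the gauge transformation by \<open>h = G\<close> multiplies \<open>S\<close> by the inverses of \<open>G\<^sub>1\<^sub>4\<close> and
  \<open>G\<^sub>3\<^sub>2\<close>. What remains is \<open>H'\<^sub>2\<^sub>3 (G\<^sub>3\<^sub>2)\<^sup>-\<^sup>1 (R1)\<^sub>1\<^sub>3 (R2)\<^sub>2\<^sub>4\<close>, which is the desired
  product with \<open>Q = H' (G\<^sup>o\<^sup>p)\<^sup>-\<^sup>1\<close> (\<open>gauge_S\<close>). That it is quasitriangular and that \<open>Q\<close> is a weak
  R-matrix follows from closure properties: a weak R-matrix may be multiplied by a central one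
  (\<open>weak_R_matrix_mult\<close>), a central one may be inverted (\<open>weak_R_matrix_inv\<close>), and the inverse of
  the flip of any weak R-matrix is one (\<open>weak_R_matrix_flip_inv\<close>).

  On the technical side, the tensor product of modules gets its universal property (\<open>tensor_lift\<close>
  is linear and has the prescribed values on pure tensors), and the maps of interest on tensor
  products of algebras are recognized as algebra homomorphisms. Such maps are determined by their
  values on \<open>a \<otimes> 1\<close> and \<open>1 \<otimes> b\<close>, which settles the identities between them.
\<close>

section \<open>Linear and bilinear maps\<close>

text \<open>Only the values on the carrier of the domain are constrained, here and in the notions below;
  functions are not required to be extensional.\<close>

definition linear_map ::
    "('k, 'm) ring_scheme \<Rightarrow> ('k, 'a, 'p) module_scheme \<Rightarrow> ('k, 'b, 'q) module_scheme
      \<Rightarrow> ('a \<Rightarrow> 'b) \<Rightarrow> bool" where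
  "linear_map K V W f \<longleftrightarrow>
    (\<forall>x \<in> carrier V. f x \<in> carrier W) \<and>
    (\<forall>x \<in> carrier V. \<forall>y \<in> carrier V. f (x \<oplus>\<^bsub>V\<^esub> y) = f x \<oplus>\<^bsub>W\<^esub> f y) \<and>
    (\<forall>c \<in> carrier K. \<forall>x \<in> carrier V. f (c \<odot>\<^bsub>V\<^esub> x) = c \<odot>\<^bsub>W\<^esub> f x)"

lemma linear_mapI:
  assumes "\<And>x. x \<in> carrier V \<Longrightarrow> f x \<in> carrier W"
    and "\<And>x y. x \<in> carrier V \<Longrightarrow> y \<in> carrier V \<Longrightarrow> f (x \<oplus>\<^bsub>V\<^esub> y) = f x \<oplus>\<^bsub>W\<^esub> f y"
    and "\<And>c x. c \<in> carrier K \<Longrightarrow> x \<in> carrier V \<Longrightarrow> f (c \<odot>\<^bsub>V\<^esub> x) = c \<odot>\<^bsub>W\<^esub> f x"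
  shows "linear_map K V W f"
  using assms by (auto simp: linear_map_def)

lemma linear_mapD:
  assumes "linear_map K V W f"
  shows "x \<in> carrier V \<Longrightarrow> f x \<in> carrier W"
    and "x \<in> carrier V \<Longrightarrow> y \<in> carrier V \<Longrightarrow> f (x \<oplus>\<^bsub>V\<^esub> y) = f x \<oplus>\<^bsub>W\<^esub> f y"
    and "c \<in> carrier K \<Longrightarrow> x \<in> carrier V \<Longrightarrow> f (c \<odot>\<^bsub>V\<^esub> x) = c \<odot>\<^bsub>W\<^esub> f x"
  using assms by (auto simp: linear_map_def)

lemma linear_map_compose:
  assumes "linear_map K U V g" "linear_map K V W f"
  shows "linear_map K U W (\<lambda>x. f (g x))"
  by (rule linear_mapI) (simp_all add: linear_mapD[OF assms(1)] linear_mapD[OF assms(2)])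

lemma linear_map_zero:
  assumes "module K V" "module K W" "linear_map K V W f"
  shows "f \<zero>\<^bsub>V\<^esub> = \<zero>\<^bsub>W\<^esub>"
proof -
  interpret V: module K V by fact
  interpret W: module K W by fact
  have "f (\<zero>\<^bsub>K\<^esub> \<odot>\<^bsub>V\<^esub> \<zero>\<^bsub>V\<^esub>) = \<zero>\<^bsub>K\<^esub> \<odot>\<^bsub>W\<^esub> f \<zero>\<^bsub>V\<^esub>"
    by (rule linear_mapD[OF assms(3)]) auto
  then show ?thesis using linear_mapD(1)[OF assms(3)] by simp
qed

definition bilinear_map ::
    "('k, 'm) ring_scheme \<Rightarrow> ('k, 'a, 'p) module_scheme \<Rightarrow> ('k, 'b, 'q) module_scheme
      \<Rightarrow> ('k, 'c, 'r) module_scheme \<Rightarrow> ('a \<Rightarrow> 'b \<Rightarrow> 'c) \<Rightarrow> bool" where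
  "bilinear_map K A B M \<phi> \<longleftrightarrow>
    (\<forall>a \<in> carrier A. linear_map K B M (\<phi> a)) \<and>
    (\<forall>b \<in> carrier B. linear_map K A M (\<lambda>a. \<phi> a b))"

lemma bilinear_mapI:
  assumes "\<And>a. a \<in> carrier A \<Longrightarrow> linear_map K B M (\<phi> a)"
    and "\<And>b. b \<in> carrier B \<Longrightarrow> linear_map K A M (\<lambda>a. \<phi> a b)"
  shows "bilinear_map K A B M \<phi>"
  using assms by (auto simp: bilinear_map_def)

lemma bilinear_mapD:
  assumes "bilinear_map K A B M \<phi>"
  shows "a \<in> carrier A \<Longrightarrow> linear_map K B M (\<phi> a)"
    and "b \<in> carrier B \<Longrightarrow> linear_map K A M (\<lambda>a. \<phi> a b)"
  using assms by (auto simp: bilinear_map_def)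

lemma bilinear_map_closed:
  assumes "bilinear_map K A B M \<phi>" "a \<in> carrier A" "b \<in> carrier B"
  shows "\<phi> a b \<in> carrier M"
  using linear_mapD(1)[OF bilinear_mapD(1)[OF assms(1,2)] assms(3)] .


section \<open>The tensor product of two modules and its universal property\<close>

lemma free_module_simps:
  "carrier (free_module K X) =
    {f. (\<forall>x. f x \<in> carrier K) \<and> finite {x. f x \<noteq> \<zero>\<^bsub>K\<^esub>} \<and> {x. f x \<noteq> \<zero>\<^bsub>K\<^esub>} \<subseteq> X}"
  "zero (free_module K X) = (\<lambda>x. \<zero>\<^bsub>K\<^esub>)"
  "add (free_module K X) = (\<lambda>f g x. f x \<oplus>\<^bsub>K\<^esub> g x)"
  "smult (free_module K X) = (\<lambda>c f x. c \<otimes>\<^bsub>K\<^esub> f x)"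
  by (simp_all add: free_module_def)

lemma free_module_is_module:
  assumes "cring K"
  shows "module K (free_module K X)"
proof -
  interpret K: cring K by fact
  let ?F = "free_module K X"
  have add: "f \<oplus>\<^bsub>?F\<^esub> g \<in> carrier ?F" if fg: "f \<in> carrier ?F" "g \<in> carrier ?F" for f g
  proof -
    have "{x. f x \<oplus>\<^bsub>K\<^esub> g x \<noteq> \<zero>\<^bsub>K\<^esub>} \<subseteq> {x. f x \<noteq> \<zero>\<^bsub>K\<^esub>} \<union> {x. g x \<noteq> \<zero>\<^bsub>K\<^esub>}" by auto
    with fg show ?thesis
      by (auto simp: free_module_simps intro: finite_subset)
  qed
  have smult: "c \<odot>\<^bsub>?F\<^esub> f \<in> carrier ?F" if cf: "c \<in> carrier K" "f \<in> carrier ?F" for c f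
  proof -
    have "{x. c \<otimes>\<^bsub>K\<^esub> f x \<noteq> \<zero>\<^bsub>K\<^esub>} \<subseteq> {x. f x \<noteq> \<zero>\<^bsub>K\<^esub>}" using cf by auto
    with cf show ?thesis
      by (auto simp: free_module_simps intro: finite_subset)
  qed
  have "\<exists>g \<in> carrier ?F. g \<oplus>\<^bsub>?F\<^esub> f = \<zero>\<^bsub>?F\<^esub>" if f: "f \<in> carrier ?F" for f
  proof
    show "(\<ominus>\<^bsub>K\<^esub> \<one>\<^bsub>K\<^esub>) \<odot>\<^bsub>?F\<^esub> f \<in> carrier ?F" using f by (intro smult) auto
    show "(\<ominus>\<^bsub>K\<^esub> \<one>\<^bsub>K\<^esub>) \<odot>\<^bsub>?F\<^esub> f \<oplus>\<^bsub>?F\<^esub> f = \<zero>\<^bsub>?F\<^esub>"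
      using f by (auto simp: free_module_simps K.l_minus K.l_neg)
  qed
  then have "abelian_group ?F"
    using add by (intro abelian_groupI) (auto simp: free_module_simps K.a_ac)
  then show ?thesis
    using smult assms
    by (intro moduleI) (auto simp: free_module_simps K.l_distr K.r_distr K.m_assoc)
qed

lemma basis_elt_closed:
  assumes "cring K" "x \<in> X"
  shows "basis_elt K x \<in> carrier (free_module K X)"
proof -
  interpret K: cring K by fact
  have "{y. basis_elt K x y \<noteq> \<zero>\<^bsub>K\<^esub>} \<subseteq> {x}" by (auto simp: basis_elt_def)
  then show ?thesis using assms(2)
    by (auto simp: free_module_simps basis_elt_def intro: finite_subset)
qed

lemma basis_elt_pair_closed:
  assumes "cring K" "a \<in> carrier A" "b \<in> carrier B"
  shows "basis_elt K (a, b) \<in> carrier (free_on_pairs K A B)"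
  using assms by (intro basis_elt_closed) auto

text \<open>The linear extension of \<open>\<phi>\<close> from the basis \<open>X\<close> to the free module.\<close>

definition linear_extension ::
    "('k, 'm) ring_scheme \<Rightarrow> ('k, 'c, 'r) module_scheme \<Rightarrow> ('x \<Rightarrow> 'c) \<Rightarrow> ('x \<Rightarrow> 'k) \<Rightarrow> 'c" where
  "linear_extension K M \<phi> f = (\<Oplus>\<^bsub>M\<^esub>p \<in> {p. f p \<noteq> \<zero>\<^bsub>K\<^esub>}. f p \<odot>\<^bsub>M\<^esub> \<phi> p)"

lemma linear_extension_superset:
  assumes "module K M" and \<phi>: "\<And>x. x \<in> X \<Longrightarrow> \<phi> x \<in> carrier M"
    and f: "f \<in> carrier (free_module K X)"
    and S: "finite S" "{p. f p \<noteq> \<zero>\<^bsub>K\<^esub>} \<subseteq> S" "S \<subseteq> X"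
  shows "linear_extension K M \<phi> f = (\<Oplus>\<^bsub>M\<^esub>p \<in> S. f p \<odot>\<^bsub>M\<^esub> \<phi> p)"
proof -
  interpret M: module K M by fact
  show ?thesis unfolding linear_extension_def
    using f S \<phi> by (intro M.add.finprod_mono_neutral_cong_left) (auto simp: free_module_simps)
qed

lemma linear_extension_linear:
  assumes "module K M" and \<phi>: "\<And>x. x \<in> X \<Longrightarrow> \<phi> x \<in> carrier M"
  shows "linear_map K (free_module K X) M (linear_extension K M \<phi>)"
proof -
  interpret M: module K M by fact
  let ?F = "free_module K X"
  interpret F: module K ?F by (rule free_module_is_module) (rule M.is_cring)
  show ?thesis
  proof (rule linear_mapI)
    fix f assume f: "f \<in> carrier ?F"
    then show "linear_extension K M \<phi> f \<in> carrier M"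
      unfolding linear_extension_def using \<phi>
      by (intro M.add.finprod_closed) (auto simp: free_module_simps)
  next
    fix f g assume f: "f \<in> carrier ?F" and g: "g \<in> carrier ?F"
    let ?S = "{p. f p \<noteq> \<zero>\<^bsub>K\<^esub>} \<union> {p. g p \<noteq> \<zero>\<^bsub>K\<^esub>}"
    have S: "finite ?S" "?S \<subseteq> X" using f g by (auto simp: free_module_simps)
    have fg: "{p. (f \<oplus>\<^bsub>?F\<^esub> g) p \<noteq> \<zero>\<^bsub>K\<^esub>} \<subseteq> ?S" by (auto simp: free_module_simps)
    have "linear_extension K M \<phi> (f \<oplus>\<^bsub>?F\<^esub> g) = (\<Oplus>\<^bsub>M\<^esub>p \<in> ?S. (f \<oplus>\<^bsub>?F\<^esub> g) p \<odot>\<^bsub>M\<^esub> \<phi> p)"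
      by (intro linear_extension_superset[where X = X] assms(1) \<phi> F.a_closed f g S fg)
    also have "\<dots> = (\<Oplus>\<^bsub>M\<^esub>p \<in> ?S. f p \<odot>\<^bsub>M\<^esub> \<phi> p \<oplus>\<^bsub>M\<^esub> g p \<odot>\<^bsub>M\<^esub> \<phi> p)"
      using f g \<phi> S(2) 
      by (intro M.add.finprod_cong') (auto simp: free_module_simps M.smult_l_distr subset_iff)
    also have "\<dots> = (\<Oplus>\<^bsub>M\<^esub>p \<in> ?S. f p \<odot>\<^bsub>M\<^esub> \<phi> p) \<oplus>\<^bsub>M\<^esub> (\<Oplus>\<^bsub>M\<^esub>p \<in> ?S. g p \<odot>\<^bsub>M\<^esub> \<phi> p)"
      using f g \<phi> S(2) by (intro M.finsum_addf) (auto simp: free_module_simps subset_iff)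
    also have "\<dots> = linear_extension K M \<phi> f \<oplus>\<^bsub>M\<^esub> linear_extension K M \<phi> g"
      using S by (simp add: linear_extension_superset[OF assms(1) \<phi> f S(1)]
          linear_extension_superset[OF assms(1) \<phi> g S(1)])
    finally show "linear_extension K M \<phi> (f \<oplus>\<^bsub>?F\<^esub> g)
        = linear_extension K M \<phi> f \<oplus>\<^bsub>M\<^esub> linear_extension K M \<phi> g" .
  next
    fix c f assume c: "c \<in> carrier K" and f: "f \<in> carrier ?F"
    let ?S = "{p. f p \<noteq> \<zero>\<^bsub>K\<^esub>}"
    have S: "finite ?S" "?S \<subseteq> X" using f by (auto simp: free_module_simps)
    have cf: "{p. (c \<odot>\<^bsub>?F\<^esub> f) p \<noteq> \<zero>\<^bsub>K\<^esub>} \<subseteq> ?S" using c by (auto simp: free_module_simps)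
    have "linear_extension K M \<phi> (c \<odot>\<^bsub>?F\<^esub> f) = (\<Oplus>\<^bsub>M\<^esub>p \<in> ?S. (c \<odot>\<^bsub>?F\<^esub> f) p \<odot>\<^bsub>M\<^esub> \<phi> p)"
      by (intro linear_extension_superset[where X = X] assms(1) \<phi> F.smult_closed c f S cf)
    also have "\<dots> = (\<Oplus>\<^bsub>M\<^esub>p \<in> ?S. c \<odot>\<^bsub>M\<^esub> (f p \<odot>\<^bsub>M\<^esub> \<phi> p))"
      using c f \<phi> S(2)
      by (intro M.add.finprod_cong') (auto simp: free_module_simps M.smult_assoc1 subset_iff)
    also have "\<dots> = c \<odot>\<^bsub>M\<^esub> (\<Oplus>\<^bsub>M\<^esub>p \<in> ?S. f p \<odot>\<^bsub>M\<^esub> \<phi> p)"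
      using c f \<phi> S by (intro M.finsum_smult_ldistr[symmetric]) (auto simp: free_module_simps)
    finally show "linear_extension K M \<phi> (c \<odot>\<^bsub>?F\<^esub> f) = c \<odot>\<^bsub>M\<^esub> linear_extension K M \<phi> f"
      by (simp add: linear_extension_def)
  qed
qed

lemma linear_extension_basis_elt:
  assumes "module K M" "\<And>x. x \<in> X \<Longrightarrow> \<phi> x \<in> carrier M" "x \<in> X"
  shows "linear_extension K M \<phi> (basis_elt K x) = \<phi> x"
proof -
  interpret M: module K M by fact
  have "linear_extension K M \<phi> (basis_elt K x) = (\<Oplus>\<^bsub>M\<^esub>p \<in> {x}. basis_elt K x p \<odot>\<^bsub>M\<^esub> \<phi> p)"
    using assms basis_elt_closed[OF M.is_cring assms(3)]
    by (intro linear_extension_superset[where X = X]) (auto simp: basis_elt_def)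
  then show ?thesis using assms by (simp add: basis_elt_def)
qed

text \<open>The free module is spanned by its basis.\<close>

lemma free_module_induct [consumes 2, case_names zero add]:
  assumes "cring K" "f \<in> carrier (free_module K X)"
    and zero: "P \<zero>\<^bsub>free_module K X\<^esub>"
    and step: "\<And>c x f. c \<in> carrier K \<Longrightarrow> x \<in> X \<Longrightarrow> f \<in> carrier (free_module K X) \<Longrightarrow> P f
      \<Longrightarrow> P (c \<odot>\<^bsub>free_module K X\<^esub> basis_elt K x \<oplus>\<^bsub>free_module K X\<^esub> f)"
  shows "P f"
proof -
  interpret K: cring K by fact
  let ?F = "free_module K X"
  have "finite S \<Longrightarrow> f \<in> carrier ?F \<Longrightarrow> {x. f x \<noteq> \<zero>\<^bsub>K\<^esub>} = S \<Longrightarrow> P f" for S f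
  proof (induction S arbitrary: f rule: finite_induct)
    case empty
    then have "f = \<zero>\<^bsub>?F\<^esub>" by (auto simp: free_module_simps)
    with zero show ?case by simp
  next
    case (insert x S)
    define g where "g = f(x := \<zero>\<^bsub>K\<^esub>)"
    have supp: "{y. g y \<noteq> \<zero>\<^bsub>K\<^esub>} = S" using insert.hyps insert.prems(2) by (auto simp: g_def)
    have x: "x \<in> X" using insert.prems by (auto simp: free_module_simps)
    have g: "g \<in> carrier ?F"
      using insert.prems insert.hyps supp by (auto simp: free_module_simps g_def)
    have "f = f x \<odot>\<^bsub>?F\<^esub> basis_elt K x \<oplus>\<^bsub>?F\<^esub> g"
      using insert.prems by (auto simp: free_module_simps basis_elt_def g_def)
    moreover have "P (f x \<odot>\<^bsub>?F\<^esub> basis_elt K x \<oplus>\<^bsub>?F\<^esub> g)"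
      using insert.prems x g supp insert.IH by (intro step) (auto simp: free_module_simps)
    ultimately show ?case by simp
  qed
  with assms(2) show ?thesis by (auto simp: free_module_simps)
qed

lemma submodule_Inter:
  assumes "module K F" "\<N> \<noteq> {}" "\<And>N. N \<in> \<N> \<Longrightarrow> submodule N K F"
  shows "submodule (\<Inter>\<N>) K F"
proof -
  interpret F: module K F by fact
  note E = F.submoduleE[OF assms(3)]
  have zero: "\<zero>\<^bsub>F\<^esub> \<in> N" if "N \<in> \<N>" for N
    using assms(3)[OF that] subgroup.one_closed[of N "add_monoid F"]
    by (auto simp: submodule_def)
  obtain N0 where N0: "N0 \<in> \<N>" using assms(2) by blast
  show ?thesis
  proof (rule F.submoduleI)
    show "\<Inter>\<N> \<subseteq> carrier F" using N0 E(1)[OF N0] by blast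
  qed (use zero E in auto)
qed

lemma bilinearity_relators_closed:
  assumes "module K A" "module K B"
  shows "bilinearity_relators K A B \<subseteq> carrier (free_on_pairs K A B)"
proof -
  interpret A: module K A by fact
  interpret B: module K B by fact
  interpret F: module K "free_on_pairs K A B" by (rule free_module_is_module) (rule A.is_cring)
  note [intro] = basis_elt_closed[OF A.is_cring]
  show ?thesis unfolding bilinearity_relators_def Let_def
    by (auto intro!: F.minus_closed F.a_closed F.smult_closed)
qed

lemma bilinearity_submodule_props:
  assumes "module K A" "module K B"
  shows bilinearity_submodule: "submodule (bilinearity_submodule K A B) K (free_on_pairs K A B)"
    and relators_in_bilinearity_submodule:
      "bilinearity_relators K A B \<subseteq> bilinearity_submodule K A B"
proof -
  interpret A: module K A by fact
  interpret F: module K "free_on_pairs K A B" by (rule free_module_is_module) (rule A.is_cring)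
  show "submodule (bilinearity_submodule K A B) K (free_on_pairs K A B)"
    unfolding bilinearity_submodule_def
    using F.carrier_is_submodule bilinearity_relators_closed[OF assms]
    by (intro submodule_Inter) (auto intro: F.module_axioms)
  show "bilinearity_relators K A B \<subseteq> bilinearity_submodule K A B"
    by (auto simp: bilinearity_submodule_def)
qed

text \<open>The class in the tensor product of an element of the free module.\<close>

definition tensor_class ::
    "('k, 'm) ring_scheme \<Rightarrow> ('k, 'a, 'p) module_scheme \<Rightarrow> ('k, 'b, 'q) module_scheme
      \<Rightarrow> ('a \<times> 'b \<Rightarrow> 'k) \<Rightarrow> ('k, 'a, 'b) tens" where
  "tensor_class K A B f = bilinearity_submodule K A B +>\<^bsub>free_on_pairs K A B\<^esub> f"

lemma pure_tensor_class: "pure_tensor K A B a b = tensor_class K A B (basis_elt K (a, b))"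
  by (simp add: pure_tensor_def tensor_class_def)

lemma tensor_module_class:
  fixes K (structure)
  assumes "module K A" "module K B"
  defines "F \<equiv> free_on_pairs K A B" and "T \<equiv> tensor_module K A B"
  shows tensor_class_self: "f \<in> carrier F \<Longrightarrow> f \<in> tensor_class K A B f"
    and tensor_class_eq_iff: "f \<in> carrier F \<Longrightarrow> g \<in> carrier F \<Longrightarrow>
      tensor_class K A B f = tensor_class K A B g \<longleftrightarrow> f \<ominus>\<^bsub>F\<^esub> g \<in> bilinearity_submodule K A B"
    and tensor_class_rep: "f \<in> carrier F \<Longrightarrow> g \<in> tensor_class K A B f \<Longrightarrow>
      g \<in> carrier F \<and> tensor_class K A B g = tensor_class K A B f"
    and carrier_tensor_module: "carrier T = tensor_class K A B ` carrier F"
    and zero_tensor_module: "\<zero>\<^bsub>T\<^esub> = tensor_class K A B \<zero>\<^bsub>F\<^esub>"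
    and add_tensor_module: "f \<in> carrier F \<Longrightarrow> g \<in> carrier F \<Longrightarrow>
      tensor_class K A B f \<oplus>\<^bsub>T\<^esub> tensor_class K A B g = tensor_class K A B (f \<oplus>\<^bsub>F\<^esub> g)"
    and smult_tensor_module: "c \<in> carrier K \<Longrightarrow> f \<in> carrier F \<Longrightarrow>
      c \<odot>\<^bsub>T\<^esub> tensor_class K A B f = tensor_class K A B (c \<odot>\<^bsub>F\<^esub> f)"
proof -
  interpret A: module K A by fact
  interpret F: module K F unfolding F_def by (rule free_module_is_module) (rule A.is_cring)
  let ?N = "bilinearity_submodule K A B"
  have sub: "submodule ?N K F"
    unfolding F_def by (rule bilinearity_submodule[OF assms(1,2)])
  then have sg: "subgroup ?N (add_monoid F)" by (simp add: submodule_def)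
  interpret N: abelian_subgroup ?N F
    by (rule abelian_subgroupI3) (auto simp: additive_subgroup_def sg F.abelian_group_axioms)
  have cl: "tensor_class K A B f = ?N +>\<^bsub>F\<^esub> f" for f
    by (simp add: tensor_class_def F_def)
  show self: "f \<in> tensor_class K A B f" if "f \<in> carrier F" for f
    unfolding cl using that by (rule N.a_rcos_self)
  have eqI: "tensor_class K A B f = tensor_class K A B g"
    if "f \<in> carrier F" "g \<in> tensor_class K A B f" for f g
    using F.a_repr_independence[OF _ _ sg] that unfolding cl by blast
  show rep: "g \<in> carrier F \<and> tensor_class K A B g = tensor_class K A B f"
    if "f \<in> carrier F" "g \<in> tensor_class K A B f" for f g
    using eqI[OF that] that F.a_r_coset_subset_G[OF N.a_subset] unfolding cl by blast
  show eq: "tensor_class K A B f = tensor_class K A B g \<longleftrightarrow> f \<ominus>\<^bsub>F\<^esub> g \<in> ?N"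
    if fg: "f \<in> carrier F" "g \<in> carrier F" for f g
  proof -
    have "f \<in> tensor_class K A B g \<longleftrightarrow> f \<ominus>\<^bsub>F\<^esub> g \<in> ?N"
      unfolding cl using N.a_rcos_module[OF fg(2,1)] by (simp add: F.minus_eq)
    then show ?thesis using self[OF fg(1)] eqI[OF fg(2)] by auto
  qed
  show "carrier T = tensor_class K A B ` carrier F"
    by (auto simp: T_def tensor_module_def Let_def cl F_def[symmetric] A_RCOSETS_def')
  show "\<zero>\<^bsub>T\<^esub> = tensor_class K A B \<zero>\<^bsub>F\<^esub>"
    unfolding cl using N.a_subset by (simp add: T_def tensor_module_def Let_def F_def[symmetric])
  show "tensor_class K A B f \<oplus>\<^bsub>T\<^esub> tensor_class K A B g = tensor_class K A B (f \<oplus>\<^bsub>F\<^esub> g)"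
    if "f \<in> carrier F" "g \<in> carrier F" for f g
    unfolding cl using that
    by (simp add: T_def tensor_module_def Let_def F_def[symmetric] N.a_rcos_sum)
  show "c \<odot>\<^bsub>T\<^esub> tensor_class K A B f = tensor_class K A B (c \<odot>\<^bsub>F\<^esub> f)"
    if cf: "c \<in> carrier K" "f \<in> carrier F" for c f
  proof -
    have "tensor_class K A B (c \<odot>\<^bsub>F\<^esub> g) = tensor_class K A B (c \<odot>\<^bsub>F\<^esub> f)"
      if g: "g \<in> tensor_class K A B f" for g
    proof -
      have gc: "g \<in> carrier F" and "tensor_class K A B g = tensor_class K A B f"
        using rep[OF cf(2) g] by auto
      then have "g \<ominus>\<^bsub>F\<^esub> f \<in> ?N" using eq cf by simp
      then have "c \<odot>\<^bsub>F\<^esub> (g \<ominus>\<^bsub>F\<^esub> f) \<in> ?N" using cf(1) submodule.smult_closed[OF sub] by blast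
      moreover have "c \<odot>\<^bsub>F\<^esub> (g \<ominus>\<^bsub>F\<^esub> f) = c \<odot>\<^bsub>F\<^esub> g \<ominus>\<^bsub>F\<^esub> c \<odot>\<^bsub>F\<^esub> f"
        using cf gc by (simp add: F.minus_eq F.smult_r_distr F.smult_r_minus)
      ultimately show ?thesis using eq cf gc by simp
    qed
    then have "(\<Union>g \<in> tensor_class K A B f. tensor_class K A B (c \<odot>\<^bsub>F\<^esub> g))
        = tensor_class K A B (c \<odot>\<^bsub>F\<^esub> f)"
      using self[OF cf(2)] by blast
    then show ?thesis
      by (simp add: T_def tensor_module_def Let_def F_def[symmetric] cl)
  qed
qed

lemma tensor_module_is_module:
  assumes "module K A" "module K B"
  shows "module K (tensor_module K A B)"
proof -
  interpret A: module K A by fact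
  let ?F = "free_on_pairs K A B"
  interpret F: module K ?F by (rule free_module_is_module) (rule A.is_cring)
  note C = tensor_module_class(2,4-7)[OF assms]
  let ?c = "tensor_class K A B"
  have "\<exists>g \<in> carrier ?F. ?c g \<oplus>\<^bsub>tensor_module K A B\<^esub> ?c f = \<zero>\<^bsub>tensor_module K A B\<^esub>"
    if "f \<in> carrier ?F" for f
    using that by (intro bexI[of _ "\<ominus>\<^bsub>?F\<^esub> f"]) (auto simp: C F.l_neg)
  then have "abelian_group (tensor_module K A B)"
    by (intro abelian_groupI) (auto simp: C F.a_ac)
  then show ?thesis
    by (intro moduleI A.is_cring)
      (auto simp: C F.smult_l_distr F.smult_r_distr F.smult_assoc1)
qed

lemma pure_tensor_closed:
  assumes "module K A" "module K B" "a \<in> carrier A" "b \<in> carrier B"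
  shows "pure_tensor K A B a b \<in> carrier (tensor_module K A B)"
proof -
  interpret A: module K A by fact
  have "basis_elt K (a, b) \<in> carrier (free_on_pairs K A B)"
    using assms by (intro basis_elt_pair_closed A.is_cring)
  then show ?thesis
    unfolding pure_tensor_class carrier_tensor_module[OF assms(1,2)] by blast
qed

lemma pure_tensor_bilinear:
  assumes "module K A" "module K B"
  shows "bilinear_map K A B (tensor_module K A B) (pure_tensor K A B)"
proof -
  interpret A: module K A by fact
  interpret B: module K B by fact
  let ?F = "free_on_pairs K A B"
  interpret F: module K ?F by (rule free_module_is_module) (rule A.is_cring)
  note C = tensor_module_class(2,4-7)[OF assms]
  note e = basis_elt_pair_closed[OF A.is_cring]
  have rel: "tensor_class K A B f = tensor_class K A B g"
    if "f \<ominus>\<^bsub>?F\<^esub> g \<in> bilinearity_relators K A B" "f \<in> carrier ?F" "g \<in> carrier ?F" for f g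
    using that relators_in_bilinearity_submodule[OF assms] by (auto simp: C)
  have add: "tensor_class K A B (basis_elt K (a, b) \<oplus>\<^bsub>?F\<^esub> basis_elt K (a', b')) =
      pure_tensor K A B a b \<oplus>\<^bsub>tensor_module K A B\<^esub> pure_tensor K A B a' b'"
    if "a \<in> carrier A" "b \<in> carrier B" "a' \<in> carrier A" "b' \<in> carrier B" for a b a' b'
    using that by (simp add: add_tensor_module[OF assms] e pure_tensor_class)
  have smult: "tensor_class K A B (c \<odot>\<^bsub>?F\<^esub> basis_elt K (a, b)) =
      c \<odot>\<^bsub>tensor_module K A B\<^esub> pure_tensor K A B a b"
    if "a \<in> carrier A" "b \<in> carrier B" "c \<in> carrier K" for a b c
    using that by (simp add: smult_tensor_module[OF assms] e pure_tensor_class)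
  show ?thesis
  proof (intro bilinear_mapI linear_mapI)
    fix a b b' assume "a \<in> carrier A" "b \<in> carrier B" "b' \<in> carrier B"
    then show "pure_tensor K A B a (b \<oplus>\<^bsub>B\<^esub> b') =
        pure_tensor K A B a b \<oplus>\<^bsub>tensor_module K A B\<^esub> pure_tensor K A B a b'"
      by (simp only: add[symmetric], simp only: pure_tensor_class, intro rel) (auto simp: bilinearity_relators_def Let_def e)
  next
    fix a a' b assume "a \<in> carrier A" "b \<in> carrier B" "a' \<in> carrier A"
    then show "pure_tensor K A B (a \<oplus>\<^bsub>A\<^esub> a') b =
        pure_tensor K A B a b \<oplus>\<^bsub>tensor_module K A B\<^esub> pure_tensor K A B a' b"
      by (simp only: add[symmetric], simp only: pure_tensor_class, intro rel) (auto simp: bilinearity_relators_def Let_def e)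
  next
    fix c a b assume "a \<in> carrier A" "b \<in> carrier B" "c \<in> carrier K"
    then show "pure_tensor K A B a (c \<odot>\<^bsub>B\<^esub> b) =
        c \<odot>\<^bsub>tensor_module K A B\<^esub> pure_tensor K A B a b"
      by (simp only: smult[symmetric], simp only: pure_tensor_class, intro rel) (auto simp: bilinearity_relators_def Let_def e)
  next
    fix c a b assume "a \<in> carrier A" "b \<in> carrier B" "c \<in> carrier K"
    then show "pure_tensor K A B (c \<odot>\<^bsub>A\<^esub> a) b =
        c \<odot>\<^bsub>tensor_module K A B\<^esub> pure_tensor K A B a b"
      by (simp only: smult[symmetric], simp only: pure_tensor_class, intro rel) (auto simp: bilinearity_relators_def Let_def e)
  qed (auto intro: pure_tensor_closed assms)
qed

text \<open>Sums of pure tensors suffice, without scalars: \<open>c (a \<otimes> b)\<close> is the pure tensor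
  \<open>(c a) \<otimes> b\<close>, and zero is \<open>0 \<otimes> 0\<close>.\<close>

lemma tensor_module_induct [consumes 3, case_names pure add]:
  assumes "module K A" "module K B" "x \<in> carrier (tensor_module K A B)"
    and pure: "\<And>a b. a \<in> carrier A \<Longrightarrow> b \<in> carrier B \<Longrightarrow> P (pure_tensor K A B a b)"
    and add: "\<And>x y. x \<in> carrier (tensor_module K A B) \<Longrightarrow> y \<in> carrier (tensor_module K A B)
      \<Longrightarrow> P x \<Longrightarrow> P y \<Longrightarrow> P (x \<oplus>\<^bsub>tensor_module K A B\<^esub> y)"
  shows "P x"
proof -
  interpret A: module K A by fact
  interpret B: module K B by fact
  let ?F = "free_on_pairs K A B"
  interpret F: module K ?F by (rule free_module_is_module) (rule A.is_cring)
  note T = tensor_module_is_module[OF assms(1,2)]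
  note C = tensor_module_class(4-7)[OF assms(1,2)]
  note bil = pure_tensor_bilinear[OF assms(1,2)]
  note e = basis_elt_pair_closed[OF A.is_cring]
  have P: "P (tensor_class K A B f)" if "f \<in> carrier ?F" for f
    using A.is_cring that
  proof (induction rule: free_module_induct)
    case zero
    have "pure_tensor K A B \<zero>\<^bsub>A\<^esub> \<zero>\<^bsub>B\<^esub> = \<zero>\<^bsub>tensor_module K A B\<^esub>"
      by (rule linear_map_zero[OF assms(2) T bilinear_mapD(1)[OF bil]]) simp
    then show ?case using pure[of "\<zero>\<^bsub>A\<^esub>" "\<zero>\<^bsub>B\<^esub>"] by (simp add: C)
  next
    case (add c x f)
    obtain a b where x: "x = (a, b)" and ab: "a \<in> carrier A" "b \<in> carrier B"
      using add.hyps by auto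
    have "tensor_class K A B (c \<odot>\<^bsub>?F\<^esub> basis_elt K x \<oplus>\<^bsub>?F\<^esub> f) =
        pure_tensor K A B (c \<odot>\<^bsub>A\<^esub> a) b \<oplus>\<^bsub>tensor_module K A B\<^esub> tensor_class K A B f"
      using ab add.hyps
      by (simp add: linear_mapD(3)[OF bilinear_mapD(2)[OF bil]] x e pure_tensor_class[symmetric]
          add_tensor_module[OF assms(1,2), symmetric] smult_tensor_module[OF assms(1,2), symmetric])
    moreover have "tensor_class K A B f \<in> carrier (tensor_module K A B)"
      using add.hyps by (simp add: carrier_tensor_module[OF assms(1,2)])
    ultimately show ?case
      using ab add.hyps add.IH by (simp add: assms(5) pure pure_tensor_closed[OF assms(1,2)])
  qed
  with assms(3) show ?thesis by (auto simp: carrier_tensor_module[OF assms(1,2)])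
qed

text \<open>A linear extension that comes from a bilinear map vanishes on the relators, hence on
  the submodule that they generate, since its kernel is a submodule.\<close>

lemma tensor_lift_class:
  assumes "module K A" "module K B" "module K M" "bilinear_map K A B M \<phi>"
    and "f \<in> carrier (free_on_pairs K A B)"
  shows "tensor_lift K M \<phi> (tensor_class K A B f)
    = linear_extension K M (\<lambda>p. \<phi> (fst p) (snd p)) f"
proof -
  interpret A: module K A by fact
  interpret B: module K B by fact
  interpret M: module K M by fact
  let ?F = "free_on_pairs K A B"
  interpret F: module K ?F by (rule free_module_is_module) (rule A.is_cring)
  let ?\<phi> = "\<lambda>p. \<phi> (fst p) (snd p)"
  let ?L = "linear_extension K M ?\<phi>"
  have \<phi>: "?\<phi> p \<in> carrier M" if "p \<in> carrier A \<times> carrier B" for p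
    using that by (auto intro: bilinear_map_closed[OF assms(4)])
  have lin: "linear_map K ?F M ?L"
    by (rule linear_extension_linear[OF assms(3) \<phi>])
  note L = linear_mapD[OF lin]
  have neg: "?L (\<ominus>\<^bsub>?F\<^esub> f) = \<ominus>\<^bsub>M\<^esub> ?L f" if "f \<in> carrier ?F" for f
  proof -
    have "?L (\<ominus>\<^bsub>?F\<^esub> f) \<oplus>\<^bsub>M\<^esub> ?L f = \<zero>\<^bsub>M\<^esub>"
      using L(2)[of "\<ominus>\<^bsub>?F\<^esub> f" f] that linear_map_zero[OF F.module_axioms assms(3) lin]
      by (simp add: F.l_neg)
    then show ?thesis using that L(1) by (simp add: M.minus_equality)
  qed
  have diff: "?L (f \<ominus>\<^bsub>?F\<^esub> g) = ?L f \<ominus>\<^bsub>M\<^esub> ?L g" if "f \<in> carrier ?F" "g \<in> carrier ?F" for f g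
    using that by (simp add: F.minus_eq M.minus_eq L(2) neg)
  \<comment> \<open>The kernel of the linear extension.\<close>
  let ?Z = "{f \<in> carrier ?F. ?L f = \<zero>\<^bsub>M\<^esub>}"
  have "submodule ?Z K ?F"
    using linear_map_zero[OF F.module_axioms assms(3) lin]
    by (intro F.submoduleI) (auto simp: neg L)
  moreover have "bilinearity_relators K A B \<subseteq> ?Z"
  proof
    note e = basis_elt_pair_closed[OF A.is_cring]
    have Le: "?L (basis_elt K (a, b)) = \<phi> a b" if "a \<in> carrier A" "b \<in> carrier B" for a b
      using linear_extension_basis_elt[OF assms(3), where \<phi> = ?\<phi> and X = "carrier A \<times> carrier B" and x = "(a, b)"] that \<phi>
      by simp
    note l = linear_mapD[OF bilinear_mapD(1)[OF assms(4)]]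
    note r = linear_mapD[OF bilinear_mapD(2)[OF assms(4)]]
    fix f assume "f \<in> bilinearity_relators K A B"
    then show "f \<in> ?Z"
      using bilinearity_relators_closed[OF assms(1,2)] unfolding bilinearity_relators_def Let_def
      by (auto simp: e diff Le L(2,3) l(2,3) r(2,3) M.minus_eq M.r_neg l(1))
  qed
  ultimately have Z: "bilinearity_submodule K A B \<subseteq> ?Z"
    unfolding bilinearity_submodule_def by blast
  define g where "g = (SOME g. g \<in> tensor_class K A B f)"
  have "g \<in> tensor_class K A B f"
    unfolding g_def using tensor_class_self[OF assms(1,2,5)] by (rule someI[of "\<lambda>g. g \<in> tensor_class K A B f"])
  then have g: "g \<in> carrier ?F" "tensor_class K A B g = tensor_class K A B f"
    using tensor_class_rep[OF assms(1,2,5)] by auto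
  then have "g \<ominus>\<^bsub>?F\<^esub> f \<in> ?Z"
    using Z tensor_class_eq_iff[OF assms(1,2) _ assms(5)] by blast
  then have "?L g \<oplus>\<^bsub>M\<^esub> \<ominus>\<^bsub>M\<^esub> ?L f = \<zero>\<^bsub>M\<^esub>" using g assms(5) by (simp add: diff M.minus_eq)
  then have "?L g = ?L f"
    using M.minus_equality[of "?L g" "\<ominus>\<^bsub>M\<^esub> ?L f"] g assms(5) by (simp add: L)
  then show ?thesis
    by (simp add: tensor_lift_def Let_def g_def linear_extension_def)
qed

lemma tensor_lift_linear:
  assumes "module K A" "module K B" "module K M" "bilinear_map K A B M \<phi>"
  shows "linear_map K (tensor_module K A B) M (tensor_lift K M \<phi>)"
proof -
  interpret A: module K A by fact
  let ?F = "free_on_pairs K A B"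
  interpret F: module K ?F by (rule free_module_is_module) (rule A.is_cring)
  have "linear_map K ?F M (linear_extension K M (\<lambda>p. \<phi> (fst p) (snd p)))"
    by (rule linear_extension_linear[OF assms(3)]) (auto intro: bilinear_map_closed[OF assms(4)])
  note L = linear_mapD[OF this]
  show ?thesis
    by (rule linear_mapI)
      (auto simp: tensor_module_class(4-7)[OF assms(1,2)] tensor_lift_class[OF assms] L)
qed

lemma tensor_lift_pure:
  assumes "module K A" "module K B" "module K M" "bilinear_map K A B M \<phi>"
    and "a \<in> carrier A" "b \<in> carrier B"
  shows "tensor_lift K M \<phi> (pure_tensor K A B a b) = \<phi> a b"
proof -
  interpret A: module K A by fact
  have "basis_elt K (a, b) \<in> carrier (free_on_pairs K A B)"
    using assms by (intro basis_elt_pair_closed A.is_cring)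
  then show ?thesis
    using linear_extension_basis_elt[OF assms(3), where X = "carrier A \<times> carrier B"
        and \<phi> = "\<lambda>p. \<phi> (fst p) (snd p)" and x = "(a, b)"] assms(5,6)
    by (simp add: pure_tensor_class tensor_lift_class[OF assms(1-4)] mem_Times_iff
        bilinear_map_closed[OF assms(4)])
qed

lemma linear_map_tensor_ext:
  assumes "module K A" "module K B"
    and "linear_map K (tensor_module K A B) M f" "linear_map K (tensor_module K A B) M g"
    and "\<And>a b. a \<in> carrier A \<Longrightarrow> b \<in> carrier B
      \<Longrightarrow> f (pure_tensor K A B a b) = g (pure_tensor K A B a b)"
    and "x \<in> carrier (tensor_module K A B)"
  shows "f x = g x"
  using assms(1,2,6)
proof (induction rule: tensor_module_induct)
  case (add x y)
  then show ?case by (simp add: linear_mapD[OF assms(3)] linear_mapD[OF assms(4)])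
qed (use assms(5) in auto)

text \<open>A family of bilinear maps that depends linearly on a parameter has lifts that depend
  linearly on it.  Lifts of trilinear and quadrilinear maps are built with this.\<close>

lemma tensor_lift_parameter:
  assumes "module K A" "module K B" "module K M"
    and bil: "\<And>c. c \<in> carrier C \<Longrightarrow> bilinear_map K A B M (\<phi> c)"
    and lin: "\<And>a b. a \<in> carrier A \<Longrightarrow> b \<in> carrier B \<Longrightarrow> linear_map K C M (\<lambda>c. \<phi> c a b)"
    and "module K C"
  shows "bilinear_map K (tensor_module K A B) C M (\<lambda>t c. tensor_lift K M (\<phi> c) t)"
proof (rule bilinear_mapI)
  fix c assume "c \<in> carrier C"
  then show "linear_map K (tensor_module K A B) M (tensor_lift K M (\<phi> c))"
    by (intro tensor_lift_linear assms(1-3) bil)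
next
  interpret M: module K M by fact
  interpret C: module K C by fact
  fix t assume t: "t \<in> carrier (tensor_module K A B)"
  note l = tensor_lift_linear[OF assms(1-3) bil]
  note p = tensor_lift_pure[OF assms(1-3) bil]
  show "linear_map K C M (\<lambda>c. tensor_lift K M (\<phi> c) t)"
  proof (rule linear_mapI)
    show "tensor_lift K M (\<phi> c) t \<in> carrier M" if "c \<in> carrier C" for c
      using linear_mapD(1)[OF l] that t by blast
  next
    fix c d assume cd: "c \<in> carrier C" "d \<in> carrier C"
    let ?r = "\<lambda>t. tensor_lift K M (\<phi> c) t \<oplus>\<^bsub>M\<^esub> tensor_lift K M (\<phi> d) t"
    have "linear_map K (tensor_module K A B) M ?r"
      using cd by (intro linear_mapI)
        (simp_all add: linear_mapD[OF l] M.a_ac M.smult_r_distr)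
    then show "tensor_lift K M (\<phi> (c \<oplus>\<^bsub>C\<^esub> d)) t = ?r t"
      by (rule linear_map_tensor_ext[OF assms(1,2) l, where g = ?r, rotated])
        (use cd t in \<open>simp_all add: p linear_mapD[OF lin]\<close>)
  next
    fix k c assume kc: "k \<in> carrier K" "c \<in> carrier C"
    let ?r = "\<lambda>t. k \<odot>\<^bsub>M\<^esub> tensor_lift K M (\<phi> c) t"
    have "linear_map K (tensor_module K A B) M ?r"
      using kc by (intro linear_mapI)
        (simp_all add: linear_mapD[OF l] M.smult_r_distr M.smult_assoc1[symmetric] M.R.m_comm)
    then show "tensor_lift K M (\<phi> (k \<odot>\<^bsub>C\<^esub> c)) t = ?r t"
      by (rule linear_map_tensor_ext[OF assms(1,2) l, where g = ?r, rotated])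
        (use kc t in \<open>simp_all add: p linear_mapD[OF lin]\<close>)
  qed
qed

section \<open>Tensor products of algebras\<close>

text \<open>Associative unital algebras over \<open>K\<close>, not necessarily commutative.\<close>

locale k_algebra = V?: module K A + A?: ring A
  for K :: "('k, 'm) ring_scheme" and A :: "('k, 'a, 'p) module_scheme" +
  assumes smult_mult_left: "\<lbrakk>c \<in> carrier K; x \<in> carrier A; y \<in> carrier A\<rbrakk>
        \<Longrightarrow> (c \<odot>\<^bsub>A\<^esub> x) \<otimes>\<^bsub>A\<^esub> y = c \<odot>\<^bsub>A\<^esub> (x \<otimes>\<^bsub>A\<^esub> y)"
    and smult_mult_right: "\<lbrakk>c \<in> carrier K; x \<in> carrier A; y \<in> carrier A\<rbrakk>
        \<Longrightarrow> x \<otimes>\<^bsub>A\<^esub> (c \<odot>\<^bsub>A\<^esub> y) = c \<odot>\<^bsub>A\<^esub> (x \<otimes>\<^bsub>A\<^esub> y)"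

lemma k_algebra_module: "k_algebra K A \<Longrightarrow> module K A"
  by (simp add: k_algebra_def)

lemma k_algebra_monoid: "k_algebra K A \<Longrightarrow> monoid A"
  by (simp add: k_algebra_def ring_def)

lemma k_algebra_mult_bilinear:
  assumes "k_algebra K A"
  shows "bilinear_map K A A A (\<otimes>\<^bsub>A\<^esub>)"
proof -
  interpret k_algebra K A by fact
  show ?thesis
    by (intro bilinear_mapI linear_mapI)
      (simp_all add: l_distr r_distr smult_mult_left smult_mult_right)
qed

text \<open>The predicates depend on the algebraic structure only, not on further record fields.\<close>

lemma module_record_cong:
  assumes "module K M" "carrier M' = carrier M" "add M' = add M" "zero M' = zero M"
    "smult M' = smult M"
  shows "module K M'"
proof -
  interpret M: module K M by fact
  have "abelian_group M'"
    using M.add.l_inv_ex by (intro abelian_groupI) (auto simp: assms(2-) M.a_ac)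
  then show ?thesis
    by (intro moduleI M.is_cring)
      (auto simp: assms(2-) M.smult_l_distr M.smult_r_distr M.smult_assoc1)
qed

lemma k_algebra_record_cong:
  assumes "k_algebra K A" "carrier A' = carrier A" "add A' = add A" "zero A' = zero A"
    "smult A' = smult A" "mult A' = mult A" "one A' = one A"
  shows "k_algebra K A'"
proof -
  interpret A: k_algebra K A by fact
  interpret A': module K A' by (rule module_record_cong[OF A.module_axioms assms(2-5)])
  have "ring A'"
    using A'.abelian_group_axioms
    by (intro ringI monoidI)
      (auto simp: assms(2-) A.A.m_assoc A.A.l_distr A.A.r_distr)
  then show ?thesis
    by (intro k_algebra.intro A'.module_axioms k_algebra_axioms.intro)
      (auto simp: assms(2-) A.smult_mult_left A.smult_mult_right)
qed

lemma tensor_algebra_fields: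
  "carrier (tensor_algebra K A B) = carrier (tensor_module K A B)"
  "add (tensor_algebra K A B) = add (tensor_module K A B)"
  "zero (tensor_algebra K A B) = zero (tensor_module K A B)"
  "smult (tensor_algebra K A B) = smult (tensor_module K A B)"
  "one (tensor_algebra K A B) = pure_tensor K A B \<one>\<^bsub>A\<^esub> \<one>\<^bsub>B\<^esub>"
  "mult (tensor_algebra K A B) = (\<lambda>X Y. tensor_lift K (tensor_module K A B) (\<lambda>a b.
      tensor_lift K (tensor_module K A B) (\<lambda>a' b'.
        pure_tensor K A B (a \<otimes>\<^bsub>A\<^esub> a') (b \<otimes>\<^bsub>B\<^esub> b')) Y) X)"
  by (simp_all add: tensor_algebra_def Let_def)

lemma linear_map_tensor_algebra:
  "linear_map K (tensor_algebra K A B) M f = linear_map K (tensor_module K A B) M f"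
  "linear_map K M (tensor_algebra K A B) g = linear_map K M (tensor_module K A B) g"
  by (simp_all add: linear_map_def tensor_algebra_fields)

lemma tensor_algebra_is_module:
  assumes "module K A" "module K B"
  shows "module K (tensor_algebra K A B)"
  by (rule module_record_cong[OF tensor_module_is_module[OF assms]])
    (simp_all add: tensor_algebra_fields)

lemma pure_tensor_linear:
  assumes "module K A" "module K B"
  shows "a \<in> carrier A \<Longrightarrow> linear_map K B (tensor_algebra K A B) (pure_tensor K A B a)"
    and "b \<in> carrier B \<Longrightarrow> linear_map K A (tensor_algebra K A B) (\<lambda>a. pure_tensor K A B a b)"
  using pure_tensor_bilinear[OF assms]
  by (auto simp: linear_map_tensor_algebra dest: bilinear_mapD)

lemma pure_tensor_bilinear_algebra:
  assumes "module K A" "module K B"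
  shows "bilinear_map K A B (tensor_algebra K A B) (pure_tensor K A B)"
  using pure_tensor_linear[OF assms] by (auto intro: bilinear_mapI)

lemma bilinear_map_compose:
  assumes "bilinear_map K C D M \<phi>" "linear_map K A C f" "linear_map K B D g"
  shows "bilinear_map K A B M (\<lambda>a b. \<phi> (f a) (g b))"
  using linear_map_compose[OF assms(3) bilinear_mapD(1)[OF assms(1)]]
    linear_map_compose[OF assms(2) bilinear_mapD(2)[OF assms(1)]]
    linear_mapD(1)[OF assms(2)] linear_mapD(1)[OF assms(3)]
  by (intro bilinear_mapI) auto

lemma pure_tensor_mult_bilinear:
  assumes "k_algebra K A" "k_algebra K B" "a \<in> carrier A" "b \<in> carrier B"
  shows "bilinear_map K A B (tensor_module K A B)
    (\<lambda>a' b'. pure_tensor K A B (a \<otimes>\<^bsub>A\<^esub> a') (b \<otimes>\<^bsub>B\<^esub> b'))"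
  by (intro bilinear_map_compose[OF pure_tensor_bilinear] k_algebra_module assms(1,2)
      bilinear_mapD(1)[OF k_algebra_mult_bilinear] assms(3,4))

text \<open>The product of a tensor product of algebras is defined by two nested lifts; this is the
  bilinearity that makes the outer one well defined.\<close>

lemma tensor_mult_inner_bilinear:
  assumes "k_algebra K A" "k_algebra K B" "Y \<in> carrier (tensor_module K A B)"
  shows "bilinear_map K A B (tensor_module K A B) (\<lambda>a b.
    tensor_lift K (tensor_module K A B) (\<lambda>a' b'.
      pure_tensor K A B (a \<otimes>\<^bsub>A\<^esub> a') (b \<otimes>\<^bsub>B\<^esub> b')) Y)"
proof -
  let ?T = "tensor_module K A B"
  note M = assms(1,2)[THEN k_algebra_module]
  note T = tensor_module_is_module[OF M]
  note bil = pure_tensor_mult_bilinear[OF assms(1,2)]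
  note rm = bilinear_mapD(2)[OF k_algebra_mult_bilinear]
  note cl = bilinear_map_closed[OF k_algebra_mult_bilinear]
  note pl = bilinear_mapD[OF pure_tensor_bilinear[OF M]]
  show ?thesis
  proof (rule bilinear_mapI)
    show "linear_map K B ?T (\<lambda>b. tensor_lift K ?T (\<lambda>a' b'.
        pure_tensor K A B (a \<otimes>\<^bsub>A\<^esub> a') (b \<otimes>\<^bsub>B\<^esub> b')) Y)" if "a \<in> carrier A" for a
      using bil linear_map_compose[OF rm[OF assms(2)] pl(1)[OF cl[OF assms(1)]]] that assms(3)
      by (intro bilinear_mapD(1)[OF tensor_lift_parameter[OF M T _ _ M(2)]]) auto
    show "linear_map K A ?T (\<lambda>a. tensor_lift K ?T (\<lambda>a' b'.
        pure_tensor K A B (a \<otimes>\<^bsub>A\<^esub> a') (b \<otimes>\<^bsub>B\<^esub> b')) Y)" if "b \<in> carrier B" for b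
      using bil linear_map_compose[OF rm[OF assms(1)] pl(2)[OF cl[OF assms(2)]]] that assms(3)
      by (intro bilinear_mapD(1)[OF tensor_lift_parameter[OF M T _ _ M(1)]]) auto
  qed
qed

lemma tensor_algebra_mult_bilinear:
  assumes "k_algebra K A" "k_algebra K B"
  shows "bilinear_map K (tensor_algebra K A B) (tensor_algebra K A B) (tensor_algebra K A B)
    (\<otimes>\<^bsub>tensor_algebra K A B\<^esub>)"
proof -
  let ?T = "tensor_module K A B"
  note M = assms[THEN k_algebra_module]
  note T = tensor_module_is_module[OF M]
  have "bilinear_map K ?T ?T ?T (\<lambda>X Y. tensor_lift K ?T (\<lambda>a b.
      tensor_lift K ?T (\<lambda>a' b'. pure_tensor K A B (a \<otimes>\<^bsub>A\<^esub> a') (b \<otimes>\<^bsub>B\<^esub> b')) Y) X)"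
    using pure_tensor_mult_bilinear[OF assms]
    by (intro tensor_lift_parameter M T tensor_lift_linear tensor_mult_inner_bilinear[OF assms])
  then show ?thesis
    by (simp add: bilinear_map_def linear_map_tensor_algebra tensor_algebra_fields)
qed

lemma pure_tensor_mult:
  assumes "k_algebra K A" "k_algebra K B"
    and "a \<in> carrier A" "b \<in> carrier B" "a' \<in> carrier A" "b' \<in> carrier B"
  shows "pure_tensor K A B a b \<otimes>\<^bsub>tensor_algebra K A B\<^esub> pure_tensor K A B a' b'
    = pure_tensor K A B (a \<otimes>\<^bsub>A\<^esub> a') (b \<otimes>\<^bsub>B\<^esub> b')"
proof -
  note M = assms(1,2)[THEN k_algebra_module]
  note T = tensor_module_is_module[OF M]
  have "pure_tensor K A B a' b' \<in> carrier (tensor_module K A B)"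
    using pure_tensor_closed[OF M] assms by blast
  then show ?thesis
    using assms
    by (simp add: tensor_algebra_fields tensor_lift_pure[OF M T]
        tensor_mult_inner_bilinear[OF assms(1,2)] pure_tensor_mult_bilinear[OF assms(1,2)])
qed

lemma tensor_algebra_induct [consumes 3, case_names pure add]:
  assumes "module K A" "module K B" "x \<in> carrier (tensor_algebra K A B)"
    and "\<And>a b. a \<in> carrier A \<Longrightarrow> b \<in> carrier B \<Longrightarrow> P (pure_tensor K A B a b)"
    and "\<And>x y. x \<in> carrier (tensor_algebra K A B) \<Longrightarrow> y \<in> carrier (tensor_algebra K A B)
      \<Longrightarrow> P x \<Longrightarrow> P y \<Longrightarrow> P (x \<oplus>\<^bsub>tensor_algebra K A B\<^esub> y)"
  shows "P x"
  using tensor_module_induct[OF assms(1,2), of x P] assms(3-) by (simp add: tensor_algebra_fields)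

lemma tensor_algebra_is_k_algebra:
  assumes "k_algebra K A" "k_algebra K B"
  shows "k_algebra K (tensor_algebra K A B)"
proof -
  interpret A: k_algebra K A by fact
  interpret B: k_algebra K B by fact
  let ?T = "tensor_algebra K A B"
  interpret T: module K ?T
    by (rule tensor_algebra_is_module[OF A.module_axioms B.module_axioms])
  note bil = tensor_algebra_mult_bilinear[OF assms]
  note l = linear_mapD[OF bilinear_mapD(1)[OF bil]]
  note r = linear_mapD[OF bilinear_mapD(2)[OF bil]]
  have p: "pure_tensor K A B a b \<in> carrier ?T" if "a \<in> carrier A" "b \<in> carrier B" for a b
    using pure_tensor_closed[OF A.module_axioms B.module_axioms that]
    by (simp add: tensor_algebra_fields)
  note pm = pure_tensor_mult[OF assms]
  have 1: "(pure_tensor K A B a b \<otimes>\<^bsub>?T\<^esub> pure_tensor K A B a' b') \<otimes>\<^bsub>?T\<^esub> z =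
    pure_tensor K A B a b \<otimes>\<^bsub>?T\<^esub> (pure_tensor K A B a' b' \<otimes>\<^bsub>?T\<^esub> z)"
    if "a \<in> carrier A" "b \<in> carrier B" "a' \<in> carrier A" "b' \<in> carrier B" "z \<in> carrier ?T"
    for a b a' b' z
    using A.module_axioms B.module_axioms that(5)
  proof (induction rule: tensor_algebra_induct)
    case (pure a'' b'')
    then show ?case using that by (simp add: pm A.A.m_assoc B.A.m_assoc)
  next
    case (add x y)
    then show ?case using that p by (simp add: l)
  qed
  have 2: "(pure_tensor K A B a b \<otimes>\<^bsub>?T\<^esub> y) \<otimes>\<^bsub>?T\<^esub> z = pure_tensor K A B a b \<otimes>\<^bsub>?T\<^esub> (y \<otimes>\<^bsub>?T\<^esub> z)"
    if "a \<in> carrier A" "b \<in> carrier B" "y \<in> carrier ?T" "z \<in> carrier ?T" for a b y z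
    using A.module_axioms B.module_axioms that(3)
  proof (induction rule: tensor_algebra_induct)
    case (add x y)
    then show ?case using that p by (simp add: l r)
  qed (use 1 that in auto)
  have 3: "(x \<otimes>\<^bsub>?T\<^esub> y) \<otimes>\<^bsub>?T\<^esub> z = x \<otimes>\<^bsub>?T\<^esub> (y \<otimes>\<^bsub>?T\<^esub> z)"
    if "x \<in> carrier ?T" "y \<in> carrier ?T" "z \<in> carrier ?T" for x y z
    using A.module_axioms B.module_axioms that(1)
  proof (induction rule: tensor_algebra_induct)
    case (add x y)
    then show ?case using that by (simp add: l r)
  qed (use 2 that in auto)
  have o: "\<one>\<^bsub>?T\<^esub> = pure_tensor K A B \<one>\<^bsub>A\<^esub> \<one>\<^bsub>B\<^esub>" by (simp add: tensor_algebra_fields)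
  have oc: "\<one>\<^bsub>?T\<^esub> \<in> carrier ?T" by (simp add: o p)
  have l1: "\<one>\<^bsub>?T\<^esub> \<otimes>\<^bsub>?T\<^esub> x = x" if "x \<in> carrier ?T" for x
    using A.module_axioms B.module_axioms that
  proof (induction rule: tensor_algebra_induct)
    case (pure a b)
    then show ?case by (simp add: o pm)
  qed (simp add: l oc)
  have r1: "x \<otimes>\<^bsub>?T\<^esub> \<one>\<^bsub>?T\<^esub> = x" if "x \<in> carrier ?T" for x
    using A.module_axioms B.module_axioms that
  proof (induction rule: tensor_algebra_induct)
    case (pure a b)
    then show ?case by (simp add: o pm)
  qed (simp add: r oc)
  have "ring ?T"
    using T.abelian_group_axioms oc 3 l1 r1 by (intro ringI monoidI) (simp_all add: l r)
  then show ?thesis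
    by (intro k_algebra.intro T.module_axioms k_algebra_axioms.intro) (simp_all add: l r)
qed


section \<open>Algebra homomorphisms\<close>

text \<open>Unital algebra homomorphisms. That domain and codomain are algebras is part of the notion.\<close>

definition alg_hom ::
    "('k, 'm) ring_scheme \<Rightarrow> ('k, 'a, 'p) module_scheme \<Rightarrow> ('k, 'b, 'q) module_scheme
      \<Rightarrow> ('a \<Rightarrow> 'b) \<Rightarrow> bool" where
  "alg_hom K A B f \<longleftrightarrow> k_algebra K A \<and> k_algebra K B \<and> linear_map K A B f \<and> f \<in> ring_hom A B"

lemma alg_homI:
  assumes "k_algebra K A" "k_algebra K B" "linear_map K A B f"
    and "\<And>x y. x \<in> carrier A \<Longrightarrow> y \<in> carrier A \<Longrightarrow> f (x \<otimes>\<^bsub>A\<^esub> y) = f x \<otimes>\<^bsub>B\<^esub> f y"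
    and "f \<one>\<^bsub>A\<^esub> = \<one>\<^bsub>B\<^esub>"
  shows "alg_hom K A B f"
  using assms linear_mapD[OF assms(3)] by (auto simp: alg_hom_def ring_hom_def)

lemma alg_homD:
  assumes "alg_hom K A B f"
  shows "x \<in> carrier A \<Longrightarrow> f x \<in> carrier B"
    and "x \<in> carrier A \<Longrightarrow> y \<in> carrier A \<Longrightarrow> f (x \<oplus>\<^bsub>A\<^esub> y) = f x \<oplus>\<^bsub>B\<^esub> f y"
    and "c \<in> carrier K \<Longrightarrow> x \<in> carrier A \<Longrightarrow> f (c \<odot>\<^bsub>A\<^esub> x) = c \<odot>\<^bsub>B\<^esub> f x"
    and "x \<in> carrier A \<Longrightarrow> y \<in> carrier A \<Longrightarrow> f (x \<otimes>\<^bsub>A\<^esub> y) = f x \<otimes>\<^bsub>B\<^esub> f y"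
    and "f \<one>\<^bsub>A\<^esub> = \<one>\<^bsub>B\<^esub>"
  using assms by (auto simp: alg_hom_def ring_hom_def linear_map_def)

lemma alg_hom_linear: "alg_hom K A B f \<Longrightarrow> linear_map K A B f"
  by (simp add: alg_hom_def)

lemma alg_hom_dom: "alg_hom K A B f \<Longrightarrow> k_algebra K A"
  and alg_hom_cod: "alg_hom K A B f \<Longrightarrow> k_algebra K B"
  by (simp_all add: alg_hom_def)

lemma alg_hom_compose:
  assumes "alg_hom K A B g" "alg_hom K B C f"
  shows "alg_hom K A C (\<lambda>x. f (g x))"
  by (rule alg_homI[OF alg_hom_dom[OF assms(1)] alg_hom_cod[OF assms(2)]
        linear_map_compose[OF alg_hom_linear[OF assms(1)] alg_hom_linear[OF assms(2)]]])
    (simp_all add: alg_homD[OF assms(1)] alg_homD[OF assms(2)])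

lemma alg_hom_id:
  assumes "k_algebra K A"
  shows "alg_hom K A A id" "alg_hom K A A (\<lambda>x. x)"
  using assms by (auto simp: alg_hom_def linear_map_def ring_hom_def)

lemma alg_hom_cong:
  assumes "alg_hom K A B f" "\<And>x. x \<in> carrier A \<Longrightarrow> f x = g x"
  shows "alg_hom K A B g"
proof -
  interpret A: k_algebra K A by (rule alg_hom_dom[OF assms(1)])
  show ?thesis
    by (intro alg_homI linear_mapI alg_hom_dom[OF assms(1)] alg_hom_cod[OF assms(1)])
      (simp_all add: alg_homD[OF assms(1)] assms(2)[symmetric])
qed

lemma alg_hom_Units:
  assumes "alg_hom K A B f" "u \<in> Units A"
  shows "f u \<in> Units B" "f (inv\<^bsub>A\<^esub> u) = inv\<^bsub>B\<^esub> (f u)"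
proof -
  interpret A: monoid A by (rule k_algebra_monoid[OF alg_hom_dom[OF assms(1)]])
  interpret B: monoid B by (rule k_algebra_monoid[OF alg_hom_cod[OF assms(1)]])
  note f = alg_homD[OF assms(1)]
  have u: "u \<in> carrier A" "inv\<^bsub>A\<^esub> u \<in> carrier A" using assms(2) by auto
  have 1: "f u \<otimes>\<^bsub>B\<^esub> f (inv\<^bsub>A\<^esub> u) = \<one>\<^bsub>B\<^esub>" "f (inv\<^bsub>A\<^esub> u) \<otimes>\<^bsub>B\<^esub> f u = \<one>\<^bsub>B\<^esub>"
    using assms(2) u by (simp_all add: f(4)[symmetric] f(5))
  then show "f u \<in> Units B" using u f(1) by (auto simp: Units_def)
  show "f (inv\<^bsub>A\<^esub> u) = inv\<^bsub>B\<^esub> (f u)"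
    using B.inv_unique'[of "f u" "f (inv\<^bsub>A\<^esub> u)"] 1 u f(1) by simp
qed

lemma pure_tensor_closed_algebra:
  assumes "k_algebra K A" "k_algebra K B" "a \<in> carrier A" "b \<in> carrier B"
  shows "pure_tensor K A B a b \<in> carrier (tensor_algebra K A B)"
  using pure_tensor_closed[OF assms(1,2)[THEN k_algebra_module] assms(3,4)]
  by (simp add: tensor_algebra_fields)

lemma tensor_algebra_one:
  "\<one>\<^bsub>tensor_algebra K A B\<^esub> = pure_tensor K A B \<one>\<^bsub>A\<^esub> \<one>\<^bsub>B\<^esub>"
  by (simp add: tensor_algebra_fields)

lemma tensor_lift_linear_algebra:
  assumes "module K A" "module K B" "module K M" "bilinear_map K A B M \<phi>"
  shows "linear_map K (tensor_algebra K A B) M (tensor_lift K M \<phi>)"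
  using tensor_lift_linear[OF assms] by (simp add: linear_map_tensor_algebra)

text \<open>Multiplicativity of lifts can be checked on pure tensors.\<close>

lemma tensor_lift_mult:
  assumes alg: "k_algebra K A" "k_algebra K B" "k_algebra K M"
    and bil: "bilinear_map K A B M \<phi>" "bilinear_map K A B M \<phi>'" "bilinear_map K A B M \<phi>''"
    and mult: "\<And>a b a' b'. a \<in> carrier A \<Longrightarrow> b \<in> carrier B \<Longrightarrow> a' \<in> carrier A \<Longrightarrow> b' \<in> carrier B
      \<Longrightarrow> \<phi>'' (a \<otimes>\<^bsub>A\<^esub> a') (b \<otimes>\<^bsub>B\<^esub> b') = \<phi> a b \<otimes>\<^bsub>M\<^esub> \<phi>' a' b'"
    and t: "t \<in> carrier (tensor_algebra K A B)" "t' \<in> carrier (tensor_algebra K A B)"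
  shows "tensor_lift K M \<phi>'' (t \<otimes>\<^bsub>tensor_algebra K A B\<^esub> t')
    = tensor_lift K M \<phi> t \<otimes>\<^bsub>M\<^esub> tensor_lift K M \<phi>' t'"
proof -
  interpret A: k_algebra K A by fact
  interpret B: k_algebra K B by fact
  interpret M: k_algebra K M by fact
  interpret T: k_algebra K "tensor_algebra K A B" by (rule tensor_algebra_is_k_algebra[OF alg(1,2)])
  note mod = A.module_axioms B.module_axioms M.module_axioms
  note lift = tensor_lift_pure[OF mod] linear_mapD[OF tensor_lift_linear_algebra[OF mod]]
  note pc = pure_tensor_closed_algebra[OF alg(1,2)]
  have 1: "tensor_lift K M \<phi>'' (pure_tensor K A B a b \<otimes>\<^bsub>tensor_algebra K A B\<^esub> t')
      = \<phi> a b \<otimes>\<^bsub>M\<^esub> tensor_lift K M \<phi>' t'" if "a \<in> carrier A" "b \<in> carrier B" for a b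
    using mod(1,2) t(2)
  proof (induction rule: tensor_algebra_induct)
    case (pure a' b')
    then show ?case using that by (simp add: pure_tensor_mult[OF alg(1,2)] lift bil mult)
  next
    case (add x y)
    then show ?case using that bilinear_map_closed[OF bil(1)]
      by (simp add: pc lift bil T.A.r_distr M.A.r_distr)
  qed
  show ?thesis using mod(1,2) t(1)
  proof (induction rule: tensor_algebra_induct)
    case (pure a b)
    then show ?case by (simp add: 1 lift bil)
  next
    case (add x y)
    then show ?case using t(2) by (simp add: lift bil T.A.l_distr M.A.l_distr)
  qed
qed

lemma tensor_lift_alg_hom:
  assumes "k_algebra K A" "k_algebra K B" "k_algebra K M" "bilinear_map K A B M \<phi>"
    and "\<phi> \<one>\<^bsub>A\<^esub> \<one>\<^bsub>B\<^esub> = \<one>\<^bsub>M\<^esub>"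
    and "\<And>a b a' b'. a \<in> carrier A \<Longrightarrow> b \<in> carrier B \<Longrightarrow> a' \<in> carrier A \<Longrightarrow> b' \<in> carrier B
      \<Longrightarrow> \<phi> (a \<otimes>\<^bsub>A\<^esub> a') (b \<otimes>\<^bsub>B\<^esub> b') = \<phi> a b \<otimes>\<^bsub>M\<^esub> \<phi> a' b'"
  shows "alg_hom K (tensor_algebra K A B) M (tensor_lift K M \<phi>)"
proof -
  interpret A: k_algebra K A by fact
  interpret B: k_algebra K B by fact
  note mod = assms(1-3)[THEN k_algebra_module]
  show ?thesis
    by (intro alg_homI tensor_algebra_is_k_algebra tensor_lift_linear_algebra mod
          tensor_lift_mult assms)
      (simp_all add: tensor_algebra_one tensor_lift_pure[OF mod] assms)
qed

text \<open>A homomorphism from \<open>A \<otimes> B\<close> is determined by its values on \<open>a \<otimes> 1\<close> and \<open>1 \<otimes> b\<close>. Since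
  all structure maps considered below are algebra homomorphisms, the identities between them are
  checked on these elements, if necessary repeatedly.\<close>

lemma alg_hom_tensor_ext:
  assumes "k_algebra K A" "k_algebra K B"
    and f: "alg_hom K (tensor_algebra K A B) M f" and g: "alg_hom K (tensor_algebra K A B) M g"
    and left: "\<And>a. a \<in> carrier A \<Longrightarrow> \<one>\<^bsub>B\<^esub> \<in> carrier B \<Longrightarrow>
      f (pure_tensor K A B a \<one>\<^bsub>B\<^esub>) = g (pure_tensor K A B a \<one>\<^bsub>B\<^esub>)"
    and right: "\<And>b. b \<in> carrier B \<Longrightarrow> \<one>\<^bsub>A\<^esub> \<in> carrier A \<Longrightarrow>
      f (pure_tensor K A B \<one>\<^bsub>A\<^esub> b) = g (pure_tensor K A B \<one>\<^bsub>A\<^esub> b)"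
    and x: "x \<in> carrier (tensor_algebra K A B)"
  shows "f x = g x"
proof -
  interpret A: k_algebra K A by fact
  interpret B: k_algebra K B by fact
  show ?thesis using A.module_axioms B.module_axioms x
  proof (induction rule: tensor_algebra_induct)
    case (pure a b)
    have "pure_tensor K A B a b = pure_tensor K A B a \<one>\<^bsub>B\<^esub>
        \<otimes>\<^bsub>tensor_algebra K A B\<^esub> pure_tensor K A B \<one>\<^bsub>A\<^esub> b"
      using pure by (simp add: pure_tensor_mult[OF assms(1,2)])
    then show ?case
      using pure left right
      by (simp add: alg_homD[OF f] alg_homD[OF g] pure_tensor_closed_algebra[OF assms(1,2)])
  qed (simp add: alg_homD[OF f] alg_homD[OF g])
qed

lemma alg_hom_pure_left:
  assumes "k_algebra K A" "k_algebra K B"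
  shows "alg_hom K A (tensor_algebra K A B) (\<lambda>a. pure_tensor K A B a \<one>\<^bsub>B\<^esub>)"
proof -
  interpret A: k_algebra K A by fact
  interpret B: k_algebra K B by fact
  show ?thesis
    by (intro alg_homI tensor_algebra_is_k_algebra assms pure_tensor_linear A.module_axioms
          B.module_axioms B.A.one_closed)
      (simp_all add: pure_tensor_mult[OF assms] tensor_algebra_one)
qed

lemma alg_hom_pure_right:
  assumes "k_algebra K A" "k_algebra K B"
  shows "alg_hom K B (tensor_algebra K A B) (pure_tensor K A B \<one>\<^bsub>A\<^esub>)"
proof -
  interpret A: k_algebra K A by fact
  interpret B: k_algebra K B by fact
  show ?thesis
    by (intro alg_homI tensor_algebra_is_k_algebra assms pure_tensor_linear A.module_axioms
          B.module_axioms A.A.one_closed)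
      (simp_all add: pure_tensor_mult[OF assms] tensor_algebra_one)
qed


subsection \<open>The canonical maps between tensor products\<close>

lemma tensor_map_props:
  assumes f: "alg_hom K A C f" and g: "alg_hom K B D g"
  shows tensor_map_alg_hom:
      "alg_hom K (tensor_algebra K A B) (tensor_algebra K C D) (tensor_map K C D f g)"
    and tensor_map_pure: "a \<in> carrier A \<Longrightarrow> b \<in> carrier B
      \<Longrightarrow> tensor_map K C D f g (pure_tensor K A B a b) = pure_tensor K C D (f a) (g b)"
proof -
  note alg = alg_hom_dom[OF f] alg_hom_dom[OF g] alg_hom_cod[OF f] alg_hom_cod[OF g]
  note mod = alg[THEN k_algebra_module]
  have bil: "bilinear_map K A B (tensor_algebra K C D) (\<lambda>a b. pure_tensor K C D (f a) (g b))"
    by (rule bilinear_map_compose[OF pure_tensor_bilinear_algebra[OF mod(3,4)]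
          alg_hom_linear[OF f] alg_hom_linear[OF g]])
  show "alg_hom K (tensor_algebra K A B) (tensor_algebra K C D) (tensor_map K C D f g)"
    unfolding tensor_map_def
    by (intro tensor_lift_alg_hom tensor_algebra_is_k_algebra alg bil)
      (simp_all add: alg_homD[OF f] alg_homD[OF g] tensor_algebra_one pure_tensor_mult[OF alg(3,4)])
  show "tensor_map K C D f g (pure_tensor K A B a b) = pure_tensor K C D (f a) (g b)"
    if "a \<in> carrier A" "b \<in> carrier B"
    unfolding tensor_map_def
    using that by (intro tensor_lift_pure tensor_algebra_is_module mod bil)
qed

lemma tensor_map_cong:
  assumes f: "alg_hom K A C f" and g: "alg_hom K B D g"
    and "\<And>a. a \<in> carrier A \<Longrightarrow> f a = f' a" "\<And>b. b \<in> carrier B \<Longrightarrow> g b = g' b"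
    and "x \<in> carrier (tensor_algebra K A B)"
  shows "tensor_map K C D f g x = tensor_map K C D f' g' x"
proof -
  have f': "alg_hom K A C f'" and g': "alg_hom K B D g'"
    using alg_hom_cong[OF f assms(3)] alg_hom_cong[OF g assms(4)] by auto
  show ?thesis
    by (rule alg_hom_tensor_ext[OF alg_hom_dom[OF f] alg_hom_dom[OF g]
          tensor_map_alg_hom[OF f g] tensor_map_alg_hom[OF f' g']])
      (simp_all add: tensor_map_pure[OF f g] tensor_map_pure[OF f' g'] assms)
qed

lemma tensor_map_compose:
  assumes f: "alg_hom K A C f" and g: "alg_hom K B D g"
    and f': "alg_hom K C C' f'" and g': "alg_hom K D D' g'"
    and "x \<in> carrier (tensor_algebra K A B)"
  shows "tensor_map K C' D' f' g' (tensor_map K C D f g x)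
    = tensor_map K C' D' (\<lambda>a. f' (f a)) (\<lambda>b. g' (g b)) x"
proof -
  note ff = alg_hom_compose[OF f f'] and gg = alg_hom_compose[OF g g']
  interpret C: k_algebra K C by (rule alg_hom_cod[OF f])
  interpret D: k_algebra K D by (rule alg_hom_cod[OF g])
  show ?thesis
    by (rule alg_hom_tensor_ext[OF alg_hom_dom[OF f] alg_hom_dom[OF g]
          alg_hom_compose[OF tensor_map_alg_hom[OF f g] tensor_map_alg_hom[OF f' g']]
          tensor_map_alg_hom[OF ff gg]])
      (simp_all add: tensor_map_pure[OF f g] tensor_map_pure[OF f' g'] tensor_map_pure[OF ff gg]
        alg_homD[OF f] alg_homD[OF g] assms(5))
qed

lemma tensor_map_id:
  assumes "k_algebra K A" "k_algebra K B" "x \<in> carrier (tensor_algebra K A B)"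
  shows "tensor_map K A B (\<lambda>a. a) (\<lambda>b. b) x = x"
proof -
  note i = alg_hom_id(2)[OF assms(1)] alg_hom_id(2)[OF assms(2)]
  show ?thesis
    by (rule alg_hom_tensor_ext[OF assms(1,2) tensor_map_alg_hom[OF i]
          alg_hom_id(2)[OF tensor_algebra_is_k_algebra[OF assms(1,2)]]])
      (simp_all add: tensor_map_pure[OF i] assms(3))
qed

lemma flip_props:
  assumes "k_algebra K A" "k_algebra K B"
  shows flip_alg_hom: "alg_hom K (tensor_algebra K A B) (tensor_algebra K B A) (flip K A B)"
    and flip_pure: "a \<in> carrier A \<Longrightarrow> b \<in> carrier B
      \<Longrightarrow> flip K A B (pure_tensor K A B a b) = pure_tensor K B A b a"
proof -
  note mod = assms[THEN k_algebra_module]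
  have bil: "bilinear_map K A B (tensor_algebra K B A) (\<lambda>a b. pure_tensor K B A b a)"
    using pure_tensor_linear[OF mod(2,1)] by (auto intro: bilinear_mapI)
  show "alg_hom K (tensor_algebra K A B) (tensor_algebra K B A) (flip K A B)"
    unfolding flip_def
    by (intro tensor_lift_alg_hom tensor_algebra_is_k_algebra assms bil)
      (simp_all add: tensor_algebra_one pure_tensor_mult[OF assms(2,1)])
  show "flip K A B (pure_tensor K A B a b) = pure_tensor K B A b a"
    if "a \<in> carrier A" "b \<in> carrier B"
    unfolding flip_def
    using that by (intro tensor_lift_pure mod tensor_algebra_is_module bil)
qed

lemma flip_flip:
  assumes "k_algebra K A" "k_algebra K B" "x \<in> carrier (tensor_algebra K A B)"
  shows "flip K B A (flip K A B x) = x"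
proof -
  show ?thesis
    by (rule alg_hom_tensor_ext[OF assms(1,2) alg_hom_compose[OF flip_alg_hom[OF assms(1,2)]
          flip_alg_hom[OF assms(2,1)]] alg_hom_id(2)[OF tensor_algebra_is_k_algebra[OF assms(1,2)]]])
      (simp_all add: flip_pure[OF assms(1,2)] flip_pure[OF assms(2,1)] assms(3))
qed

lemma flip_tensor_map:
  assumes f: "alg_hom K A C f" and g: "alg_hom K B D g"
    and "x \<in> carrier (tensor_algebra K A B)"
  shows "flip K C D (tensor_map K C D f g x) = tensor_map K D C g f (flip K A B x)"
proof -
  note alg = alg_hom_dom[OF f] alg_hom_dom[OF g] alg_hom_cod[OF f] alg_hom_cod[OF g]
  interpret C: k_algebra K C by (rule alg)
  interpret D: k_algebra K D by (rule alg)
  show ?thesis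
    by (rule alg_hom_tensor_ext[OF alg(1,2)
          alg_hom_compose[OF tensor_map_alg_hom[OF f g] flip_alg_hom[OF alg(3,4)]]
          alg_hom_compose[OF flip_alg_hom[OF alg(1,2)] tensor_map_alg_hom[OF g f]]])
      (simp_all add: tensor_map_pure[OF f g] tensor_map_pure[OF g f] flip_pure[OF alg(1,2)]
        flip_pure[OF alg(3,4)] alg_homD[OF f] alg_homD[OF g] assms(3))
qed

text \<open>Lifts of trilinear maps. The parameter \<open>c\<close> comes first in \<open>\<phi>\<close>, so that \<open>\<phi> c\<close> is the
  bilinear map that the inner lift is applied to.\<close>

lemma tensor_lift_lift:
  assumes alg: "k_algebra K A" "k_algebra K B" "k_algebra K C" "k_algebra K M"
    and bil: "\<And>c. c \<in> carrier C \<Longrightarrow> bilinear_map K A B M (\<phi> c)"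
    and lin: "\<And>a b. a \<in> carrier A \<Longrightarrow> b \<in> carrier B \<Longrightarrow> linear_map K C M (\<lambda>c. \<phi> c a b)"
  shows tensor_lift_lift_pure: "a \<in> carrier A \<Longrightarrow> b \<in> carrier B \<Longrightarrow> c \<in> carrier C \<Longrightarrow>
      tensor_lift K M (\<lambda>t c. tensor_lift K M (\<phi> c) t)
        (pure_tensor K (tensor_algebra K A B) C (pure_tensor K A B a b) c) = \<phi> c a b"
    and tensor_lift_lift_alg_hom: "\<lbrakk>\<phi> \<one>\<^bsub>C\<^esub> \<one>\<^bsub>A\<^esub> \<one>\<^bsub>B\<^esub> = \<one>\<^bsub>M\<^esub>;
      \<And>a b c a' b' c'. \<lbrakk>a \<in> carrier A; b \<in> carrier B; c \<in> carrier C;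
          a' \<in> carrier A; b' \<in> carrier B; c' \<in> carrier C\<rbrakk>
        \<Longrightarrow> \<phi> (c \<otimes>\<^bsub>C\<^esub> c') (a \<otimes>\<^bsub>A\<^esub> a') (b \<otimes>\<^bsub>B\<^esub> b') = \<phi> c a b \<otimes>\<^bsub>M\<^esub> \<phi> c' a' b'\<rbrakk> \<Longrightarrow>
      alg_hom K (tensor_algebra K (tensor_algebra K A B) C) M
        (tensor_lift K M (\<lambda>t c. tensor_lift K M (\<phi> c) t))"
proof -
  interpret A: k_algebra K A by fact
  interpret B: k_algebra K B by fact
  interpret C: k_algebra K C by fact
  note mod = alg[THEN k_algebra_module]
  note T = tensor_algebra_is_k_algebra[OF alg(1,2)]
  have b: "bilinear_map K (tensor_algebra K A B) C M (\<lambda>t c. tensor_lift K M (\<phi> c) t)"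
    using tensor_lift_parameter[OF mod(1,2,4) bil lin mod(3)]
    by (simp add: bilinear_map_def linear_map_tensor_algebra tensor_algebra_fields)
  show "tensor_lift K M (\<lambda>t c. tensor_lift K M (\<phi> c) t)
      (pure_tensor K (tensor_algebra K A B) C (pure_tensor K A B a b) c) = \<phi> c a b"
    if "a \<in> carrier A" "b \<in> carrier B" "c \<in> carrier C"
    using that tensor_lift_pure[OF k_algebra_module[OF T] mod(3,4) b]
    by (simp add: pure_tensor_closed_algebra alg tensor_lift_pure[OF mod(1,2,4) bil])
  show "alg_hom K (tensor_algebra K (tensor_algebra K A B) C) M
      (tensor_lift K M (\<lambda>t c. tensor_lift K M (\<phi> c) t))"
    if "\<phi> \<one>\<^bsub>C\<^esub> \<one>\<^bsub>A\<^esub> \<one>\<^bsub>B\<^esub> = \<one>\<^bsub>M\<^esub>"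
      and "\<And>a b c a' b' c'. \<lbrakk>a \<in> carrier A; b \<in> carrier B; c \<in> carrier C;
          a' \<in> carrier A; b' \<in> carrier B; c' \<in> carrier C\<rbrakk>
        \<Longrightarrow> \<phi> (c \<otimes>\<^bsub>C\<^esub> c') (a \<otimes>\<^bsub>A\<^esub> a') (b \<otimes>\<^bsub>B\<^esub> b') = \<phi> c a b \<otimes>\<^bsub>M\<^esub> \<phi> c' a' b'"
  proof (rule tensor_lift_alg_hom[OF T alg(3,4) b])
    show "tensor_lift K M (\<phi> \<one>\<^bsub>C\<^esub>) \<one>\<^bsub>tensor_algebra K A B\<^esub> = \<one>\<^bsub>M\<^esub>"
      by (simp add: tensor_algebra_one tensor_lift_pure[OF mod(1,2,4) bil] that(1))
    show "tensor_lift K M (\<phi> (c \<otimes>\<^bsub>C\<^esub> c')) (t \<otimes>\<^bsub>tensor_algebra K A B\<^esub> t') =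
        tensor_lift K M (\<phi> c) t \<otimes>\<^bsub>M\<^esub> tensor_lift K M (\<phi> c') t'"
      if "t \<in> carrier (tensor_algebra K A B)" "c \<in> carrier C"
        "t' \<in> carrier (tensor_algebra K A B)" "c' \<in> carrier C" for t c t' c'
      using that \<open>\<And>a b c a' b' c'. \<lbrakk>a \<in> carrier A; b \<in> carrier B; c \<in> carrier C;
          a' \<in> carrier A; b' \<in> carrier B; c' \<in> carrier C\<rbrakk>
        \<Longrightarrow> \<phi> (c \<otimes>\<^bsub>C\<^esub> c') (a \<otimes>\<^bsub>A\<^esub> a') (b \<otimes>\<^bsub>B\<^esub> b') = \<phi> c a b \<otimes>\<^bsub>M\<^esub> \<phi> c' a' b'\<close>
      by (intro tensor_lift_mult alg(1,2,4) bil) auto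
  qed
qed

lemma assoc_props:
  assumes alg: "k_algebra K A" "k_algebra K B" "k_algebra K C"
  shows assoc_alg_hom: "alg_hom K (tensor_algebra K (tensor_algebra K A B) C)
      (tensor_algebra K A (tensor_algebra K B C)) (assoc K A B C)"
    and assoc_pure: "a \<in> carrier A \<Longrightarrow> b \<in> carrier B \<Longrightarrow> c \<in> carrier C \<Longrightarrow>
      assoc K A B C (pure_tensor K (tensor_algebra K A B) C (pure_tensor K A B a b) c)
        = pure_tensor K A (tensor_algebra K B C) a (pure_tensor K B C b c)"
proof -
  interpret A: k_algebra K A by fact
  interpret B: k_algebra K B by fact
  interpret C: k_algebra K C by fact
  note BC = tensor_algebra_is_k_algebra[OF alg(2,3)]
  note M = tensor_algebra_is_k_algebra[OF alg(1) BC]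
  note mod = alg[THEN k_algebra_module] k_algebra_module[OF BC]
  let ?\<phi> = "\<lambda>c a b. pure_tensor K A (tensor_algebra K B C) a (pure_tensor K B C b c)"
  let ?M = "tensor_algebra K A (tensor_algebra K B C)"
  note pl = pure_tensor_linear[OF mod(1,4)] pure_tensor_linear[OF mod(2,3)]
  note pc = pure_tensor_closed_algebra[OF alg(2,3)]
  have bil: "bilinear_map K A B ?M (?\<phi> c)" if "c \<in> carrier C" for c
    using that by (intro bilinear_mapI linear_map_compose[OF pl(4) pl(1)] pl(2) pc)
  have lin: "linear_map K C ?M (\<lambda>c. ?\<phi> c a b)" if "a \<in> carrier A" "b \<in> carrier B" for a b
    using that by (intro linear_map_compose[OF pl(3) pl(1)])
  show "assoc K A B C (pure_tensor K (tensor_algebra K A B) C (pure_tensor K A B a b) c)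
      = ?\<phi> c a b" if "a \<in> carrier A" "b \<in> carrier B" "c \<in> carrier C"
    using that unfolding assoc_def Let_def
    by (intro tensor_lift_lift_pure[where \<phi> = ?\<phi>] alg M bil lin)
  show "alg_hom K (tensor_algebra K (tensor_algebra K A B) C) ?M (assoc K A B C)"
    unfolding assoc_def Let_def
    by (intro tensor_lift_lift_alg_hom[where \<phi> = ?\<phi>] alg M bil lin)
      (simp_all add: tensor_algebra_one pure_tensor_mult[OF alg(1) BC] pure_tensor_mult[OF alg(2,3)]
        pc)
qed

lemma middle_flip_props:
  assumes alg: "k_algebra K A" "k_algebra K B" "k_algebra K C" "k_algebra K D"
  shows middle_flip_alg_hom:
      "alg_hom K (tensor_algebra K (tensor_algebra K A B) (tensor_algebra K C D))
        (tensor_algebra K (tensor_algebra K A C) (tensor_algebra K B D)) (middle_flip K A B C D)"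
    and middle_flip_pure:
      "a \<in> carrier A \<Longrightarrow> b \<in> carrier B \<Longrightarrow> c \<in> carrier C \<Longrightarrow> d \<in> carrier D \<Longrightarrow>
      middle_flip K A B C D (pure_tensor K (tensor_algebra K A B) (tensor_algebra K C D)
          (pure_tensor K A B a b) (pure_tensor K C D c d))
        = pure_tensor K (tensor_algebra K A C) (tensor_algebra K B D)
            (pure_tensor K A C a c) (pure_tensor K B D b d)"
proof -
  interpret A: k_algebra K A by fact
  interpret B: k_algebra K B by fact
  interpret C: k_algebra K C by fact
  interpret D: k_algebra K D by fact
  let ?AC = "tensor_algebra K A C" and ?BD = "tensor_algebra K B D"
  let ?CD = "tensor_algebra K C D"
  let ?M = "tensor_algebra K ?AC ?BD"
  note AC = tensor_algebra_is_k_algebra[OF alg(1,3)]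
  note BD = tensor_algebra_is_k_algebra[OF alg(2,4)]
  note CD = tensor_algebra_is_k_algebra[OF alg(3,4)]
  note M = tensor_algebra_is_k_algebra[OF AC BD]
  note mod = alg[THEN k_algebra_module]
  note modM = k_algebra_module[OF M] k_algebra_module[OF AC] k_algebra_module[OF BD]
    k_algebra_module[OF CD]
  let ?W = "\<lambda>a b c d. pure_tensor K ?AC ?BD (pure_tensor K A C a c) (pure_tensor K B D b d)"
  note pl = pure_tensor_linear[OF mod(1,3)] pure_tensor_linear[OF mod(2,4)]
    pure_tensor_linear[OF modM(2,3)]
  note pc = pure_tensor_closed_algebra[OF alg(1,3)] pure_tensor_closed_algebra[OF alg(2,4)]
    pure_tensor_closed_algebra[OF AC BD]
  let ?\<phi> = "\<lambda>u a b. tensor_lift K ?M (?W a b) u"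
  have W: "bilinear_map K C D ?M (?W a b)" if "a \<in> carrier A" "b \<in> carrier B" for a b
    using that
    by (intro bilinear_mapI linear_map_compose[OF pl(3) pl(5)] linear_map_compose[OF pl(1) pl(6)] pc)
  have Wa: "linear_map K A ?M (\<lambda>a. ?W a b c d)"
    if "b \<in> carrier B" "c \<in> carrier C" "d \<in> carrier D" for b c d
    using that by (intro linear_map_compose[OF pl(2) pl(6)] pc)
  have Wb: "linear_map K B ?M (\<lambda>b. ?W a b c d)"
    if "a \<in> carrier A" "c \<in> carrier C" "d \<in> carrier D" for a c d
    using that by (intro linear_map_compose[OF pl(4) pl(5)] pc)
  have lin: "linear_map K ?CD ?M (\<lambda>u. ?\<phi> u a b)" if "a \<in> carrier A" "b \<in> carrier B" for a b
    using that by (intro tensor_lift_linear_algebra mod modM W)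
  have bil: "bilinear_map K A B ?M (?\<phi> u)" if "u \<in> carrier ?CD" for u
  proof (rule bilinear_mapI)
    have u: "u \<in> carrier (tensor_module K C D)" using that by (simp add: tensor_algebra_fields)
    show "linear_map K B ?M (?\<phi> u a)" if "a \<in> carrier A" for a
      using that by (intro bilinear_mapD(1)[OF tensor_lift_parameter[OF mod(3,4) modM(1) _ _ mod(2)]]
          W Wb u)
    show "linear_map K A ?M (\<lambda>a. ?\<phi> u a b)" if "b \<in> carrier B" for b
      using that by (intro bilinear_mapD(1)[OF tensor_lift_parameter[OF mod(3,4) modM(1) _ _ mod(1)]]
          W Wa u)
  qed
  have val: "?\<phi> (pure_tensor K C D c d) a b = ?W a b c d"
    if "a \<in> carrier A" "b \<in> carrier B" "c \<in> carrier C" "d \<in> carrier D" for a b c d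
    using that by (intro tensor_lift_pure mod modM W)
  have mf: "middle_flip K A B C D = tensor_lift K ?M (\<lambda>t u. tensor_lift K ?M (?\<phi> u) t)"
    by (simp add: middle_flip_def Let_def)
  show "middle_flip K A B C D (pure_tensor K (tensor_algebra K A B) ?CD
      (pure_tensor K A B a b) (pure_tensor K C D c d)) = ?W a b c d"
    if "a \<in> carrier A" "b \<in> carrier B" "c \<in> carrier C" "d \<in> carrier D"
    unfolding mf val[OF that, symmetric] using that
    by (intro tensor_lift_lift_pure[where \<phi> = ?\<phi>] alg CD M bil lin pure_tensor_closed_algebra)
  show "alg_hom K (tensor_algebra K (tensor_algebra K A B) ?CD) ?M (middle_flip K A B C D)"
    unfolding mf
  proof (intro tensor_lift_lift_alg_hom[where \<phi> = ?\<phi>] alg CD M bil lin)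
    show "?\<phi> \<one>\<^bsub>?CD\<^esub> \<one>\<^bsub>A\<^esub> \<one>\<^bsub>B\<^esub> = \<one>\<^bsub>?M\<^esub>" by (simp add: tensor_algebra_one val)
    show "?\<phi> (c \<otimes>\<^bsub>?CD\<^esub> c') (a \<otimes>\<^bsub>A\<^esub> a') (b \<otimes>\<^bsub>B\<^esub> b') = ?\<phi> c a b \<otimes>\<^bsub>?M\<^esub> ?\<phi> c' a' b'"
      if "a \<in> carrier A" "b \<in> carrier B" "c \<in> carrier ?CD"
        "a' \<in> carrier A" "b' \<in> carrier B" "c' \<in> carrier ?CD" for a b c a' b' c'
      using that
      by (intro tensor_lift_mult[OF alg(3,4) M] W)
        (simp_all add: pure_tensor_mult[OF AC BD] pure_tensor_mult[OF alg(1,3)]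
          pure_tensor_mult[OF alg(2,4)] pc)
  qed
qed

section \<open>Functionals on tensor products\<close>

text \<open>The ground ring as an algebra over itself.\<close>

definition base_algebra :: "('k, 'm) ring_scheme \<Rightarrow> ('k, 'k) module" where
  "base_algebra K = \<lparr>carrier = carrier K, mult = mult K, one = one K, zero = zero K,
     add = add K, smult = mult K\<rparr>"

lemma base_algebra_fields:
  "carrier (base_algebra K) = carrier K" "mult (base_algebra K) = mult K"
  "one (base_algebra K) = one K" "zero (base_algebra K) = zero K"
  "add (base_algebra K) = add K" "smult (base_algebra K) = mult K"
  by (simp_all add: base_algebra_def)

lemma base_algebra_is_k_algebra:
  assumes "cring K"
  shows "k_algebra K (base_algebra K)"
proof -
  interpret K: cring K by fact
  have "abelian_group (base_algebra K)"
    using K.add.l_inv_ex by (intro abelian_groupI) (auto simp: base_algebra_fields K.a_ac)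
  then have m: "module K (base_algebra K)"
    by (intro moduleI K.is_cring)
      (auto simp: base_algebra_fields K.l_distr K.r_distr K.m_assoc)
  then interpret B: module K "base_algebra K" .
  have "ring (base_algebra K)"
    using B.abelian_group_axioms
    by (intro ringI monoidI) (auto simp: base_algebra_fields K.l_distr K.r_distr K.m_assoc)
  with m show ?thesis
    by (intro k_algebra.intro k_algebra_axioms.intro) (auto simp: base_algebra_fields K.m_ac)
qed

lemma alg_hom_functional:
  assumes "alg_hom K B (base_algebra K) e"
  shows "b \<in> carrier B \<Longrightarrow> e b \<in> carrier K"
    and "b \<in> carrier B \<Longrightarrow> c \<in> carrier B \<Longrightarrow> e (b \<oplus>\<^bsub>B\<^esub> c) = e b \<oplus>\<^bsub>K\<^esub> e c"
    and "k \<in> carrier K \<Longrightarrow> b \<in> carrier B \<Longrightarrow> e (k \<odot>\<^bsub>B\<^esub> b) = k \<otimes>\<^bsub>K\<^esub> e b"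
    and "b \<in> carrier B \<Longrightarrow> c \<in> carrier B \<Longrightarrow> e (b \<otimes>\<^bsub>B\<^esub> c) = e b \<otimes>\<^bsub>K\<^esub> e c"
    and "e \<one>\<^bsub>B\<^esub> = \<one>\<^bsub>K\<^esub>"
  using alg_homD[OF assms] by (simp_all add: base_algebra_fields)

lemma alg_hom_unit:
  assumes "k_algebra K A"
  shows "alg_hom K (base_algebra K) A (\<lambda>c. c \<odot>\<^bsub>A\<^esub> \<one>\<^bsub>A\<^esub>)"
proof -
  interpret A: k_algebra K A by fact
  show ?thesis
    by (intro alg_homI linear_mapI assms base_algebra_is_k_algebra A.R.is_cring)
      (simp_all add: base_algebra_fields A.smult_l_distr A.smult_assoc1 A.smult_mult_left)
qed

lemma apply_right_props:
  assumes "k_algebra K A" and e: "alg_hom K B (base_algebra K) e"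
  shows apply_right_alg_hom: "alg_hom K (tensor_algebra K A B) A (apply_right K A e)"
    and apply_right_pure: "a \<in> carrier A \<Longrightarrow> b \<in> carrier B
      \<Longrightarrow> apply_right K A e (pure_tensor K A B a b) = e b \<odot>\<^bsub>A\<^esub> a"
proof -
  note alg = assms(1) alg_hom_dom[OF e]
  interpret A: k_algebra K A by (rule alg)
  interpret B: k_algebra K B by (rule alg)
  note e' = alg_hom_functional[OF e]
  have bil: "bilinear_map K A B A (\<lambda>a b. e b \<odot>\<^bsub>A\<^esub> a)"
    by (intro bilinear_mapI linear_mapI)
      (simp_all add: e' A.smult_l_distr A.smult_r_distr A.smult_assoc1[symmetric] A.R.m_comm)
  show "alg_hom K (tensor_algebra K A B) A (apply_right K A e)"
    unfolding apply_right_def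
    by (intro tensor_lift_alg_hom alg bil)
      (simp_all add: e' A.smult_mult_left A.smult_mult_right A.smult_assoc1[symmetric] A.R.m_comm)
  show "apply_right K A e (pure_tensor K A B a b) = e b \<odot>\<^bsub>A\<^esub> a"
    if "a \<in> carrier A" "b \<in> carrier B"
    unfolding apply_right_def
    using that by (intro tensor_lift_pure k_algebra_module alg bil)
qed

lemma apply_left_props:
  assumes "k_algebra K B" and e: "alg_hom K A (base_algebra K) e"
  shows apply_left_alg_hom: "alg_hom K (tensor_algebra K A B) B (apply_left K B e)"
    and apply_left_pure: "a \<in> carrier A \<Longrightarrow> b \<in> carrier B
      \<Longrightarrow> apply_left K B e (pure_tensor K A B a b) = e a \<odot>\<^bsub>B\<^esub> b"
proof -
  note alg = alg_hom_dom[OF e] assms(1)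
  interpret A: k_algebra K A by (rule alg)
  interpret B: k_algebra K B by (rule alg)
  note e' = alg_hom_functional[OF e]
  have bil: "bilinear_map K A B B (\<lambda>a b. e a \<odot>\<^bsub>B\<^esub> b)"
    by (intro bilinear_mapI linear_mapI)
      (simp_all add: e' B.smult_l_distr B.smult_r_distr B.smult_assoc1[symmetric] A.R.m_comm)
  show "alg_hom K (tensor_algebra K A B) B (apply_left K B e)"
    unfolding apply_left_def
    by (intro tensor_lift_alg_hom alg bil)
      (simp_all add: e' B.smult_mult_left B.smult_mult_right B.smult_assoc1[symmetric] A.R.m_comm)
  show "apply_left K B e (pure_tensor K A B a b) = e a \<odot>\<^bsub>B\<^esub> b"
    if "a \<in> carrier A" "b \<in> carrier B"
    unfolding apply_left_def
    using that by (intro tensor_lift_pure k_algebra_module alg bil)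
qed

lemma smult_pure_tensor:
  assumes "k_algebra K A" "k_algebra K B" "c \<in> carrier K" "a \<in> carrier A" "b \<in> carrier B"
  shows "pure_tensor K A B (c \<odot>\<^bsub>A\<^esub> a) b = c \<odot>\<^bsub>tensor_algebra K A B\<^esub> pure_tensor K A B a b"
    and "pure_tensor K A B a (c \<odot>\<^bsub>B\<^esub> b) = c \<odot>\<^bsub>tensor_algebra K A B\<^esub> pure_tensor K A B a b"
  using linear_mapD(3)[OF pure_tensor_linear(2)[OF assms(1,2)[THEN k_algebra_module] assms(5)]]
    linear_mapD(3)[OF pure_tensor_linear(1)[OF assms(1,2)[THEN k_algebra_module] assms(4)]] assms(3-5)
  by simp_all

lemma apply_left_flip:
  assumes "k_algebra K B" and e: "alg_hom K A (base_algebra K) e"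
    and x: "x \<in> carrier (tensor_algebra K B A)"
  shows "apply_left K B e (flip K B A x) = apply_right K B e x"
proof -
  note alg = assms(1) alg_hom_dom[OF e]
  show ?thesis
    by (rule alg_hom_tensor_ext[OF alg alg_hom_compose[OF flip_alg_hom[OF alg]
          apply_left_alg_hom[OF assms(1) e]] apply_right_alg_hom[OF assms(1) e]])
      (simp_all add: flip_pure[OF alg] apply_left_pure[OF assms(1) e]
        apply_right_pure[OF assms(1) e] x)
qed

lemma apply_right_flip:
  assumes "k_algebra K B" and e: "alg_hom K A (base_algebra K) e"
    and x: "x \<in> carrier (tensor_algebra K A B)"
  shows "apply_right K B e (flip K A B x) = apply_left K B e x"
  using apply_left_flip[OF assms(1) e, of "flip K A B x"] x
    flip_flip[OF alg_hom_dom[OF e] assms(1) x]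
    alg_homD(1)[OF flip_alg_hom[OF alg_hom_dom[OF e] assms(1)] x] by simp

text \<open>Replacing one leg by its value under a functional \<open>e\<close>, times the unit.\<close>

lemma tensor_map_apply_left:
  assumes g: "alg_hom K B D g" and "k_algebra K C" and e: "alg_hom K A (base_algebra K) e"
    and x: "x \<in> carrier (tensor_algebra K A B)"
  shows "tensor_map K C D (\<lambda>a. e a \<odot>\<^bsub>C\<^esub> \<one>\<^bsub>C\<^esub>) g x
    = pure_tensor K C D \<one>\<^bsub>C\<^esub> (g (apply_left K B e x))"
proof -
  note alg = alg_hom_dom[OF e] alg_hom_dom[OF g] assms(2) alg_hom_cod[OF g]
  interpret C: k_algebra K C by (rule alg)
  interpret D: k_algebra K D by (rule alg)
  note u = alg_hom_compose[OF e alg_hom_unit[OF assms(2)]]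
  show ?thesis
    by (rule alg_hom_tensor_ext[OF alg(1,2) tensor_map_alg_hom[OF u g]
          alg_hom_compose[OF alg_hom_compose[OF apply_left_alg_hom[OF alg(2) e] g]
            alg_hom_pure_right[OF alg(3,4)]]])
      (simp_all add: tensor_map_pure[OF u g] apply_left_pure[OF alg(2) e] alg_hom_functional[OF e]
        alg_homD[OF g] smult_pure_tensor[OF alg(3,4)] x)
qed

lemma tensor_map_apply_right:
  assumes g: "alg_hom K B D g" and "k_algebra K C" and e: "alg_hom K A (base_algebra K) e"
    and x: "x \<in> carrier (tensor_algebra K B A)"
  shows "tensor_map K D C g (\<lambda>a. e a \<odot>\<^bsub>C\<^esub> \<one>\<^bsub>C\<^esub>) x
    = pure_tensor K D C (g (apply_right K B e x)) \<one>\<^bsub>C\<^esub>"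
proof -
  note alg = alg_hom_dom[OF g] alg_hom_dom[OF e]
  interpret C: k_algebra K C by fact
  note fx = alg_homD(1)[OF flip_alg_hom[OF alg] x]
  show ?thesis
    using flip_tensor_map[OF alg_hom_compose[OF e alg_hom_unit[OF assms(2)]] g fx]
    by (simp add: flip_flip[OF alg x] tensor_map_apply_left[OF g assms(2) e fx]
        apply_left_flip[OF alg(1) e x] flip_pure[OF assms(2) alg_hom_cod[OF g]]
        alg_homD(1)[OF g] alg_homD(1)[OF apply_right_alg_hom[OF alg(1) e] x])
qed

lemma apply_left_tensor_map:
  assumes f: "alg_hom K A C f" and g: "alg_hom K B D g" and e: "alg_hom K C (base_algebra K) e"
    and x: "x \<in> carrier (tensor_algebra K A B)"
  shows "apply_left K D e (tensor_map K C D f g x) = g (apply_left K B (\<lambda>a. e (f a)) x)"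
proof -
  note alg = alg_hom_dom[OF f] alg_hom_dom[OF g] alg_hom_cod[OF f] alg_hom_cod[OF g]
  interpret A: k_algebra K A by (rule alg)
  interpret B: k_algebra K B by (rule alg)
  interpret C: k_algebra K C by (rule alg)
  interpret D: k_algebra K D by (rule alg)
  note ef = alg_hom_compose[OF f e]
  show ?thesis
    by (rule alg_hom_tensor_ext[OF alg(1,2)
          alg_hom_compose[OF tensor_map_alg_hom[OF f g] apply_left_alg_hom[OF alg(4) e]]
          alg_hom_compose[OF apply_left_alg_hom[OF alg(2) ef] g]])
      (simp_all only: tensor_map_pure[OF f g] apply_left_pure[OF alg(4) e]
        apply_left_pure[OF alg(2) ef] alg_hom_functional[OF ef]
        alg_homD(1-4)[OF f] alg_homD(1-4)[OF g] x A.A.one_closed B.A.one_closed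
        C.A.one_closed D.A.one_closed alg_hom_functional[OF e]
        A.smult_one B.smult_one C.smult_one D.smult_one alg_homD(5)[OF f] alg_homD(5)[OF g]
       )
qed

lemma apply_right_tensor_map:
  assumes f: "alg_hom K A C f" and g: "alg_hom K B D g" and e: "alg_hom K D (base_algebra K) e"
    and x: "x \<in> carrier (tensor_algebra K A B)"
  shows "apply_right K C e (tensor_map K C D f g x) = f (apply_right K A (\<lambda>a. e (g a)) x)"
  using apply_left_tensor_map[OF g f e
      alg_homD(1)[OF flip_alg_hom[OF alg_hom_dom[OF f] alg_hom_dom[OF g]] x]]
    apply_left_flip[OF alg_hom_dom[OF f] alg_hom_compose[OF g e] x]
    apply_left_flip[OF alg_hom_cod[OF f] e alg_homD(1)[OF tensor_map_alg_hom[OF f g] x]]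
  by (simp add: flip_tensor_map[OF f g x])

lemma apply_left_cong:
  assumes "k_algebra K B" and e: "alg_hom K A (base_algebra K) e"
    and "\<And>a. a \<in> carrier A \<Longrightarrow> e a = e' a" "x \<in> carrier (tensor_algebra K A B)"
  shows "apply_left K B e x = apply_left K B e' x"
proof -
  note alg = alg_hom_dom[OF e] assms(1)
  note e' = alg_hom_cong[OF e assms(3)]
  show ?thesis
    by (rule alg_hom_tensor_ext[OF alg apply_left_alg_hom[OF alg(2) e] apply_left_alg_hom[OF alg(2) e']])
      (simp_all add: apply_left_pure[OF alg(2) e] apply_left_pure[OF alg(2) e'] assms(3,4))
qed

lemma apply_right_cong:
  assumes "k_algebra K A" and e: "alg_hom K B (base_algebra K) e"
    and "\<And>b. b \<in> carrier B \<Longrightarrow> e b = e' b" "x \<in> carrier (tensor_algebra K A B)"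
  shows "apply_right K A e x = apply_right K A e' x"
  using apply_left_cong[OF assms(1) e assms(3)
      alg_homD(1)[OF flip_alg_hom[OF assms(1) alg_hom_dom[OF e]] assms(4)]]
    apply_left_flip[OF assms(1) e assms(4)]
    apply_left_flip[OF assms(1) alg_hom_cong[OF e assms(3)] assms(4)]
  by simp

lemma tensor_map_compose_eq:
  assumes f: "alg_hom K A C f" and g: "alg_hom K B D g"
    and f': "alg_hom K C C' f'" and g': "alg_hom K D D' g'"
    and "\<And>a. a \<in> carrier A \<Longrightarrow> f' (f a) = h a" "\<And>b. b \<in> carrier B \<Longrightarrow> g' (g b) = k b"
    and x: "x \<in> carrier (tensor_algebra K A B)"
  shows "tensor_map K C' D' f' g' (tensor_map K C D f g x) = tensor_map K C' D' h k x"
  unfolding tensor_map_compose[OF f g f' g' x]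
  by (rule tensor_map_cong[OF alg_hom_compose[OF f f'] alg_hom_compose[OF g g'] assms(5,6) x])


section \<open>Counital bialgebras\<close>

text \<open>Algebras with a coproduct and a counit that are algebra homomorphisms and satisfy the counit
  laws; coassociativity is not part of this notion.\<close>

definition counital_bialgebra :: "('k, 'm) ring_scheme \<Rightarrow> ('k, 'a) bialg \<Rightarrow> bool" where
  "counital_bialgebra K H \<longleftrightarrow>
    alg_hom K H (tensor_algebra K H H) (comult H) \<and>
    alg_hom K H (base_algebra K) (counit H) \<and>
    (\<forall>x \<in> carrier H. apply_left K H (counit H) (comult H x) = x \<and>
      apply_right K H (counit H) (comult H x) = x)"

lemma counital_bialgebraD:
  assumes "counital_bialgebra K H"
  shows "alg_hom K H (tensor_algebra K H H) (comult H)"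
    and "alg_hom K H (base_algebra K) (counit H)"
    and "k_algebra K H"
    and "x \<in> carrier H \<Longrightarrow> apply_left K H (counit H) (comult H x) = x"
    and "x \<in> carrier H \<Longrightarrow> apply_right K H (counit H) (comult H x) = x"
  using assms by (auto simp: counital_bialgebra_def dest: alg_hom_dom)

lemma bialgebra_counital:
  assumes "bialgebra K H"
  shows "counital_bialgebra K H"
proof -
  interpret H: bialgebra K H by fact
  have alg: "k_algebra K H"
    by (intro k_algebra.intro k_algebra_axioms.intro H.V.module_axioms H.H.ring_axioms
        H.smult_mult_left H.smult_mult_right)
  have "alg_hom K H (tensor_algebra K H H) (comult H)"
    using H.comult_hom H.comult_smult
    by (intro alg_homI alg tensor_algebra_is_k_algebra linear_mapI) (auto simp: ring_hom_def)
  moreover have "alg_hom K H (base_algebra K) (counit H)"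
    using H.counit_hom H.counit_smult
    by (intro alg_homI alg base_algebra_is_k_algebra linear_mapI H.K.is_cring)
      (auto simp: ring_hom_def base_algebra_fields)
  ultimately show ?thesis
    by (auto simp: counital_bialgebra_def H.counit_left H.counit_right)
qed

text \<open>Algebra homomorphisms that respect the coproduct. Compatibility with the counit is not
  demanded.\<close>

definition bialg_hom ::
    "('k, 'm) ring_scheme \<Rightarrow> ('k, 'a) bialg \<Rightarrow> ('k, 'b) bialg \<Rightarrow> ('a \<Rightarrow> 'b) \<Rightarrow> bool" where
  "bialg_hom K A B f \<longleftrightarrow> alg_hom K A B f \<and>
    (\<forall>x \<in> carrier A. comult B (f x) = tensor_map K B B f f (comult A x))"

text \<open>The trivial homomorphism \<open>b \<mapsto> \<epsilon>(b) 1\<close> is compatible with the coproduct of \<open>B\<close>.\<close>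

lemma comult_counit_trivial:
  assumes B: "counital_bialgebra K B" and A: "k_algebra K A" and b: "b \<in> carrier B"
  shows "tensor_map K A A (\<lambda>b. counit B b \<odot>\<^bsub>A\<^esub> \<one>\<^bsub>A\<^esub>) (\<lambda>b. counit B b \<odot>\<^bsub>A\<^esub> \<one>\<^bsub>A\<^esub>) (comult B b)
    = counit B b \<odot>\<^bsub>tensor_algebra K A A\<^esub> \<one>\<^bsub>tensor_algebra K A A\<^esub>"
proof -
  note B' = counital_bialgebraD[OF B]
  interpret A: k_algebra K A by fact
  note u = alg_hom_compose[OF B'(2) alg_hom_unit[OF A]]
  show ?thesis
    unfolding tensor_map_apply_left[OF u A B'(2) alg_homD(1)[OF B'(1) b]]
    using b by (simp add: B'(4) smult_pure_tensor[OF A A] alg_hom_functional[OF B'(2)]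
        tensor_algebra_one)
qed

section \<open>The tensor product of two bialgebras\<close>

lemma tensor_bialgebra_fields:
  "carrier (tensor_bialgebra K A B) = carrier (tensor_algebra K A B)"
  "mult (tensor_bialgebra K A B) = mult (tensor_algebra K A B)"
  "one (tensor_bialgebra K A B) = one (tensor_algebra K A B)"
  "zero (tensor_bialgebra K A B) = zero (tensor_algebra K A B)"
  "add (tensor_bialgebra K A B) = add (tensor_algebra K A B)"
  "smult (tensor_bialgebra K A B) = smult (tensor_algebra K A B)"
  by (simp_all add: tensor_bialgebra_def Let_def)

text \<open>The record of the tensor product bialgebra has more fields than the one of the tensor
  product algebra, but constructions that ignore the coalgebra structure give the same result
  on both.\<close>

lemma tensor_bialgebra_as_algebra:
  shows "tensor_algebra K (tensor_bialgebra K A B) X = tensor_algebra K (tensor_algebra K A B) X"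
    and "tensor_algebra K X (tensor_bialgebra K A B) = tensor_algebra K X (tensor_algebra K A B)"
    and "pure_tensor K (tensor_bialgebra K A B) X = pure_tensor K (tensor_algebra K A B) X"
    and "pure_tensor K X (tensor_bialgebra K A B) = pure_tensor K X (tensor_algebra K A B)"
proof -
  show "pure_tensor K (tensor_bialgebra K A B) X = pure_tensor K (tensor_algebra K A B) X"
    "pure_tensor K X (tensor_bialgebra K A B) = pure_tensor K X (tensor_algebra K A B)"
    by (simp_all add: fun_eq_iff pure_tensor_def bilinearity_submodule_def
        bilinearity_relators_def tensor_bialgebra_fields)
  then show "tensor_algebra K (tensor_bialgebra K A B) X = tensor_algebra K (tensor_algebra K A B) X"
    "tensor_algebra K X (tensor_bialgebra K A B) = tensor_algebra K X (tensor_algebra K A B)"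
    by (simp_all add: tensor_algebra_def tensor_module_def Let_def bilinearity_submodule_def
        bilinearity_relators_def tensor_bialgebra_fields)
qed

lemma tensor_bialgebra_k_algebra:
  "k_algebra K (tensor_bialgebra K A B) \<longleftrightarrow> k_algebra K (tensor_algebra K A B)"
  by (auto elim!: k_algebra_record_cong simp: tensor_bialgebra_fields)

lemma tensor_bialgebra_maps:
  "alg_hom K (tensor_bialgebra K A B) X f1 \<longleftrightarrow> alg_hom K (tensor_algebra K A B) X f1"
  "alg_hom K X (tensor_bialgebra K A B) f2 \<longleftrightarrow> alg_hom K X (tensor_algebra K A B) f2"
  "tensor_map K (tensor_bialgebra K A B) Y g1 h1 = tensor_map K (tensor_algebra K A B) Y g1 h1"
  "tensor_map K Y (tensor_bialgebra K A B) g2 h2 = tensor_map K Y (tensor_algebra K A B) g2 h2"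
  "flip K (tensor_bialgebra K A B) Z = flip K (tensor_algebra K A B) Z"
  "flip K Z (tensor_bialgebra K A B) = flip K Z (tensor_algebra K A B)"
  "apply_left K (tensor_bialgebra K A B) e1 = apply_left K (tensor_algebra K A B) e1"
  "apply_right K (tensor_bialgebra K A B) e2 = apply_right K (tensor_algebra K A B) e2"
  by (simp_all add: alg_hom_def linear_map_def ring_hom_def tensor_bialgebra_k_algebra
      tensor_bialgebra_fields tensor_map_def flip_def tensor_bialgebra_as_algebra fun_eq_iff
      apply_left_def apply_right_def tensor_lift_def finsum_def finprod_def Let_def)

lemma tensor_bialgebra_units:
  "Units (tensor_bialgebra K A B) = Units (tensor_algebra K A B)"
  "m_inv (tensor_bialgebra K A B) = m_inv (tensor_algebra K A B)"
  by (simp_all add: Units_def m_inv_def fun_eq_iff tensor_bialgebra_fields)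

text \<open>These rules replace the bialgebra by the algebra everywhere except below its coproduct and
  counit.\<close>

lemmas tensor_bialgebra_simps = tensor_bialgebra_fields tensor_bialgebra_as_algebra
  tensor_bialgebra_k_algebra tensor_bialgebra_maps tensor_bialgebra_units

text \<open>Two bialgebras \<open>A\<close> and \<open>B\<close>; \<open>AB\<close> is the algebra \<open>A \<otimes> B\<close> and \<open>H\<close> the bialgebra on it.\<close>

locale two_bialgebras =
  fixes K :: "('k, 'm) ring_scheme" and A :: "('k, 'a) bialg" and B :: "('k, 'b) bialg"
  assumes bialgA: "counital_bialgebra K A" and bialgB: "counital_bialgebra K B"
begin

abbreviation "AB \<equiv> tensor_algebra K A B"
abbreviation "H \<equiv> tensor_bialgebra K A B"

text \<open>The two inclusions into the tensor product and the two projections from it.\<close>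

definition inA :: "'a \<Rightarrow> ('k, 'a, 'b) tens" where
  "inA a = pure_tensor K A B a \<one>\<^bsub>B\<^esub>"

definition inB :: "'b \<Rightarrow> ('k, 'a, 'b) tens" where
  "inB b = pure_tensor K A B \<one>\<^bsub>A\<^esub> b"

definition prA :: "('k, 'a, 'b) tens \<Rightarrow> 'a" where
  "prA = apply_right K A (counit B)"

definition prB :: "('k, 'a, 'b) tens \<Rightarrow> 'b" where
  "prB = apply_left K B (counit A)"

lemmas A = counital_bialgebraD[OF bialgA]
lemmas B = counital_bialgebraD[OF bialgB]

lemma algAB: "k_algebra K AB"
  by (rule tensor_algebra_is_k_algebra[OF A(3) B(3)])

sublocale A: k_algebra K A by (rule A(3))
sublocale B: k_algebra K B by (rule B(3))
sublocale AB: k_algebra K AB by (rule algAB)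

lemma inA_hom: "alg_hom K A AB inA" and inB_hom: "alg_hom K B AB inB"
  unfolding inA_def inB_def
  by (rule alg_hom_pure_left[OF A(3) B(3)] alg_hom_pure_right[OF A(3) B(3)])+

lemma prA_hom: "alg_hom K AB A prA" and prB_hom: "alg_hom K AB B prB"
  unfolding prA_def prB_def
  by (rule apply_right_alg_hom[OF A(3) B(2)] apply_left_alg_hom[OF B(3) A(2)])+

lemma pr_in:
  "a \<in> carrier A \<Longrightarrow> prA (inA a) = a"
  "b \<in> carrier B \<Longrightarrow> prB (inB b) = b"
  "b \<in> carrier B \<Longrightarrow> prA (inB b) = counit B b \<odot>\<^bsub>A\<^esub> \<one>\<^bsub>A\<^esub>"
  "a \<in> carrier A \<Longrightarrow> prB (inA a) = counit A a \<odot>\<^bsub>B\<^esub> \<one>\<^bsub>B\<^esub>"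
  by (simp_all add: inA_def inB_def prA_def prB_def apply_right_pure[OF A(3) B(2)]
      apply_left_pure[OF B(3) A(2)] alg_hom_functional[OF A(2)] alg_hom_functional[OF B(2)])

lemma AB_ext:
  assumes "alg_hom K AB X f" "alg_hom K AB X g"
    and "\<And>a. a \<in> carrier A \<Longrightarrow> f (inA a) = g (inA a)"
    and "\<And>b. b \<in> carrier B \<Longrightarrow> f (inB b) = g (inB b)"
    and "x \<in> carrier AB"
  shows "f x = g x"
  using alg_hom_tensor_ext[OF A(3) B(3) assms(1,2) _ _ assms(5)] assms(3,4)
  by (simp add: inA_def inB_def)

lemma comult_tensor:
  "comult H = (\<lambda>x. middle_flip K A A B B
     (tensor_map K (tensor_algebra K A A) (tensor_algebra K B B) (comult A) (comult B) x))"
  by (simp add: tensor_bialgebra_def Let_def)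

lemma comult_hom: "alg_hom K AB (tensor_algebra K AB AB) (comult H)"
  unfolding comult_tensor
  by (rule alg_hom_compose[OF tensor_map_alg_hom[OF A(1) B(1)]
        middle_flip_alg_hom[OF A(3) A(3) B(3) B(3)]])

text \<open>On each of its two factors the middle flip is \<open>inA \<otimes> inA\<close> and \<open>inB \<otimes> inB\<close>. It follows that
  the two inclusions respect the coproducts.\<close>

lemma middle_flip_left:
  assumes t: "t \<in> carrier (tensor_algebra K A A)"
  shows "middle_flip K A A B B (pure_tensor K (tensor_algebra K A A) (tensor_algebra K B B)
    t \<one>\<^bsub>tensor_algebra K B B\<^esub>) = tensor_map K AB AB inA inA t"
proof -
  note AA = tensor_algebra_is_k_algebra[OF A(3) A(3)]
  note BB = tensor_algebra_is_k_algebra[OF B(3) B(3)]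
  show ?thesis
    by (rule alg_hom_tensor_ext[OF A(3) A(3) alg_hom_compose[OF alg_hom_pure_left[OF AA BB]
          middle_flip_alg_hom[OF A(3) A(3) B(3) B(3)]] tensor_map_alg_hom[OF inA_hom inA_hom]])
      (simp_all add: tensor_map_pure[OF inA_hom inA_hom] tensor_algebra_one
        middle_flip_pure[OF A(3) A(3) B(3) B(3)] inA_def t)
qed

lemma middle_flip_right:
  assumes t: "t \<in> carrier (tensor_algebra K B B)"
  shows "middle_flip K A A B B (pure_tensor K (tensor_algebra K A A) (tensor_algebra K B B)
    \<one>\<^bsub>tensor_algebra K A A\<^esub> t) = tensor_map K AB AB inB inB t"
proof -
  note AA = tensor_algebra_is_k_algebra[OF A(3) A(3)]
  note BB = tensor_algebra_is_k_algebra[OF B(3) B(3)]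
  show ?thesis
    by (rule alg_hom_tensor_ext[OF B(3) B(3) alg_hom_compose[OF alg_hom_pure_right[OF AA BB]
          middle_flip_alg_hom[OF A(3) A(3) B(3) B(3)]] tensor_map_alg_hom[OF inB_hom inB_hom]])
      (simp_all add: tensor_map_pure[OF inB_hom inB_hom] tensor_algebra_one
        middle_flip_pure[OF A(3) A(3) B(3) B(3)] inB_def t)
qed

lemma comult_in:
  "a \<in> carrier A \<Longrightarrow> comult H (inA a) = tensor_map K AB AB inA inA (comult A a)"
  "b \<in> carrier B \<Longrightarrow> comult H (inB b) = tensor_map K AB AB inB inB (comult B b)"
  by (simp_all add: comult_tensor inA_def inB_def tensor_map_pure[OF A(1) B(1)] alg_homD(5)[OF A(1)]
      alg_homD(5)[OF B(1)] middle_flip_left[OF alg_homD(1)[OF A(1)]]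
      middle_flip_right[OF alg_homD(1)[OF B(1)]])

lemma counit_hom: "alg_hom K AB (base_algebra K) (counit H)"
  and counit_pure: "a \<in> carrier A \<Longrightarrow> b \<in> carrier B
    \<Longrightarrow> counit H (pure_tensor K A B a b) = counit A a \<otimes>\<^bsub>K\<^esub> counit B b"
proof -
  note K = base_algebra_is_k_algebra[OF A.R.is_cring]
  note e = alg_hom_functional[OF A(2)] alg_hom_functional[OF B(2)]
  have eq: "counit H = tensor_lift K (base_algebra K) (\<lambda>a b. counit A a \<otimes>\<^bsub>K\<^esub> counit B b)"
    by (simp add: tensor_bialgebra_def Let_def base_algebra_def)
  have bil: "bilinear_map K A B (base_algebra K) (\<lambda>a b. counit A a \<otimes>\<^bsub>K\<^esub> counit B b)"
    by (intro bilinear_mapI linear_mapI)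
      (simp_all add: base_algebra_fields e A.R.l_distr A.R.r_distr A.R.m_ac)
  show "alg_hom K AB (base_algebra K) (counit H)"
    unfolding eq
    by (intro tensor_lift_alg_hom A(3) B(3) K bil)
      (simp_all add: base_algebra_fields e A.R.m_ac)
  show "counit H (pure_tensor K A B a b) = counit A a \<otimes>\<^bsub>K\<^esub> counit B b"
    if "a \<in> carrier A" "b \<in> carrier B"
    unfolding eq using that by (intro tensor_lift_pure k_algebra_module A(3) B(3) K bil)
qed

lemma counit_in:
  "a \<in> carrier A \<Longrightarrow> counit H (inA a) = counit A a"
  "b \<in> carrier B \<Longrightarrow> counit H (inB b) = counit B b"
  by (simp_all add: inA_def inB_def counit_pure alg_hom_functional[OF A(2)]
      alg_hom_functional[OF B(2)])

lemma tensor_counital: "counital_bialgebra K H"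
proof -
  note cA = alg_homD(1)[OF A(1)] and cB = alg_homD(1)[OF B(1)]
  note eA = alg_hom_compose[OF inA_hom counit_hom] and eB = alg_hom_compose[OF inB_hom counit_hom]
  have "apply_left K AB (counit H) (comult H x) = x" if "x \<in> carrier AB" for x
    by (rule AB_ext[OF alg_hom_compose[OF comult_hom apply_left_alg_hom[OF algAB counit_hom]]
          alg_hom_id(2)[OF algAB] _ _ that])
      (simp_all add: comult_in apply_left_tensor_map[OF inA_hom inA_hom counit_hom]
        apply_left_tensor_map[OF inB_hom inB_hom counit_hom] cA cB
        apply_left_cong[OF A(3) eA counit_in(1) cA] apply_left_cong[OF B(3) eB counit_in(2) cB] A(4) B(4))
  moreover have "apply_right K AB (counit H) (comult H x) = x" if "x \<in> carrier AB" for x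
    by (rule AB_ext[OF alg_hom_compose[OF comult_hom apply_right_alg_hom[OF algAB counit_hom]]
          alg_hom_id(2)[OF algAB] _ _ that])
      (simp_all add: comult_in apply_right_tensor_map[OF inA_hom inA_hom counit_hom]
        apply_right_tensor_map[OF inB_hom inB_hom counit_hom] cA cB
        apply_right_cong[OF A(3) eA counit_in(1) cA] apply_right_cong[OF B(3) eB counit_in(2) cB] A(5) B(5))
  ultimately show ?thesis
    using comult_hom counit_hom by (simp add: counital_bialgebra_def tensor_bialgebra_simps)
qed

lemma inA_bialg_hom: "bialg_hom K A H inA" and inB_bialg_hom: "bialg_hom K B H inB"
  using inA_hom inB_hom by (simp_all add: bialg_hom_def tensor_bialgebra_simps comult_in)

lemma prA_bialg_hom: "bialg_hom K H A prA"
proof -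
  have "comult A (prA x) = tensor_map K A A prA prA (comult H x)" if "x \<in> carrier AB" for x
  proof (rule AB_ext[OF alg_hom_compose[OF prA_hom A(1)]
        alg_hom_compose[OF comult_hom tensor_map_alg_hom[OF prA_hom prA_hom]] _ _ that])
    fix a assume a: "a \<in> carrier A"
    note c = alg_homD(1)[OF A(1) a]
    show "comult A (prA (inA a)) = tensor_map K A A prA prA (comult H (inA a))"
      using a tensor_map_compose_eq[OF inA_hom inA_hom prA_hom prA_hom pr_in(1) pr_in(1) c]
      by (simp add: comult_in pr_in tensor_map_id[OF A(3) A(3) c])
  next
    fix b assume b: "b \<in> carrier B"
    note c = alg_homD(1)[OF B(1) b]
    show "comult A (prA (inB b)) = tensor_map K A A prA prA (comult H (inB b))"
      using b tensor_map_compose_eq[OF inB_hom inB_hom prA_hom prA_hom pr_in(3) pr_in(3) c]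
      by (simp add: comult_in pr_in comult_counit_trivial[OF bialgB A(3)] alg_homD[OF A(1)]
          alg_hom_functional[OF B(2)])
  qed
  then show ?thesis using prA_hom by (simp add: bialg_hom_def tensor_bialgebra_simps)
qed

lemma prB_bialg_hom: "bialg_hom K H B prB"
proof -
  have "comult B (prB x) = tensor_map K B B prB prB (comult H x)" if "x \<in> carrier AB" for x
  proof (rule AB_ext[OF alg_hom_compose[OF prB_hom B(1)]
        alg_hom_compose[OF comult_hom tensor_map_alg_hom[OF prB_hom prB_hom]] _ _ that])
    fix a assume a: "a \<in> carrier A"
    note c = alg_homD(1)[OF A(1) a]
    show "comult B (prB (inA a)) = tensor_map K B B prB prB (comult H (inA a))"
      using a tensor_map_compose_eq[OF inA_hom inA_hom prB_hom prB_hom pr_in(4) pr_in(4) c]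
      by (simp add: comult_in pr_in comult_counit_trivial[OF bialgA B(3)] alg_homD[OF B(1)]
          alg_hom_functional[OF A(2)])
  next
    fix b assume b: "b \<in> carrier B"
    note c = alg_homD(1)[OF B(1) b]
    show "comult B (prB (inB b)) = tensor_map K B B prB prB (comult H (inB b))"
      using b tensor_map_compose_eq[OF inB_hom inB_hom prB_hom prB_hom pr_in(2) pr_in(2) c]
      by (simp add: comult_in pr_in tensor_map_id[OF B(3) B(3) c])
  qed
  then show ?thesis using prB_hom by (simp add: bialg_hom_def tensor_bialgebra_simps)
qed

text \<open>An element of \<open>A \<otimes> B\<close> is recovered from its coproduct by projecting one leg to \<open>A\<close> and the
  other one to \<open>B\<close>, and likewise from its opposite coproduct. The whole structure theorem rests
  on these two identities.\<close>

lemma pr_comult: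
  assumes x: "x \<in> carrier AB"
  shows "tensor_map K A B prA prB (comult H x) = x"
proof (rule AB_ext[OF alg_hom_compose[OF comult_hom tensor_map_alg_hom[OF prA_hom prB_hom]]
      alg_hom_id(2)[OF algAB] _ _ x])
  fix a assume a: "a \<in> carrier A"
  note c = alg_homD(1)[OF A(1) a]
  show "tensor_map K A B prA prB (comult H (inA a)) = inA a"
    using a tensor_map_compose_eq[OF inA_hom inA_hom prA_hom prB_hom pr_in(1) pr_in(4) c]
      tensor_map_apply_right[OF alg_hom_id(2)[OF A(3)] B(3) A(2) c]
    by (simp add: comult_in A(5) inA_def[symmetric])
next
  fix b assume b: "b \<in> carrier B"
  note c = alg_homD(1)[OF B(1) b]
  show "tensor_map K A B prA prB (comult H (inB b)) = inB b"
    using b tensor_map_compose_eq[OF inB_hom inB_hom prA_hom prB_hom pr_in(3) pr_in(2) c]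
      tensor_map_apply_left[OF alg_hom_id(2)[OF B(3)] A(3) B(2) c]
    by (simp add: comult_in B(4) inB_def[symmetric])
qed

lemma pr_flip_comult:
  assumes x: "x \<in> carrier AB"
  shows "tensor_map K A B prA prB (flip K AB AB (comult H x)) = x"
proof (rule AB_ext[OF alg_hom_compose[OF alg_hom_compose[OF comult_hom flip_alg_hom[OF algAB algAB]]
        tensor_map_alg_hom[OF prA_hom prB_hom]] alg_hom_id(2)[OF algAB] _ _ x])
  fix a assume a: "a \<in> carrier A"
  note c = alg_homD(1)[OF A(1) a]
  note fc = alg_homD(1)[OF flip_alg_hom[OF A(3) A(3)] c]
  show "tensor_map K A B prA prB (flip K AB AB (comult H (inA a))) = inA a"
    using a tensor_map_compose_eq[OF inA_hom inA_hom prA_hom prB_hom pr_in(1) pr_in(4) fc]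
      tensor_map_apply_right[OF alg_hom_id(2)[OF A(3)] B(3) A(2) fc]
    by (simp add: comult_in A(4) inA_def[symmetric] flip_tensor_map[OF inA_hom inA_hom c]
        apply_right_flip[OF A(3) A(2) c])
next
  fix b assume b: "b \<in> carrier B"
  note c = alg_homD(1)[OF B(1) b]
  note fc = alg_homD(1)[OF flip_alg_hom[OF B(3) B(3)] c]
  show "tensor_map K A B prA prB (flip K AB AB (comult H (inB b))) = inB b"
    using b tensor_map_compose_eq[OF inB_hom inB_hom prA_hom prB_hom pr_in(3) pr_in(2) fc]
      tensor_map_apply_left[OF alg_hom_id(2)[OF B(3)] A(3) B(2) fc]
    by (simp add: comult_in B(5) inB_def[symmetric] flip_tensor_map[OF inB_hom inB_hom c]
        apply_left_flip[OF B(3) B(2) c])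
qed

end

section \<open>Central elements\<close>

lemma centralD:
  assumes "central M z"
  shows "z \<in> carrier M" "x \<in> carrier M \<Longrightarrow> z \<otimes>\<^bsub>M\<^esub> x = x \<otimes>\<^bsub>M\<^esub> z"
  using assms by (auto simp: central_def)

lemma central_mult:
  assumes "monoid M" "central M z" "central M w"
  shows "central M (z \<otimes>\<^bsub>M\<^esub> w)"
proof -
  interpret monoid M by fact
  have "z \<otimes>\<^bsub>M\<^esub> w \<otimes>\<^bsub>M\<^esub> x = x \<otimes>\<^bsub>M\<^esub> (z \<otimes>\<^bsub>M\<^esub> w)" if x: "x \<in> carrier M" for x
  proof -
    note c = centralD(1)[OF assms(2)] centralD(1)[OF assms(3)]
    have "z \<otimes>\<^bsub>M\<^esub> w \<otimes>\<^bsub>M\<^esub> x = z \<otimes>\<^bsub>M\<^esub> (x \<otimes>\<^bsub>M\<^esub> w)"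
      using x c centralD(2)[OF assms(3) x] by (simp add: m_assoc)
    also have "\<dots> = z \<otimes>\<^bsub>M\<^esub> x \<otimes>\<^bsub>M\<^esub> w" using x c by (simp add: m_assoc)
    also have "\<dots> = x \<otimes>\<^bsub>M\<^esub> z \<otimes>\<^bsub>M\<^esub> w" unfolding centralD(2)[OF assms(2) x] ..
    finally show ?thesis using x c by (simp add: m_assoc)
  qed
  then show ?thesis using centralD(1)[OF assms(2)] centralD(1)[OF assms(3)] by (simp add: central_def)
qed

lemma central_inv:
  assumes "monoid M" "central M z" "z \<in> Units M"
  shows "central M (inv\<^bsub>M\<^esub> z)"
proof -
  interpret monoid M by fact
  have "inv\<^bsub>M\<^esub> z \<otimes>\<^bsub>M\<^esub> x = x \<otimes>\<^bsub>M\<^esub> inv\<^bsub>M\<^esub> z" if x: "x \<in> carrier M" for x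
  proof -
    note c = centralD(1)[OF assms(2)] Units_inv_closed[OF assms(3)]
    have "inv\<^bsub>M\<^esub> z \<otimes>\<^bsub>M\<^esub> x = inv\<^bsub>M\<^esub> z \<otimes>\<^bsub>M\<^esub> (x \<otimes>\<^bsub>M\<^esub> z) \<otimes>\<^bsub>M\<^esub> inv\<^bsub>M\<^esub> z"
      using x c assms(3) by (simp add: m_assoc)
    also have "\<dots> = inv\<^bsub>M\<^esub> z \<otimes>\<^bsub>M\<^esub> (z \<otimes>\<^bsub>M\<^esub> x) \<otimes>\<^bsub>M\<^esub> inv\<^bsub>M\<^esub> z"
      unfolding centralD(2)[OF assms(2) x] ..
    also have "\<dots> = x \<otimes>\<^bsub>M\<^esub> inv\<^bsub>M\<^esub> z"
      using x c assms(3) by (simp add: m_assoc[symmetric])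
    finally show ?thesis .
  qed
  then show ?thesis using assms(3) by (simp add: central_def)
qed

lemma central_flip:
  assumes "k_algebra K A" "k_algebra K B" and z: "central (tensor_algebra K A B) z"
  shows "central (tensor_algebra K B A) (flip K A B z)"
proof -
  note fl = alg_homD[OF flip_alg_hom[OF assms(1,2)]]
    and fl' = alg_homD(1)[OF flip_alg_hom[OF assms(2,1)]]
  have "flip K A B z \<otimes>\<^bsub>tensor_algebra K B A\<^esub> y = y \<otimes>\<^bsub>tensor_algebra K B A\<^esub> flip K A B z"
    if y: "y \<in> carrier (tensor_algebra K B A)" for y
    using arg_cong[OF centralD(2)[OF z fl'[OF y]], of "flip K A B"] flip_flip[OF assms(2,1) y]
    by (simp add: fl(4) centralD(1)[OF z] fl'[OF y])
  then show ?thesis using fl(1)[OF centralD(1)[OF z]] by (simp add: central_def)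
qed

lemma (in monoid) mult_swap_inner:
  assumes "b \<otimes> c = c \<otimes> b" "a \<in> carrier G" "b \<in> carrier G" "c \<in> carrier G" "d \<in> carrier G"
  shows "(a \<otimes> b) \<otimes> (c \<otimes> d) = (a \<otimes> c) \<otimes> (b \<otimes> d)"
proof -
  have "(a \<otimes> b) \<otimes> (c \<otimes> d) = a \<otimes> ((b \<otimes> c) \<otimes> d)" using assms(2-) by (simp add: m_assoc)
  also have "\<dots> = (a \<otimes> c) \<otimes> (b \<otimes> d)" using assms by (simp add: m_assoc)
  finally show ?thesis .
qed

lemma commute_tensorI:
  assumes "k_algebra K A" "k_algebra K B" and k: "alg_hom K (tensor_algebra K A B) Y k"
    and w: "w \<in> carrier Y"
    and "\<And>a. a \<in> carrier A \<Longrightarrow>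
      w \<otimes>\<^bsub>Y\<^esub> k (pure_tensor K A B a \<one>\<^bsub>B\<^esub>) = k (pure_tensor K A B a \<one>\<^bsub>B\<^esub>) \<otimes>\<^bsub>Y\<^esub> w"
    and "\<And>b. b \<in> carrier B \<Longrightarrow>
      w \<otimes>\<^bsub>Y\<^esub> k (pure_tensor K A B \<one>\<^bsub>A\<^esub> b) = k (pure_tensor K A B \<one>\<^bsub>A\<^esub> b) \<otimes>\<^bsub>Y\<^esub> w"
    and x: "x \<in> carrier (tensor_algebra K A B)"
  shows "w \<otimes>\<^bsub>Y\<^esub> k x = k x \<otimes>\<^bsub>Y\<^esub> w"
proof -
  interpret A: k_algebra K A by fact
  interpret B: k_algebra K B by fact
  interpret Y: k_algebra K Y by (rule alg_hom_cod[OF k])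
  note pc = pure_tensor_closed_algebra[OF assms(1,2)]
  show ?thesis using A.module_axioms B.module_axioms x
  proof (induction rule: tensor_algebra_induct)
    case (pure a b)
    let ?a = "k (pure_tensor K A B a \<one>\<^bsub>B\<^esub>)" and ?b = "k (pure_tensor K A B \<one>\<^bsub>A\<^esub> b)"
    have ab: "?a \<in> carrier Y" "?b \<in> carrier Y" using pure by (simp_all add: alg_homD[OF k] pc)
    have e: "k (pure_tensor K A B a b) = ?a \<otimes>\<^bsub>Y\<^esub> ?b"
      using pure by (simp add: alg_homD(4)[OF k, symmetric] pc pure_tensor_mult[OF assms(1,2)])
    have "w \<otimes>\<^bsub>Y\<^esub> (?a \<otimes>\<^bsub>Y\<^esub> ?b) = ?a \<otimes>\<^bsub>Y\<^esub> w \<otimes>\<^bsub>Y\<^esub> ?b"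
      using ab w assms(5)[OF pure(1)] by (simp add: Y.A.m_assoc[symmetric])
    also have "\<dots> = ?a \<otimes>\<^bsub>Y\<^esub> ?b \<otimes>\<^bsub>Y\<^esub> w"
      using ab w assms(6)[OF pure(2)] by (simp add: Y.A.m_assoc)
    finally show ?case unfolding e .
  next
    case (add x y)
    then show ?case using w by (simp add: alg_homD[OF k] Y.A.l_distr Y.A.r_distr)
  qed
qed

text \<open>If \<open>z\<close> is central and \<open>h\<close> is a homomorphism, then \<open>h z\<close> commutes with the image of \<open>k\<close> as
  soon as every generator of that image lies in the image of \<open>h\<close> or commutes with it.\<close>

lemma central_image_commutes:
  assumes alg: "k_algebra K A" "k_algebra K B" "k_algebra K C" "k_algebra K D"
    and h: "alg_hom K (tensor_algebra K A B) Y h" and k: "alg_hom K (tensor_algebra K C D) Y k"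
    and z: "central (tensor_algebra K A B) z"
  defines "good \<equiv> \<lambda>y. (\<exists>u \<in> carrier (tensor_algebra K A B). y = h u) \<or>
      ((\<forall>a \<in> carrier A. y \<otimes>\<^bsub>Y\<^esub> h (pure_tensor K A B a \<one>\<^bsub>B\<^esub>) = h (pure_tensor K A B a \<one>\<^bsub>B\<^esub>) \<otimes>\<^bsub>Y\<^esub> y) \<and>
       (\<forall>b \<in> carrier B. y \<otimes>\<^bsub>Y\<^esub> h (pure_tensor K A B \<one>\<^bsub>A\<^esub> b) = h (pure_tensor K A B \<one>\<^bsub>A\<^esub> b) \<otimes>\<^bsub>Y\<^esub> y))"
  assumes c: "\<And>c. c \<in> carrier C \<Longrightarrow> good (k (pure_tensor K C D c \<one>\<^bsub>D\<^esub>))"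
    and d: "\<And>d. d \<in> carrier D \<Longrightarrow> good (k (pure_tensor K C D \<one>\<^bsub>C\<^esub> d))"
    and x: "x \<in> carrier (tensor_algebra K C D)"
  shows "h z \<otimes>\<^bsub>Y\<^esub> k x = k x \<otimes>\<^bsub>Y\<^esub> h z"
proof -
  interpret C: k_algebra K C by fact
  interpret D: k_algebra K D by fact
  note zc = centralD(1)[OF z]
  have *: "h z \<otimes>\<^bsub>Y\<^esub> y = y \<otimes>\<^bsub>Y\<^esub> h z" if y: "good y" "y \<in> carrier Y" for y
    using y(1) unfolding good_def
  proof
    assume "\<exists>u \<in> carrier (tensor_algebra K A B). y = h u"
    then obtain u where u: "u \<in> carrier (tensor_algebra K A B)" "y = h u" by blast
    then show ?thesis
      using zc by (simp add: alg_homD(4)[OF h, symmetric] centralD(2)[OF z u(1)])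
  next
    assume "(\<forall>a \<in> carrier A. y \<otimes>\<^bsub>Y\<^esub> h (pure_tensor K A B a \<one>\<^bsub>B\<^esub>) = h (pure_tensor K A B a \<one>\<^bsub>B\<^esub>) \<otimes>\<^bsub>Y\<^esub> y) \<and>
       (\<forall>b \<in> carrier B. y \<otimes>\<^bsub>Y\<^esub> h (pure_tensor K A B \<one>\<^bsub>A\<^esub> b) = h (pure_tensor K A B \<one>\<^bsub>A\<^esub> b) \<otimes>\<^bsub>Y\<^esub> y)"
    then show ?thesis
      using commute_tensorI[OF alg(1,2) h y(2) _ _ zc] by auto
  qed
  show ?thesis
    by (rule commute_tensorI[OF alg(3,4) k alg_homD(1)[OF h zc] _ _ x])
      (auto intro!: * c d alg_homD(1)[OF k] pure_tensor_closed_algebra[OF alg(3,4)])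
qed


section \<open>Weak R-matrices\<close>

text \<open>The maps that occur in the hexagon identities of \<open>R \<in> A \<otimes> B\<close>: the coproduct on one leg, with
  values in \<open>A \<otimes> (B \<otimes> B)\<close> or in \<open>(A \<otimes> A) \<otimes> B\<close>, and the leg embeddings into these algebras.\<close>

abbreviation "right_comult K A B \<equiv> tensor_map K A (tensor_algebra K B B) id (comult B)"
abbreviation "right_leg12 K A B \<equiv>
  tensor_map K A (tensor_algebra K B B) id (\<lambda>b. pure_tensor K B B b \<one>\<^bsub>B\<^esub>)"
abbreviation "right_leg13 K A B \<equiv>
  tensor_map K A (tensor_algebra K B B) id (pure_tensor K B B \<one>\<^bsub>B\<^esub>)"
abbreviation "left_comult K A B \<equiv> tensor_map K (tensor_algebra K A A) B (comult A) id"
abbreviation "left_leg13 K A B \<equiv>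
  tensor_map K (tensor_algebra K A A) B (\<lambda>a. pure_tensor K A A a \<one>\<^bsub>A\<^esub>) id"
abbreviation "left_leg23 K A B \<equiv>
  tensor_map K (tensor_algebra K A A) B (pure_tensor K A A \<one>\<^bsub>A\<^esub>) id"

lemma weak_R_matrix_iff:
  "weak_R_matrix K A B R \<longleftrightarrow> R \<in> Units (tensor_algebra K A B) \<and>
    right_comult K A B R = right_leg13 K A B R
      \<otimes>\<^bsub>tensor_algebra K A (tensor_algebra K B B)\<^esub> right_leg12 K A B R \<and>
    left_comult K A B R = left_leg13 K A B R
      \<otimes>\<^bsub>tensor_algebra K (tensor_algebra K A A) B\<^esub> left_leg23 K A B R"
  by (simp add: weak_R_matrix_def Let_def)

lemmas weak_R_matrixD = weak_R_matrix_iff[THEN iffD1, THEN conjunct1]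
  weak_R_matrix_iff[THEN iffD1, THEN conjunct2, THEN conjunct1]
  weak_R_matrix_iff[THEN iffD1, THEN conjunct2, THEN conjunct2]

lemmas weak_R_matrixI = weak_R_matrix_iff[THEN iffD2, OF conjI[OF _ conjI]]

lemma weak_R_matrix_carrier:
  assumes "k_algebra K A" "k_algebra K B" "weak_R_matrix K A B R"
  shows "R \<in> carrier (tensor_algebra K A B)"
  using weak_R_matrixD(1)[OF assms(3)] by (simp add: Units_def)

lemma leg_homs:
  assumes A: "counital_bialgebra K A" and B: "counital_bialgebra K B"
  defines "AB \<equiv> tensor_algebra K A B" and "A_BB \<equiv> tensor_algebra K A (tensor_algebra K B B)"
    and "AA_B \<equiv> tensor_algebra K (tensor_algebra K A A) B"
  shows "alg_hom K AB A_BB (right_comult K A B)" and "alg_hom K AB A_BB (right_leg13 K A B)"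
    and "alg_hom K AB A_BB (right_leg12 K A B)" and "alg_hom K AB AA_B (left_comult K A B)"
    and "alg_hom K AB AA_B (left_leg13 K A B)" and "alg_hom K AB AA_B (left_leg23 K A B)"
  unfolding assms(3-5) using counital_bialgebraD(1,3)[OF A] counital_bialgebraD(1,3)[OF B]
  by (auto intro!: tensor_map_alg_hom alg_hom_id alg_hom_pure_left alg_hom_pure_right)

lemma tensor_map_square:
  assumes f: "alg_hom K A C f" and g: "alg_hom K B D g"
    and f': "alg_hom K C E f'" and g': "alg_hom K D F g'"
    and h: "alg_hom K A C' h" and k: "alg_hom K B D' k"
    and h': "alg_hom K C' E h'" and k': "alg_hom K D' F k'"
    and "\<And>a. a \<in> carrier A \<Longrightarrow> f' (f a) = h' (h a)" "\<And>b. b \<in> carrier B \<Longrightarrow> g' (g b) = k' (k b)"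
    and x: "x \<in> carrier (tensor_algebra K A B)"
  shows "tensor_map K E F f' g' (tensor_map K C D f g x)
    = tensor_map K E F h' k' (tensor_map K C' D' h k x)"
  unfolding tensor_map_compose[OF h k h' k' x]
  by (rule tensor_map_compose_eq[OF f g f' g' assms(9,10) x])

lemma weak_R_matrix_image:
  assumes A: "counital_bialgebra K A" and B: "counital_bialgebra K B"
    and A': "counital_bialgebra K A'" and B': "counital_bialgebra K B'"
    and f: "bialg_hom K A A' f" and g: "bialg_hom K B B' g" and R: "weak_R_matrix K A B R"
  shows "weak_R_matrix K A' B' (tensor_map K A' B' f g R)"
proof -
  let ?R = "tensor_map K A' B' f g R"
  note A = counital_bialgebraD[OF A] and B = counital_bialgebraD[OF B]
  note A' = counital_bialgebraD[OF A'] and B' = counital_bialgebraD[OF B']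
  have fa: "alg_hom K A A' f" and fc: "\<And>x. x \<in> carrier A \<Longrightarrow> comult A' (f x) = tensor_map K A' A' f f (comult A x)"
    using f by (auto simp: bialg_hom_def)
  have ga: "alg_hom K B B' g" and gc: "\<And>x. x \<in> carrier B \<Longrightarrow> comult B' (g x) = tensor_map K B' B' g g (comult B x)"
    using g by (auto simp: bialg_hom_def)
  note Rc = weak_R_matrix_carrier[OF A(3) B(3) R]
  interpret A: k_algebra K A by (rule A(3))
  interpret B: k_algebra K B by (rule B(3))
  let ?AA = "tensor_algebra K A' A'" and ?BB = "tensor_algebra K B' B'"
  note ff = tensor_map_alg_hom[OF fa fa] and gg = tensor_map_alg_hom[OF ga ga]
  let ?E = "tensor_map K A' ?BB f (tensor_map K B' B' g g)"
  let ?E' = "tensor_map K ?AA B' (tensor_map K A' A' f f) g"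
  note E = tensor_map_alg_hom[OF fa gg] and E' = tensor_map_alg_hom[OF ff ga]
  note l = leg_homs[OF assms(1,2)]
  have 1: "?E (tensor_map K A (tensor_algebra K B B) id j R)
      = tensor_map K A' ?BB id j' ?R"
    if "alg_hom K B (tensor_algebra K B B) j" "alg_hom K B' ?BB j'"
      "\<And>b. b \<in> carrier B \<Longrightarrow> tensor_map K B' B' g g (j b) = j' (g b)" for j j'
    by (rule tensor_map_square[OF alg_hom_id(1)[OF A(3)] that(1) fa gg fa ga
          alg_hom_id(1)[OF A'(3)] that(2) _ that(3) Rc]) auto
  have 2: "?E' (tensor_map K (tensor_algebra K A A) B j id R)
      = tensor_map K ?AA B' j' id ?R"
    if "alg_hom K A (tensor_algebra K A A) j" "alg_hom K A' ?AA j'"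
      "\<And>a. a \<in> carrier A \<Longrightarrow> tensor_map K A' A' f f (j a) = j' (f a)" for j j'
    by (rule tensor_map_square[OF that(1) alg_hom_id(1)[OF B(3)] ff ga fa ga
          that(2) alg_hom_id(1)[OF B'(3)] that(3) _ Rc]) auto
  note inB = alg_hom_pure_left[OF B(3) B(3)] alg_hom_pure_right[OF B(3) B(3)]
  note inB' = alg_hom_pure_left[OF B'(3) B'(3)] alg_hom_pure_right[OF B'(3) B'(3)]
  note inA = alg_hom_pure_left[OF A(3) A(3)] alg_hom_pure_right[OF A(3) A(3)]
  note inA' = alg_hom_pure_left[OF A'(3) A'(3)] alg_hom_pure_right[OF A'(3) A'(3)]
  show ?thesis
  proof (rule weak_R_matrixI)
    show "?R \<in> Units (tensor_algebra K A' B')"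
      by (rule alg_hom_Units(1)[OF tensor_map_alg_hom[OF fa ga] weak_R_matrixD(1)[OF R]])
    show "right_comult K A' B' ?R
      = right_leg13 K A' B' ?R \<otimes>\<^bsub>tensor_algebra K A' ?BB\<^esub> right_leg12 K A' B' ?R"
      using arg_cong[OF weak_R_matrixD(2)[OF R], of ?E]
      by (simp add: alg_homD(4)[OF E] alg_homD(1)[OF l(2) Rc] alg_homD(1)[OF l(3) Rc]
          1[OF B(1) B'(1)] gc 1[OF inB(1) inB'(1)] 1[OF inB(2) inB'(2)]
          tensor_map_pure[OF ga ga] alg_homD(5)[OF ga])
    show "left_comult K A' B' ?R
      = left_leg13 K A' B' ?R \<otimes>\<^bsub>tensor_algebra K ?AA B'\<^esub> left_leg23 K A' B' ?R"
      using arg_cong[OF weak_R_matrixD(3)[OF R], of ?E']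
      by (simp add: alg_homD(4)[OF E'] alg_homD(1)[OF l(5) Rc] alg_homD(1)[OF l(6) Rc]
          2[OF A(1) A'(1)] fc 2[OF inA(1) inA'(1)] 2[OF inA(2) inA'(2)]
          tensor_map_pure[OF fa fa] alg_homD(5)[OF fa])
  qed
qed

text \<open>\<open>z\<^sub>1\<^sub>2\<close> commutes with \<open>x\<^sub>1\<^sub>3\<close> for central \<open>z\<close>, because the legs that are not shared
  commute anyway; likewise \<open>z\<^sub>2\<^sub>3\<close> commutes with \<open>x\<^sub>1\<^sub>3\<close>.\<close>

lemma central_legs_commute:
  assumes A: "k_algebra K A" and B: "k_algebra K B"
    and z: "central (tensor_algebra K A B) z" and x: "x \<in> carrier (tensor_algebra K A B)"
  defines "A_BB \<equiv> tensor_algebra K A (tensor_algebra K B B)"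
    and "AA_B \<equiv> tensor_algebra K (tensor_algebra K A A) B"
  shows "right_leg12 K A B z \<otimes>\<^bsub>A_BB\<^esub> right_leg13 K A B x
      = right_leg13 K A B x \<otimes>\<^bsub>A_BB\<^esub> right_leg12 K A B z" (is ?L)
    and "left_leg23 K A B z \<otimes>\<^bsub>AA_B\<^esub> left_leg13 K A B x
      = left_leg13 K A B x \<otimes>\<^bsub>AA_B\<^esub> left_leg23 K A B z" (is ?R)
proof -
  interpret A: k_algebra K A by fact
  interpret B: k_algebra K B by fact
  note AA = tensor_algebra_is_k_algebra[OF A A] and BB = tensor_algebra_is_k_algebra[OF B B]
  note pc = pure_tensor_closed_algebra[OF A A] pure_tensor_closed_algebra[OF B B]
    pure_tensor_closed_algebra[OF A B]
  note inB = alg_hom_pure_left[OF B B] alg_hom_pure_right[OF B B]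
  note inA = alg_hom_pure_left[OF A A] alg_hom_pure_right[OF A A]
  note idA = alg_hom_id(1)[OF A] and idB = alg_hom_id(1)[OF B]
  note p1 = tensor_map_pure[OF idA inB(1)] tensor_map_pure[OF idA inB(2)]
  note p2 = tensor_map_pure[OF inA(1) idB] tensor_map_pure[OF inA(2) idB]
  note m = pure_tensor_mult[OF A A] pure_tensor_mult[OF B B] pure_tensor_mult[OF A BB]
    pure_tensor_mult[OF AA B]
  show ?L unfolding A_BB_def
  proof (rule central_image_commutes[OF A B A B tensor_map_alg_hom[OF idA inB(1)]
        tensor_map_alg_hom[OF idA inB(2)] z _ _ x], goal_cases)
    case (1 a)
    then show ?case by (intro disjI1 bexI[of _ "pure_tensor K A B a \<one>\<^bsub>B\<^esub>"]) (simp_all add: p1 pc)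
  next
    case (2 b)
    then show ?case by (intro disjI2) (simp add: p1 pc m)
  qed
  show ?R unfolding AA_B_def
  proof (rule central_image_commutes[OF A B A B tensor_map_alg_hom[OF inA(2) idB]
        tensor_map_alg_hom[OF inA(1) idB] z _ _ x], goal_cases)
    case (1 a)
    then show ?case by (intro disjI2) (simp add: p2 pc m)
  next
    case (2 b)
    then show ?case by (intro disjI1 bexI[of _ "pure_tensor K A B \<one>\<^bsub>A\<^esub> b"]) (simp_all add: p2 pc)
  qed
qed

lemma weak_R_matrix_mult:
  assumes A: "counital_bialgebra K A" and B: "counital_bialgebra K B"
    and W: "weak_R_matrix K A B W" "central (tensor_algebra K A B) W"
    and R: "weak_R_matrix K A B R"
  shows "weak_R_matrix K A B (W \<otimes>\<^bsub>tensor_algebra K A B\<^esub> R)"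
proof -
  note A' = counital_bialgebraD(3)[OF A] and B' = counital_bialgebraD(3)[OF B]
  note AB = tensor_algebra_is_k_algebra[OF A' B']
  interpret AB: monoid "tensor_algebra K A B" by (rule k_algebra_monoid[OF AB])
  interpret A_BB: monoid "tensor_algebra K A (tensor_algebra K B B)"
    by (intro k_algebra_monoid[where K = K] tensor_algebra_is_k_algebra A' B')
  interpret AA_B: monoid "tensor_algebra K (tensor_algebra K A A) B"
    by (intro k_algebra_monoid[where K = K] tensor_algebra_is_k_algebra A' B')
  note c = weak_R_matrix_carrier[OF A' B' W(1)] weak_R_matrix_carrier[OF A' B' R]
  note l = leg_homs[OF A B]
  note lc = alg_homD(1)[OF l(2)] alg_homD(1)[OF l(3)] alg_homD(1)[OF l(5)] alg_homD(1)[OF l(6)]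
  note lm = alg_homD(4)[OF l(1)] alg_homD(4)[OF l(2)] alg_homD(4)[OF l(3)]
    alg_homD(4)[OF l(4)] alg_homD(4)[OF l(5)] alg_homD(4)[OF l(6)]
  let ?P = "W \<otimes>\<^bsub>tensor_algebra K A B\<^esub> R"
  show ?thesis
  proof (rule weak_R_matrixI)
    show "?P \<in> Units (tensor_algebra K A B)"
      using weak_R_matrixD(1)[OF W(1)] weak_R_matrixD(1)[OF R] by simp
  next
    note swap = A_BB.mult_swap_inner[OF central_legs_commute(1)[OF A' B' W(2) c(2)]]
    show "right_comult K A B ?P
        = right_leg13 K A B ?P
            \<otimes>\<^bsub>tensor_algebra K A (tensor_algebra K B B)\<^esub>
          right_leg12 K A B ?P"
      unfolding lm(1)[OF c] lm(2)[OF c] lm(3)[OF c] weak_R_matrixD(2)[OF W(1)] weak_R_matrixD(2)[OF R]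
      by (rule swap) (intro lc c)+
  next
    note swap = AA_B.mult_swap_inner[OF central_legs_commute(2)[OF A' B' W(2) c(2)]]
    show "left_comult K A B ?P
        = left_leg13 K A B ?P
            \<otimes>\<^bsub>tensor_algebra K (tensor_algebra K A A) B\<^esub>
          left_leg23 K A B ?P"
      unfolding lm(4)[OF c] lm(5)[OF c] lm(6)[OF c] weak_R_matrixD(3)[OF W(1)] weak_R_matrixD(3)[OF R]
      by (rule swap) (intro lc c)+
  qed
qed

lemma weak_R_matrix_inv:
  assumes A: "counital_bialgebra K A" and B: "counital_bialgebra K B"
    and W: "weak_R_matrix K A B W" "central (tensor_algebra K A B) W"
  shows "weak_R_matrix K A B (inv\<^bsub>tensor_algebra K A B\<^esub> W)"
proof -
  let ?T = "tensor_algebra K A B"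
  note A' = counital_bialgebraD(3)[OF A] and B' = counital_bialgebraD(3)[OF B]
  note AB = tensor_algebra_is_k_algebra[OF A' B']
  interpret AB: monoid ?T by (rule k_algebra_monoid[OF AB])
  interpret A_BB: monoid "tensor_algebra K A (tensor_algebra K B B)"
    by (intro k_algebra_monoid[where K = K] tensor_algebra_is_k_algebra A' B')
  interpret AA_B: monoid "tensor_algebra K (tensor_algebra K A A) B"
    by (intro k_algebra_monoid[where K = K] tensor_algebra_is_k_algebra A' B')
  note u = weak_R_matrixD(1)[OF W(1)]
  define V where "V = inv\<^bsub>?T\<^esub> W"
  have V: "V \<in> Units ?T" "V \<otimes>\<^bsub>?T\<^esub> W = \<one>\<^bsub>?T\<^esub>"
    "W \<otimes>\<^bsub>?T\<^esub> V = \<one>\<^bsub>?T\<^esub>"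
    "central ?T V"
    using u central_inv[OF AB.monoid_axioms W(2) u] by (simp_all add: V_def)
  note c = AB.Units_closed[OF u] AB.Units_closed[OF V(1)]
  note l = leg_homs[OF A B]
  note lc = alg_homD(1)[OF l(2)] alg_homD(1)[OF l(3)] alg_homD(1)[OF l(5)] alg_homD(1)[OF l(6)]
  show ?thesis unfolding V_def[symmetric]
  proof (rule weak_R_matrixI)
    show "V \<in> Units ?T" by fact
  next
    let ?d = "right_comult K A B"
    let ?r = "right_leg13 K A B"
    let ?l = "right_leg12 K A B"
    let ?M = "tensor_algebra K A (tensor_algebra K B B)"
    have "(?r V \<otimes>\<^bsub>?M\<^esub> ?l V) \<otimes>\<^bsub>?M\<^esub> (?r W \<otimes>\<^bsub>?M\<^esub> ?l W) = (?r V \<otimes>\<^bsub>?M\<^esub> ?r W) \<otimes>\<^bsub>?M\<^esub> (?l V \<otimes>\<^bsub>?M\<^esub> ?l W)"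
      by (rule A_BB.mult_swap_inner[OF central_legs_commute(1)[OF A' B' V(4) c(1)]]) (intro lc c)+
    also have "\<dots> = \<one>\<^bsub>?M\<^esub>"
      by (simp add: alg_homD(4)[OF l(2), symmetric] alg_homD(4)[OF l(3), symmetric] c V(2)
          alg_homD(5)[OF l(2)] alg_homD(5)[OF l(3)])
    finally have 1: "(?r V \<otimes>\<^bsub>?M\<^esub> ?l V) \<otimes>\<^bsub>?M\<^esub> ?d W = \<one>\<^bsub>?M\<^esub>"
      by (simp add: weak_R_matrixD(2)[OF W(1)])
    have 2: "?d W \<otimes>\<^bsub>?M\<^esub> ?d V = \<one>\<^bsub>?M\<^esub>"
      by (simp add: alg_homD(4)[OF l(1), symmetric] c V(3) alg_homD(5)[OF l(1)])
    show "?d V = ?r V \<otimes>\<^bsub>?M\<^esub> ?l V"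
      by (rule A_BB.inv_unique[OF 1 2, symmetric]) (intro A_BB.m_closed lc alg_homD(1)[OF l(1)] c)+
  next
    let ?d = "left_comult K A B"
    let ?r = "left_leg13 K A B"
    let ?l = "left_leg23 K A B"
    let ?M = "tensor_algebra K (tensor_algebra K A A) B"
    have "(?r V \<otimes>\<^bsub>?M\<^esub> ?l V) \<otimes>\<^bsub>?M\<^esub> (?r W \<otimes>\<^bsub>?M\<^esub> ?l W) = (?r V \<otimes>\<^bsub>?M\<^esub> ?r W) \<otimes>\<^bsub>?M\<^esub> (?l V \<otimes>\<^bsub>?M\<^esub> ?l W)"
      by (rule AA_B.mult_swap_inner[OF central_legs_commute(2)[OF A' B' V(4) c(1)]]) (intro lc c)+
    also have "\<dots> = \<one>\<^bsub>?M\<^esub>"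
      by (simp add: alg_homD(4)[OF l(5), symmetric] alg_homD(4)[OF l(6), symmetric] c V(2)
          alg_homD(5)[OF l(5)] alg_homD(5)[OF l(6)])
    finally have 1: "(?r V \<otimes>\<^bsub>?M\<^esub> ?l V) \<otimes>\<^bsub>?M\<^esub> ?d W = \<one>\<^bsub>?M\<^esub>"
      by (simp add: weak_R_matrixD(3)[OF W(1)])
    have 2: "?d W \<otimes>\<^bsub>?M\<^esub> ?d V = \<one>\<^bsub>?M\<^esub>"
      by (simp add: alg_homD(4)[OF l(4), symmetric] c V(3) alg_homD(5)[OF l(4)])
    show "?d V = ?r V \<otimes>\<^bsub>?M\<^esub> ?l V"
      by (rule AA_B.inv_unique[OF 1 2, symmetric]) (intro AA_B.m_closed lc alg_homD(1)[OF l(4)] c)+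
  qed
qed

lemma (in monoid) mult_cancel_inner:
  assumes "b \<otimes> c = \<one>" "a \<otimes> d = \<one>"
    and "a \<in> carrier G" "b \<in> carrier G" "c \<in> carrier G" "d \<in> carrier G"
  shows "(a \<otimes> b) \<otimes> (c \<otimes> d) = \<one>"
proof -
  have "(a \<otimes> b) \<otimes> (c \<otimes> d) = a \<otimes> ((b \<otimes> c) \<otimes> d)" using assms(3-) by (simp add: m_assoc)
  then show ?thesis using assms by simp
qed

text \<open>The flip exchanges the two hexagon identities and thereby leaves their factors in the wrong
  order; taking the inverse reverses them. Hence no centrality is needed here, in contrast to the
  inverse alone.\<close>

lemma weak_R_matrix_flip_inv:
  assumes A: "counital_bialgebra K A" and B: "counital_bialgebra K B"
    and R: "weak_R_matrix K A B R"
  shows "weak_R_matrix K B A (inv\<^bsub>tensor_algebra K B A\<^esub> (flip K A B R))"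
proof -
  let ?T = "tensor_algebra K B A"
  note A' = counital_bialgebraD[OF A] and B' = counital_bialgebraD[OF B]
  note Rc = weak_R_matrix_carrier[OF A'(3) B'(3) R]
  note BA = tensor_algebra_is_k_algebra[OF B'(3) A'(3)]
  note AA = tensor_algebra_is_k_algebra[OF A'(3) A'(3)]
  note BB = tensor_algebra_is_k_algebra[OF B'(3) B'(3)]
  interpret BA: monoid ?T by (rule k_algebra_monoid[OF BA])
  interpret B_AA: monoid "tensor_algebra K B (tensor_algebra K A A)"
    by (intro k_algebra_monoid[where K = K] tensor_algebra_is_k_algebra A' B')
  interpret BB_A: monoid "tensor_algebra K (tensor_algebra K B B) A"
    by (intro k_algebra_monoid[where K = K] tensor_algebra_is_k_algebra A' B')
  define U where "U = flip K A B R"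
  define V where "V = inv\<^bsub>?T\<^esub> U"
  have U: "U \<in> Units ?T"
    unfolding U_def by (rule alg_hom_Units(1)[OF flip_alg_hom[OF A'(3) B'(3)] weak_R_matrixD(1)[OF R]])
  have V: "V \<in> Units ?T" "V \<otimes>\<^bsub>?T\<^esub> U = \<one>\<^bsub>?T\<^esub>"
    "U \<otimes>\<^bsub>?T\<^esub> V = \<one>\<^bsub>?T\<^esub>"
    using U by (simp_all add: V_def)
  note c = BA.Units_closed[OF U] BA.Units_closed[OF V(1)]
  note l = leg_homs[OF B A] and k = leg_homs[OF A B]
  note lc = alg_homD(1)[OF l(2)] alg_homD(1)[OF l(3)] alg_homD(1)[OF l(5)] alg_homD(1)[OF l(6)]
  note idA = alg_hom_id(1)[OF A'(3)] and idB = alg_hom_id(1)[OF B'(3)]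
  note inA = alg_hom_pure_left[OF A'(3) A'(3)] alg_hom_pure_right[OF A'(3) A'(3)]
  note inB = alg_hom_pure_left[OF B'(3) B'(3)] alg_hom_pure_right[OF B'(3) B'(3)]
  show ?thesis unfolding U_def[symmetric] V_def[symmetric]
  proof (rule weak_R_matrixI)
    show "V \<in> Units ?T" by fact
  next
    let ?AA = "tensor_algebra K A A"
    let ?M = "tensor_algebra K B ?AA"
    let ?d = "tensor_map K B ?AA id (comult A)"
    let ?r = "tensor_map K B ?AA id (pure_tensor K A A \<one>\<^bsub>A\<^esub>)"
    let ?l = "tensor_map K B ?AA id (\<lambda>a. pure_tensor K A A a \<one>\<^bsub>A\<^esub>)"
    have "?d U = flip K ?AA B (tensor_map K ?AA B (comult A) id R)"
      unfolding U_def by (rule flip_tensor_map[OF A'(1) idB Rc, symmetric])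
    also have "\<dots> = ?l U \<otimes>\<^bsub>?M\<^esub> ?r U"
      unfolding weak_R_matrixD(3)[OF R] U_def
      by (simp add: alg_homD(4)[OF flip_alg_hom[OF AA B'(3)]] alg_homD(1)[OF k(5) Rc]
          alg_homD(1)[OF k(6) Rc] flip_tensor_map[OF inA(1) idB Rc] flip_tensor_map[OF inA(2) idB Rc])
    finally have d: "?d U = ?l U \<otimes>\<^bsub>?M\<^esub> ?r U" .
    have 1: "(?r V \<otimes>\<^bsub>?M\<^esub> ?l V) \<otimes>\<^bsub>?M\<^esub> ?d U = \<one>\<^bsub>?M\<^esub>"
      unfolding d
      by (rule B_AA.mult_cancel_inner)
        (simp_all add: alg_homD(4)[OF l(2), symmetric] alg_homD(4)[OF l(3), symmetric] c V
          alg_homD(5)[OF l(2)] alg_homD(5)[OF l(3)] lc)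
    have 2: "?d U \<otimes>\<^bsub>?M\<^esub> ?d V = \<one>\<^bsub>?M\<^esub>"
      by (simp add: alg_homD(4)[OF l(1), symmetric] c V alg_homD(5)[OF l(1)])
    show "?d V = ?r V \<otimes>\<^bsub>?M\<^esub> ?l V"
      by (rule B_AA.inv_unique[OF 1 2, symmetric]) (intro B_AA.m_closed lc alg_homD(1)[OF l(1)] c)+
  next
    let ?BB = "tensor_algebra K B B"
    let ?M = "tensor_algebra K ?BB A"
    let ?d = "tensor_map K ?BB A (comult B) id"
    let ?l = "tensor_map K ?BB A (\<lambda>b. pure_tensor K B B b \<one>\<^bsub>B\<^esub>) id"
    let ?r = "tensor_map K ?BB A (pure_tensor K B B \<one>\<^bsub>B\<^esub>) id"
    have "?d U = flip K A ?BB (tensor_map K A ?BB id (comult B) R)"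
      unfolding U_def by (rule flip_tensor_map[OF idA B'(1) Rc, symmetric])
    also have "\<dots> = ?r U \<otimes>\<^bsub>?M\<^esub> ?l U"
      unfolding weak_R_matrixD(2)[OF R] U_def
      by (simp add: alg_homD(4)[OF flip_alg_hom[OF A'(3) BB]] alg_homD(1)[OF k(2) Rc]
          alg_homD(1)[OF k(3) Rc] flip_tensor_map[OF idA inB(1) Rc] flip_tensor_map[OF idA inB(2) Rc])
    finally have d: "?d U = ?r U \<otimes>\<^bsub>?M\<^esub> ?l U" .
    have 1: "(?l V \<otimes>\<^bsub>?M\<^esub> ?r V) \<otimes>\<^bsub>?M\<^esub> ?d U = \<one>\<^bsub>?M\<^esub>"
      unfolding d
      by (rule BB_A.mult_cancel_inner)
        (simp_all add: alg_homD(4)[OF l(5), symmetric] alg_homD(4)[OF l(6), symmetric] c V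
          alg_homD(5)[OF l(5)] alg_homD(5)[OF l(6)] lc)
    have 2: "?d U \<otimes>\<^bsub>?M\<^esub> ?d V = \<one>\<^bsub>?M\<^esub>"
      by (simp add: alg_homD(4)[OF l(4), symmetric] c V alg_homD(5)[OF l(4)])
    show "?d V = ?l V \<otimes>\<^bsub>?M\<^esub> ?r V"
      by (rule BB_A.inv_unique[OF 1 2, symmetric]) (intro BB_A.m_closed lc alg_homD(1)[OF l(4)] c)+
  qed
qed

text \<open>Applying the counit to the first leg of \<open>(\<Delta> \<otimes> Id)(R) = R\<^sub>1\<^sub>3 R\<^sub>2\<^sub>3\<close> gives \<open>R = (1 \<otimes> r) R\<close> with
  \<open>r = (\<epsilon> \<otimes> Id)(R)\<close>, and \<open>R\<close> can be cancelled. The statement for the second leg follows by passing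
  to the inverse of the flip.\<close>

lemma weak_R_matrix_counit_left:
  assumes A: "counital_bialgebra K A" and B: "counital_bialgebra K B"
    and R: "weak_R_matrix K A B R"
  shows "apply_left K B (counit A) R = \<one>\<^bsub>B\<^esub>"
proof -
  note A' = counital_bialgebraD[OF A] and B' = counital_bialgebraD[OF B]
  interpret A: k_algebra K A by (rule A'(3))
  interpret B: k_algebra K B by (rule B'(3))
  note Rc = weak_R_matrix_carrier[OF A'(3) B'(3) R]
  note AB = tensor_algebra_is_k_algebra[OF A'(3) B'(3)]
  interpret AB: monoid "tensor_algebra K A B" by (rule k_algebra_monoid[OF AB])
  note idB = alg_hom_id[OF B'(3)]
  note inA = alg_hom_pure_left[OF A'(3) A'(3)] alg_hom_pure_right[OF A'(3) A'(3)]
  note l = leg_homs[OF A B]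
  note u = weak_R_matrixD(1)[OF R]
  let ?T = "tensor_algebra K A B"
  have cancel: "x = \<one>\<^bsub>?T\<^esub>" if "R = x \<otimes>\<^bsub>?T\<^esub> R" "x \<in> carrier ?T" for x
  proof -
    have "x \<otimes>\<^bsub>?T\<^esub> R \<otimes>\<^bsub>?T\<^esub> inv\<^bsub>?T\<^esub> R = R \<otimes>\<^bsub>?T\<^esub> inv\<^bsub>?T\<^esub> R" using that(1) by simp
    then show ?thesis using that(2) u AB.Units_closed[OF u] by (simp add: AB.m_assoc)
  qed
  note aA = apply_left_alg_hom[OF A'(3) A'(2)] and pA = apply_left_pure[OF A'(3) A'(2)]
    and eA = alg_hom_functional[OF A'(2)]
  note rA = alg_homD(1)[OF apply_left_alg_hom[OF B'(3) A'(2)] Rc]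
  let ?E = "tensor_map K A B (apply_left K A (counit A)) id"
  note E = tensor_map_alg_hom[OF aA idB(1)]
  let ?r = "pure_tensor K A B \<one>\<^bsub>A\<^esub> (apply_left K B (counit A) R)"
  have 1: "?E (left_comult K A B R) = R"
    by (subst tensor_map_compose_eq[OF A'(1) idB(1) aA idB(1), where h = "\<lambda>a. a" and k = "\<lambda>b. b"])
      (simp_all add: A'(4) Rc tensor_map_id[OF A'(3) B'(3)])
  have 2: "?E (left_leg23 K A B R) = R"
    by (subst tensor_map_compose_eq[OF inA(2) idB(1) aA idB(1), where h = "\<lambda>a. a" and k = "\<lambda>b. b"])
      (simp_all add: pA eA Rc tensor_map_id[OF A'(3) B'(3)])
  have 3: "?E (left_leg13 K A B R) = ?r"
    by (subst tensor_map_compose_eq[OF inA(1) idB(1) aA idB(1),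
          where h = "\<lambda>a. counit A a \<odot>\<^bsub>A\<^esub> \<one>\<^bsub>A\<^esub>" and k = "\<lambda>b. b"])
      (simp_all add: pA Rc tensor_map_apply_left[OF idB(2) A'(3) A'(2) Rc])
  have "?r = \<one>\<^bsub>?T\<^esub>"
    using arg_cong[OF weak_R_matrixD(3)[OF R], of ?E]
    by (intro cancel)
      (simp_all add: 1 2 3 alg_homD(4)[OF E] alg_homD(1)[OF l(5) Rc] alg_homD(1)[OF l(6) Rc]
        pure_tensor_closed_algebra[OF A'(3) B'(3)] rA)
  then have "apply_left K B (counit A) ?r = \<one>\<^bsub>B\<^esub>"
    by (simp add: alg_homD(5)[OF apply_left_alg_hom[OF B'(3) A'(2)]])
  then show "apply_left K B (counit A) R = \<one>\<^bsub>B\<^esub>"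
    by (simp add: apply_left_pure[OF B'(3) A'(2)] eA rA)
qed

lemma weak_R_matrix_counit_right:
  assumes A: "counital_bialgebra K A" and B: "counital_bialgebra K B"
    and R: "weak_R_matrix K A B R"
  shows "apply_right K A (counit B) R = \<one>\<^bsub>A\<^esub>"
proof -
  note A' = counital_bialgebraD[OF A] and B' = counital_bialgebraD[OF B]
  interpret A: k_algebra K A by (rule A'(3))
  let ?U = "flip K A B R"
  note L = apply_left_alg_hom[OF A'(3) B'(2)]
  have U: "?U \<in> Units (tensor_algebra K B A)"
    by (rule alg_hom_Units(1)[OF flip_alg_hom[OF A'(3) B'(3)] weak_R_matrixD(1)[OF R]])
  have "inv\<^bsub>A\<^esub> (apply_left K A (counit B) ?U) = \<one>\<^bsub>A\<^esub>"
    using weak_R_matrix_counit_left[OF B A weak_R_matrix_flip_inv[OF A B R]]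
    by (simp add: alg_hom_Units(2)[OF L U])
  then have "apply_left K A (counit B) ?U = \<one>\<^bsub>A\<^esub>"
    using A.A.Units_inv_inv[OF alg_hom_Units(1)[OF L U]] by simp
  then show ?thesis
    by (simp add: apply_left_flip[OF A'(3) B'(2) weak_R_matrix_carrier[OF A'(3) B'(3) R]])
qed


section \<open>Quasitriangular structures\<close>

lemma (in monoid) conj_eq_iff:
  assumes "u \<in> Units G" "x \<in> carrier G" "y \<in> carrier G"
  shows "y = u \<otimes> x \<otimes> inv u \<longleftrightarrow> y \<otimes> u = u \<otimes> x"
proof
  assume "y = u \<otimes> x \<otimes> inv u"
  then show "y \<otimes> u = u \<otimes> x" using assms Units_closed[OF assms(1)] by (simp add: m_assoc)
next
  assume "y \<otimes> u = u \<otimes> x"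
  then have "u \<otimes> x \<otimes> inv u = y \<otimes> u \<otimes> inv u" by simp
  then show "y = u \<otimes> x \<otimes> inv u"
    using assms Units_closed[OF assms(1)] by (simp add: m_assoc)
qed

lemma quasitriangular_iff:
  assumes H: "counital_bialgebra K H"
  shows "quasitriangular K H R \<longleftrightarrow> weak_R_matrix K H H R \<and>
    (\<forall>x \<in> carrier H. flip K H H (comult H x) \<otimes>\<^bsub>tensor_algebra K H H\<^esub> R
      = R \<otimes>\<^bsub>tensor_algebra K H H\<^esub> comult H x)"
proof -
  note H' = counital_bialgebraD[OF H]
  note HH = tensor_algebra_is_k_algebra[OF H'(3) H'(3)]
  interpret HH: monoid "tensor_algebra K H H" by (rule k_algebra_monoid[OF HH])
  note c = alg_homD(1)[OF H'(1)] and fc = alg_homD(1)[OF flip_alg_hom[OF H'(3) H'(3)]]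
  show ?thesis unfolding quasitriangular_def Let_def
    using HH.conj_eq_iff[OF weak_R_matrixD(1) c fc[OF c]] by blast
qed

lemma quasitriangular_mult:
  assumes H: "counital_bialgebra K H" and W: "weak_R_matrix K H H W" "central (tensor_algebra K H H) W"
    and S: "quasitriangular K H S"
  shows "quasitriangular K H (W \<otimes>\<^bsub>tensor_algebra K H H\<^esub> S)"
proof -
  note H' = counital_bialgebraD[OF H]
  note HH = tensor_algebra_is_k_algebra[OF H'(3) H'(3)]
  let ?M = "tensor_algebra K H H"
  interpret HH: monoid ?M by (rule k_algebra_monoid[OF HH])
  note c = alg_homD(1)[OF H'(1)] and fc = alg_homD(1)[OF flip_alg_hom[OF H'(3) H'(3)]]
  have Sw: "weak_R_matrix K H H S" and Sq: "\<And>x. x \<in> carrier H \<Longrightarrow>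
      flip K H H (comult H x) \<otimes>\<^bsub>?M\<^esub> S = S \<otimes>\<^bsub>?M\<^esub> comult H x"
    using S by (auto simp: quasitriangular_iff[OF H])
  note wc = weak_R_matrix_carrier[OF H'(3) H'(3) W(1)] weak_R_matrix_carrier[OF H'(3) H'(3) Sw]
  have "flip K H H (comult H x) \<otimes>\<^bsub>?M\<^esub> (W \<otimes>\<^bsub>?M\<^esub> S) = W \<otimes>\<^bsub>?M\<^esub> S \<otimes>\<^bsub>?M\<^esub> comult H x"
    if x: "x \<in> carrier H" for x
  proof -
    let ?y = "flip K H H (comult H x)"
    have y: "?y \<in> carrier ?M" by (intro fc c x)
    have "?y \<otimes>\<^bsub>?M\<^esub> (W \<otimes>\<^bsub>?M\<^esub> S) = ?y \<otimes>\<^bsub>?M\<^esub> W \<otimes>\<^bsub>?M\<^esub> S"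
      using y wc by (simp add: HH.m_assoc)
    also have "\<dots> = W \<otimes>\<^bsub>?M\<^esub> ?y \<otimes>\<^bsub>?M\<^esub> S"
      unfolding centralD(2)[OF W(2) y] ..
    also have "\<dots> = W \<otimes>\<^bsub>?M\<^esub> S \<otimes>\<^bsub>?M\<^esub> comult H x"
      using y wc x c by (simp add: HH.m_assoc Sq)
    finally show ?thesis .
  qed
  then show ?thesis
    using weak_R_matrix_mult[OF H H W Sw] by (simp add: quasitriangular_iff[OF H])
qed

lemma quasitriangular_image:
  assumes H: "counital_bialgebra K H" and A: "counital_bialgebra K A"
    and f: "bialg_hom K H A f" and surj: "f ` carrier H = carrier A"
    and S: "quasitriangular K H S"
  shows "quasitriangular K A (tensor_map K A A f f S)"
proof -
  note H' = counital_bialgebraD[OF H]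
  have fa: "alg_hom K H A f" and fc: "\<And>x. x \<in> carrier H \<Longrightarrow> comult A (f x) = tensor_map K A A f f (comult H x)"
    using f by (auto simp: bialg_hom_def)
  note ff = alg_homD[OF tensor_map_alg_hom[OF fa fa]]
  note c = alg_homD(1)[OF H'(1)]
  note flc = alg_homD(1)[OF flip_alg_hom[OF H'(3) H'(3)] c]
  have Sw: "weak_R_matrix K H H S" and Sq: "\<And>x. x \<in> carrier H \<Longrightarrow>
      flip K H H (comult H x) \<otimes>\<^bsub>tensor_algebra K H H\<^esub> S = S \<otimes>\<^bsub>tensor_algebra K H H\<^esub> comult H x"
    using S by (auto simp: quasitriangular_iff[OF H])
  note Sc = weak_R_matrix_carrier[OF H'(3) H'(3) Sw]
  have *: "flip K A A (comult A (f x)) \<otimes>\<^bsub>tensor_algebra K A A\<^esub> tensor_map K A A f f S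
      = tensor_map K A A f f S \<otimes>\<^bsub>tensor_algebra K A A\<^esub> comult A (f x)" if x: "x \<in> carrier H" for x
    unfolding fc[OF x] flip_tensor_map[OF fa fa c[OF x]]
      ff(4)[OF flc[OF x] Sc, symmetric] ff(4)[OF Sc c[OF x], symmetric] Sq[OF x] ..
  have "flip K A A (comult A a) \<otimes>\<^bsub>tensor_algebra K A A\<^esub> tensor_map K A A f f S
      = tensor_map K A A f f S \<otimes>\<^bsub>tensor_algebra K A A\<^esub> comult A a" if "a \<in> carrier A" for a
  proof -
    obtain x where "x \<in> carrier H" "a = f x" using \<open>a \<in> carrier A\<close> surj by blast
    then show ?thesis using * by blast
  qed
  then show ?thesis
    using weak_R_matrix_image[OF H H A A f f Sw] by (simp add: quasitriangular_iff[OF A])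
qed

text \<open>The cocycle condition becomes the Yang--Baxter equation
  \<open>S\<^sub>1\<^sub>2 S\<^sub>1\<^sub>3 S\<^sub>2\<^sub>3 = S\<^sub>2\<^sub>3 S\<^sub>1\<^sub>3 S\<^sub>1\<^sub>2\<close> once the coproducts are
  expanded. The latter follows by moving \<open>S\<^sub>2\<^sub>3\<close> past \<open>(Id \<otimes> \<Delta>)(S)\<close>, which turns the coproduct into the
  opposite one.\<close>

lemma quasitriangular_imp_twist:
  assumes H: "counital_bialgebra K H" and S: "quasitriangular K H S"
  shows "twist K H S"
proof -
  note H' = counital_bialgebraD[OF H]
  let ?HH = "tensor_algebra K H H"
  let ?M = "tensor_algebra K H ?HH"
  note HH = tensor_algebra_is_k_algebra[OF H'(3) H'(3)]
  note HH_H = tensor_algebra_is_k_algebra[OF HH H'(3)]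
  note H_HH = tensor_algebra_is_k_algebra[OF H'(3) HH]
  interpret H: k_algebra K H by (rule H'(3))
  interpret HH: k_algebra K ?HH by (rule HH)
  interpret M: k_algebra K ?M by (rule H_HH)
  have Sw: "weak_R_matrix K H H S" and Sq: "\<And>x. x \<in> carrier H \<Longrightarrow>
      flip K H H (comult H x) \<otimes>\<^bsub>?HH\<^esub> S = S \<otimes>\<^bsub>?HH\<^esub> comult H x"
    using S by (auto simp: quasitriangular_iff[OF H])
  note Sc = weak_R_matrix_carrier[OF H'(3) H'(3) Sw]
  note l = leg_homs[OF H H]
  note idH = alg_hom_id(1)[OF H'(3)]
  note inH = alg_hom_pure_left[OF H'(3) H'(3)] alg_hom_pure_right[OF H'(3) H'(3)]
  note as = assoc_alg_hom[OF H'(3) H'(3) H'(3)] and asp = assoc_pure[OF H'(3) H'(3) H'(3)]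
  note c = alg_homD(1)[OF H'(1)] and fl = flip_alg_hom[OF H'(3) H'(3)]
  note pcH = pure_tensor_closed_algebra[OF H'(3) HH]
  let ?S12 = "tensor_map K H ?HH id (\<lambda>b. pure_tensor K H H b \<one>\<^bsub>H\<^esub>)"
  let ?S13 = "tensor_map K H ?HH id (pure_tensor K H H \<one>\<^bsub>H\<^esub>)"
  let ?S23 = "pure_tensor K H ?HH \<one>\<^bsub>H\<^esub>"
  have a12: "assoc K H H H (pure_tensor K ?HH H x \<one>\<^bsub>H\<^esub>) = ?S12 x" if "x \<in> carrier ?HH" for x
    by (rule alg_hom_tensor_ext[OF H'(3) H'(3) alg_hom_compose[OF alg_hom_pure_left[OF HH H'(3)] as]
          l(3) _ _ that]) (simp_all add: asp tensor_map_pure[OF idH inH(1)])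
  have a13: "assoc K H H H (tensor_map K ?HH H (\<lambda>a. pure_tensor K H H a \<one>\<^bsub>H\<^esub>) id x) = ?S13 x"
    if "x \<in> carrier ?HH" for x
    by (rule alg_hom_tensor_ext[OF H'(3) H'(3) alg_hom_compose[OF l(5) as] l(2) _ _ that])
      (simp_all add: asp tensor_map_pure[OF inH(1) idH] tensor_map_pure[OF idH inH(2)])
  have a23: "assoc K H H H (tensor_map K ?HH H (pure_tensor K H H \<one>\<^bsub>H\<^esub>) id x) = ?S23 x"
    if "x \<in> carrier ?HH" for x
    by (rule alg_hom_tensor_ext[OF H'(3) H'(3) alg_hom_compose[OF l(6) as]
          alg_hom_pure_right[OF H'(3) HH] _ _ that])
      (simp_all add: asp tensor_map_pure[OF inH(2) idH])
  have car: "?S12 S \<in> carrier ?M" "?S13 S \<in> carrier ?M" "?S23 S \<in> carrier ?M"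
    using alg_homD(1)[OF l(3) Sc] alg_homD(1)[OF l(2) Sc] pcH Sc by auto
  have "assoc K H H H (pure_tensor K ?HH H S \<one>\<^bsub>H\<^esub> \<otimes>\<^bsub>tensor_algebra K ?HH H\<^esub>
      tensor_map K ?HH H (comult H) id S) = ?S12 S \<otimes>\<^bsub>?M\<^esub> (?S13 S \<otimes>\<^bsub>?M\<^esub> ?S23 S)"
    using alg_homD(1)[OF l(5) Sc] alg_homD(1)[OF l(6) Sc]
    by (simp add: weak_R_matrixD(3)[OF Sw] alg_homD[OF as] a12 a13 a23 Sc
        pure_tensor_closed_algebra[OF HH H'(3)] k_algebra.axioms ring.ring_simprules(5)
        monoid.m_closed[OF k_algebra_monoid[OF HH_H]])
  moreover have "?S23 S \<otimes>\<^bsub>?M\<^esub> tensor_map K H ?HH id (comult H) S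
      = ?S12 S \<otimes>\<^bsub>?M\<^esub> ?S13 S \<otimes>\<^bsub>?M\<^esub> ?S23 S"
  proof -
    define d where "d = tensor_map K H ?HH id (comult H)"
    define f where "f = tensor_map K H ?HH id (flip K H H)"
    have d: "alg_hom K ?HH ?M d" and f: "alg_hom K ?M ?M f"
      unfolding d_def f_def using l(1) tensor_map_alg_hom[OF idH fl] by auto
    have dp: "d (pure_tensor K H H a b) = pure_tensor K H ?HH a (comult H b)"
      if "a \<in> carrier H" "b \<in> carrier H" for a b
      unfolding d_def using tensor_map_pure[OF idH H'(1) that] by simp
    have fp: "f (pure_tensor K H ?HH a y) = pure_tensor K H ?HH a (flip K H H y)"
      if "a \<in> carrier H" "y \<in> carrier ?HH" for a y
      unfolding f_def using tensor_map_pure[OF idH fl that] by simp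
    have *: "?S23 S \<otimes>\<^bsub>?M\<^esub> d x = f (d x) \<otimes>\<^bsub>?M\<^esub> ?S23 S" if "x \<in> carrier ?HH" for x
      using H.module_axioms H.module_axioms that
    proof (induction rule: tensor_algebra_induct)
      case (pure a b)
      then show ?case
        using c[OF pure(2)] Sc
        by (simp add: dp fp pure_tensor_mult[OF H'(3) HH] Sq alg_homD(1)[OF fl])
    next
      case (add x y)
      then show ?case
        using car(3) by (simp add: alg_homD[OF d] alg_homD[OF f] M.A.l_distr M.A.r_distr)
    qed
    have f12: "f (?S12 S) = ?S13 S"
      unfolding f_def by (rule tensor_map_compose_eq[OF idH inH(1) idH fl _ _ Sc])
        (simp_all add: flip_pure[OF H'(3) H'(3)])
    have f13: "f (?S13 S) = ?S12 S"
      unfolding f_def by (rule tensor_map_compose_eq[OF idH inH(2) idH fl _ _ Sc])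
        (simp_all add: flip_pure[OF H'(3) H'(3)])
    show ?thesis
      unfolding d_def[symmetric] *[OF Sc]
      using car by (simp add: d_def weak_R_matrixD(2)[OF Sw] alg_homD(4)[OF f] f12 f13)
  qed
  ultimately show ?thesis
    using car weak_R_matrixD(1)[OF Sw] weak_R_matrix_counit_left[OF H H Sw]
      weak_R_matrix_counit_right[OF H H Sw]
    by (simp add: twist_def Let_def M.A.m_assoc)
qed

section \<open>The structure of quasitriangular structures on a tensor product\<close>

text \<open>The computation in the algebra \<open>H \<otimes> H\<close> behind the gauge transformation.\<close>

lemma central_rearrange:
  fixes G :: "('a, 'm) ring_scheme" (structure)
  assumes "monoid G"
    and c: "central G w" "central G g" "central G v" "central G h"
    and r: "r \<in> carrier G" and v': "v' \<in> carrier G" "v' \<otimes> v = \<one>"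
  shows "g \<otimes> (w \<otimes> r \<otimes> h) = (h \<otimes> v' \<otimes> r) \<otimes> (w \<otimes> g \<otimes> v)"
proof -
  interpret monoid G by fact
  note k = centralD(1)[OF c(1)] centralD(1)[OF c(2)] centralD(1)[OF c(3)] centralD(1)[OF c(4)] r v'(1)
  define x where "x = (h \<otimes> v' \<otimes> r) \<otimes> (w \<otimes> g \<otimes> v)"
  have "x = h \<otimes> v' \<otimes> (r \<otimes> (w \<otimes> g)) \<otimes> v"
    unfolding x_def using k by (simp add: m_assoc)
  also have "\<dots> = v \<otimes> (h \<otimes> v' \<otimes> (r \<otimes> (w \<otimes> g)))"
    by (rule centralD(2)[OF c(3), symmetric]) (simp add: k)
  also have "\<dots> = v \<otimes> h \<otimes> (v' \<otimes> (r \<otimes> (w \<otimes> g)))" using k by (simp add: m_assoc)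
  also have "v \<otimes> h = h \<otimes> v" by (rule centralD(2)[OF c(3) k(4)])
  also have "h \<otimes> v \<otimes> (v' \<otimes> (r \<otimes> (w \<otimes> g))) = h \<otimes> (v \<otimes> v') \<otimes> (r \<otimes> (w \<otimes> g))"
    using k by (simp add: m_assoc)
  also have "v \<otimes> v' = \<one>" using centralD(2)[OF c(3) v'(1)] v'(2) by simp
  also have "h \<otimes> \<one> \<otimes> (r \<otimes> (w \<otimes> g)) = h \<otimes> (r \<otimes> (w \<otimes> g))" using k by simp
  also have "\<dots> = r \<otimes> (w \<otimes> g) \<otimes> h" by (rule centralD(2)[OF c(4)]) (simp add: k)
  also have "w \<otimes> g = g \<otimes> w" by (rule centralD(2)[OF c(1) k(2)])
  also have "r \<otimes> (g \<otimes> w) = r \<otimes> g \<otimes> w" using k by (simp add: m_assoc)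
  also have "r \<otimes> g = g \<otimes> r" by (rule centralD(2)[OF c(2) k(5), symmetric])
  also have "g \<otimes> r \<otimes> w \<otimes> h = g \<otimes> (r \<otimes> w) \<otimes> h" using k by (simp add: m_assoc)
  also have "r \<otimes> w = w \<otimes> r" by (rule centralD(2)[OF c(1) k(5), symmetric])
  finally have "x = g \<otimes> (w \<otimes> r) \<otimes> h" .
  then show ?thesis unfolding x_def using k by (simp add: m_assoc)
qed

text \<open>A quasitriangular structure \<open>S\<close> on \<open>A \<otimes> B\<close> and its four components, in \<open>A \<otimes> B\<close>, \<open>B \<otimes> A\<close>,
  \<open>A \<otimes> A\<close> and \<open>B \<otimes> B\<close>.\<close>

locale quasitriangular_tensor = two_bialgebras K A B
  for K :: "('k, 'm) ring_scheme" and A :: "('k, 'a) bialg" and B :: "('k, 'b) bialg" +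
  fixes S
  assumes quasi: "quasitriangular K H S"
begin

definition "G = tensor_map K A B prA prB S"
definition "H' = tensor_map K B A prB prA S"
definition "R1 = tensor_map K A A prA prA S"
definition "R2 = tensor_map K B B prB prB S"

abbreviation "BA \<equiv> tensor_algebra K B A"
abbreviation "HH \<equiv> tensor_algebra K AB AB"
abbreviation HH_mult (infixl \<open>\<bullet>\<close> 70) where "x \<bullet> y \<equiv> x \<otimes>\<^bsub>HH\<^esub> y"

lemma algBA: "k_algebra K BA"
  by (rule tensor_algebra_is_k_algebra[OF B(3) A(3)])

lemma algHH: "k_algebra K HH"
  by (rule tensor_algebra_is_k_algebra[OF algAB algAB])

sublocale BA: k_algebra K BA by (rule algBA)
sublocale HH: k_algebra K HH by (rule algHH)

lemma weak_S: "weak_R_matrix K H H S"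
  and S_flip: "x \<in> carrier AB \<Longrightarrow> flip K AB AB (comult H x) \<bullet> S = S \<bullet> comult H x"
  using quasi by (auto simp: quasitriangular_iff[OF tensor_counital] tensor_bialgebra_simps)

lemma S_carrier: "S \<in> carrier HH"
  using weak_R_matrixD(1)[OF weak_S] by (simp add: Units_def tensor_bialgebra_simps)

lemma weak_components:
  "weak_R_matrix K A B G" "weak_R_matrix K B A H'"
  unfolding G_def H'_def
  by (rule weak_R_matrix_image[OF tensor_counital tensor_counital bialgA bialgB prA_bialg_hom prB_bialg_hom weak_S]
      weak_R_matrix_image[OF tensor_counital tensor_counital bialgB bialgA prB_bialg_hom prA_bialg_hom weak_S])+

lemma quasitriangular_R1: "quasitriangular K A R1"
proof -
  have "prA ` carrier H = carrier A"
    using alg_homD(1)[OF prA_hom] alg_homD(1)[OF inA_hom] pr_in(1)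
    by (force simp: tensor_bialgebra_simps image_iff)
  then show ?thesis
    unfolding R1_def by (rule quasitriangular_image[OF tensor_counital bialgA prA_bialg_hom _ quasi])
qed

lemma quasitriangular_R2: "quasitriangular K B R2"
proof -
  have "prB ` carrier H = carrier B"
    using alg_homD(1)[OF prB_hom] alg_homD(1)[OF inB_hom] pr_in(2)
    by (force simp: tensor_bialgebra_simps image_iff)
  then show ?thesis
    unfolding R2_def by (rule quasitriangular_image[OF tensor_counital bialgB prB_bialg_hom _ quasi])
qed

lemma G_Units: "G \<in> Units AB"
  using weak_components(1) by (rule weak_R_matrixD)

text \<open>Applying \<open>prA \<otimes> prB\<close> to \<open>\<Delta>\<^sup>o\<^sup>p(x) S = S \<Delta>(x)\<close> gives \<open>x G = G x\<close>.\<close>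

lemma G_central: "central AB G"
proof -
  note F = alg_homD[OF tensor_map_alg_hom[OF prA_hom prB_hom]]
  have "G \<otimes>\<^bsub>AB\<^esub> x = x \<otimes>\<^bsub>AB\<^esub> G" if x: "x \<in> carrier AB" for x
    using arg_cong[OF S_flip[OF x], of "tensor_map K A B prA prB"]
      alg_homD(1)[OF flip_alg_hom[OF algAB algAB]] alg_homD(1)[OF comult_hom] S_carrier x
    by (simp add: F(4) pr_comult pr_flip_comult G_def)
  then show ?thesis using F(1)[OF S_carrier] by (simp add: central_def G_def)
qed

lemma H'_central: "central BA H'"
proof -
  note F = alg_homD[OF tensor_map_alg_hom[OF prB_hom prA_hom]]
  note fl = alg_homD(1)[OF flip_alg_hom[OF algAB algAB]] and c = alg_homD(1)[OF comult_hom]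
  have 1: "tensor_map K B A prB prA (comult H x) = flip K A B x"
    "tensor_map K B A prB prA (flip K AB AB (comult H x)) = flip K A B x" if x: "x \<in> carrier AB" for x
    using flip_tensor_map[OF prA_hom prB_hom fl[OF c[OF x]]] flip_tensor_map[OF prA_hom prB_hom c[OF x]] x
    by (simp_all add: pr_comult pr_flip_comult flip_flip[OF algAB algAB c[OF x]])
  have 2: "H' \<otimes>\<^bsub>BA\<^esub> flip K A B x = flip K A B x \<otimes>\<^bsub>BA\<^esub> H'" if x: "x \<in> carrier AB" for x
    using arg_cong[OF S_flip[OF x], of "tensor_map K B A prB prA"] fl c S_carrier x
    by (simp add: F(4) 1 H'_def)
  have "H' \<otimes>\<^bsub>BA\<^esub> y = y \<otimes>\<^bsub>BA\<^esub> H'" if y: "y \<in> carrier BA" for y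
    using 2[OF alg_homD(1)[OF flip_alg_hom[OF B(3) A(3)] y]] flip_flip[OF B(3) A(3) y] by simp
  then show ?thesis using F(1)[OF S_carrier] by (simp add: central_def H'_def)
qed

text \<open>The embeddings that place the components of \<open>S\<close> in the four tensor factors of \<open>(A \<otimes> B) \<otimes> (A \<otimes> B)\<close>.\<close>

abbreviation "embAB \<equiv> tensor_map K AB AB inA inB"
abbreviation "embBA \<equiv> tensor_map K AB AB inB inA"
abbreviation "embAA \<equiv> tensor_map K AB AB inA inA"
abbreviation "embBB \<equiv> tensor_map K AB AB inB inB"

lemma emb_homs:
  "alg_hom K AB HH embAB" "alg_hom K BA HH embBA"
  "alg_hom K (tensor_algebra K A A) HH embAA" "alg_hom K (tensor_algebra K B B) HH embBB"
  by (intro tensor_map_alg_hom inA_hom inB_hom)+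

lemma component_carriers:
  "G \<in> carrier AB" "H' \<in> carrier BA" "R1 \<in> carrier (tensor_algebra K A A)"
  "R2 \<in> carrier (tensor_algebra K B B)"
  unfolding G_def H'_def R1_def R2_def
  using S_carrier by (auto intro: alg_homD(1)[OF tensor_map_alg_hom] prA_hom prB_hom)

lemma emb_carriers:
  "embAB G \<in> carrier HH" "embBA H' \<in> carrier HH" "embAA R1 \<in> carrier HH" "embBB R2 \<in> carrier HH"
  using component_carriers by (auto intro: alg_homD(1)[OF emb_homs(1)] alg_homD(1)[OF emb_homs(2)]
    alg_homD(1)[OF emb_homs(3)] alg_homD(1)[OF emb_homs(4)])

text \<open>The hexagon identities of \<open>S\<close>, with \<open>prA \<otimes> prB\<close> applied to the leg that carries the coproduct.
  This restores \<open>S\<close> on the left-hand side.\<close>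

lemma weak_S_right:
  assumes f: "alg_hom K AB AB f"
  shows "tensor_map K AB AB f (\<lambda>x. x) S
    = tensor_map K AB AB f (\<lambda>x. inB (prB x)) S \<bullet> tensor_map K AB AB f (\<lambda>x. inA (prA x)) S"
proof -
  let ?p = "tensor_map K A B prA prB"
  note p = tensor_map_alg_hom[OF prA_hom prB_hom]
  note fp = alg_homD[OF tensor_map_alg_hom[OF f p]]
  note i = alg_hom_id(1)[OF algAB]
  note inl = alg_hom_pure_left[OF algAB algAB] and inr = alg_hom_pure_right[OF algAB algAB]
  have e: "tensor_map K AB HH id (comult H) S = tensor_map K AB HH id (pure_tensor K AB AB \<one>\<^bsub>AB\<^esub>) S
      \<otimes>\<^bsub>tensor_algebra K AB HH\<^esub> tensor_map K AB HH id (\<lambda>b. pure_tensor K AB AB b \<one>\<^bsub>AB\<^esub>) S"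
    using weak_R_matrixD(2)[OF weak_S] by (simp add: tensor_bialgebra_simps)
  have 1: "tensor_map K AB AB f ?p (tensor_map K AB HH id (comult H) S) = tensor_map K AB AB f (\<lambda>x. x) S"
    by (rule tensor_map_compose_eq[OF i comult_hom f p _ _ S_carrier]) (simp_all add: pr_comult)
  have 2: "tensor_map K AB AB f ?p (tensor_map K AB HH id (pure_tensor K AB AB \<one>\<^bsub>AB\<^esub>) S)
      = tensor_map K AB AB f (\<lambda>x. inB (prB x)) S"
    by (rule tensor_map_compose_eq[OF i inr f p _ _ S_carrier])
      (simp_all add: tensor_map_pure[OF prA_hom prB_hom] alg_homD(5)[OF prA_hom] inB_def)
  have 3: "tensor_map K AB AB f ?p (tensor_map K AB HH id (\<lambda>b. pure_tensor K AB AB b \<one>\<^bsub>AB\<^esub>) S)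
      = tensor_map K AB AB f (\<lambda>x. inA (prA x)) S"
    by (rule tensor_map_compose_eq[OF i inl f p _ _ S_carrier])
      (simp_all add: tensor_map_pure[OF prA_hom prB_hom] alg_homD(5)[OF prB_hom] inA_def)
  show ?thesis
    using arg_cong[OF e, of "tensor_map K AB AB f ?p"] alg_homD(1)[OF tensor_map_alg_hom[OF i inl] S_carrier]
      alg_homD(1)[OF tensor_map_alg_hom[OF i inr] S_carrier]
    by (simp add: 1 2 3 fp(4))
qed

lemma weak_S_left:
  "S = tensor_map K AB AB (\<lambda>x. inA (prA x)) (\<lambda>x. x) S \<bullet>
    tensor_map K AB AB (\<lambda>x. inB (prB x)) (\<lambda>x. x) S"
proof -
  let ?p = "tensor_map K A B prA prB"
  note p = tensor_map_alg_hom[OF prA_hom prB_hom]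
  note i = alg_hom_id(1)[OF algAB]
  note pf = alg_homD[OF tensor_map_alg_hom[OF p i]]
  note inl = alg_hom_pure_left[OF algAB algAB] and inr = alg_hom_pure_right[OF algAB algAB]
  have e: "tensor_map K HH AB (comult H) id S = tensor_map K HH AB (\<lambda>b. pure_tensor K AB AB b \<one>\<^bsub>AB\<^esub>) id S
      \<otimes>\<^bsub>tensor_algebra K HH AB\<^esub> tensor_map K HH AB (pure_tensor K AB AB \<one>\<^bsub>AB\<^esub>) id S"
    using weak_R_matrixD(3)[OF weak_S] by (simp add: tensor_bialgebra_simps)
  have "tensor_map K AB AB ?p id (tensor_map K HH AB (comult H) id S)
      = tensor_map K AB AB (\<lambda>x. x) (\<lambda>x. x) S"
    by (rule tensor_map_compose_eq[OF comult_hom i p i _ _ S_carrier]) (simp_all add: pr_comult)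
  then have 1: "tensor_map K AB AB ?p id (tensor_map K HH AB (comult H) id S) = S"
    by (simp add: tensor_map_id[OF algAB algAB S_carrier])
  have 2: "tensor_map K AB AB ?p id (tensor_map K HH AB (pure_tensor K AB AB \<one>\<^bsub>AB\<^esub>) id S)
      = tensor_map K AB AB (\<lambda>x. inB (prB x)) (\<lambda>x. x) S"
    by (rule tensor_map_compose_eq[OF inr i p i _ _ S_carrier])
      (simp_all add: tensor_map_pure[OF prA_hom prB_hom] alg_homD(5)[OF prA_hom] inB_def)
  have 3: "tensor_map K AB AB ?p id (tensor_map K HH AB (\<lambda>b. pure_tensor K AB AB b \<one>\<^bsub>AB\<^esub>) id S)
      = tensor_map K AB AB (\<lambda>x. inA (prA x)) (\<lambda>x. x) S"
    by (rule tensor_map_compose_eq[OF inl i p i _ _ S_carrier])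
      (simp_all add: tensor_map_pure[OF prA_hom prB_hom] alg_homD(5)[OF prB_hom] inA_def)
  show ?thesis
    using arg_cong[OF e, of "tensor_map K AB AB ?p id"] alg_homD(1)[OF tensor_map_alg_hom[OF inl i] S_carrier]
      alg_homD(1)[OF tensor_map_alg_hom[OF inr i] S_carrier]
    by (simp only: 1 2 3 pf(4))
qed

text \<open>With the four tensor factors of \<open>(A \<otimes> B) \<otimes> (A \<otimes> B)\<close> numbered from 1 to 4, this is
  \<open>S = G\<^sub>1\<^sub>4 (R1)\<^sub>1\<^sub>3 (R2)\<^sub>2\<^sub>4 H'\<^sub>2\<^sub>3\<close>.\<close>

lemma S_factorization:
  "S = embAB G \<bullet> (embAA R1 \<bullet> embBB R2) \<bullet> embBA H'"
proof -
  note c = tensor_map_compose[OF _ _ _ _ S_carrier]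
  have "S = (embAB G \<bullet> embAA R1) \<bullet> (embBB R2 \<bullet> embBA H')"
    using weak_S_left
    unfolding weak_S_right[OF alg_hom_compose[OF prA_hom inA_hom]]
      weak_S_right[OF alg_hom_compose[OF prB_hom inB_hom]] G_def H'_def R1_def R2_def
      c[OF prA_hom prA_hom inA_hom inA_hom] c[OF prA_hom prB_hom inA_hom inB_hom]
      c[OF prB_hom prA_hom inB_hom inA_hom] c[OF prB_hom prB_hom inB_hom inB_hom] .
  then show ?thesis using emb_carriers by (simp add: HH.A.m_assoc)
qed

text \<open>\<open>G\<^sub>1\<^sub>4\<close> and \<open>H'\<^sub>2\<^sub>3\<close> are central in \<open>H \<otimes> H\<close>: they commute with their own two tensor factors by
  centrality, and with the remaining two trivially.\<close>

lemma emb_central: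
  shows embAB_central: "central AB z \<Longrightarrow> central HH (embAB z)"
    and embBA_central: "central BA w \<Longrightarrow> central HH (embBA w)"
proof -
  note inl = alg_hom_pure_left[OF algAB algAB] and inr = alg_hom_pure_right[OF algAB algAB]
  note i = inA_hom inB_hom
  note p = tensor_map_pure[OF i] tensor_map_pure[OF i(2,1)]
  note cl = alg_homD(1)[OF inA_hom] alg_homD(1)[OF inB_hom]
  note one = alg_homD(5)[OF inA_hom] alg_homD(5)[OF inB_hom]
  note m = pure_tensor_mult[OF algAB algAB] pure_tensor_mult[OF A(3) B(3)]
  have comm: "inA a \<otimes>\<^bsub>AB\<^esub> inB b = inB b \<otimes>\<^bsub>AB\<^esub> inA a" if "a \<in> carrier A" "b \<in> carrier B" for a b
    using that by (simp add: inA_def inB_def m)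
  have e: "pure_tensor K A B a \<one>\<^bsub>B\<^esub> = inA a" "pure_tensor K A B \<one>\<^bsub>A\<^esub> b = inB b" for a b
    by (simp_all add: inA_def inB_def)
  have p': "a \<in> carrier A \<Longrightarrow> embAB (inA a) = pure_tensor K AB AB (inA a) \<one>\<^bsub>AB\<^esub>"
    "b \<in> carrier B \<Longrightarrow> embAB (inB b) = pure_tensor K AB AB \<one>\<^bsub>AB\<^esub> (inB b)" for a b
    using p(1)[of a "\<one>\<^bsub>B\<^esub>"] p(1)[of "\<one>\<^bsub>A\<^esub>" b] by (simp_all add: e one)
  have pc: "pure_tensor K A B a b \<in> carrier AB"
    if "a \<in> carrier A" "b \<in> carrier B" for a b
    using that by (auto intro: pure_tensor_closed_algebra A(3) B(3))
  have *: "central HH w" if w: "w \<in> carrier HH"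
    and l: "\<And>t. t \<in> carrier AB \<Longrightarrow> w \<bullet> pure_tensor K AB AB t \<one>\<^bsub>AB\<^esub> = pure_tensor K AB AB t \<one>\<^bsub>AB\<^esub> \<bullet> w"
    and r: "\<And>t. t \<in> carrier AB \<Longrightarrow> w \<bullet> pure_tensor K AB AB \<one>\<^bsub>AB\<^esub> t = pure_tensor K AB AB \<one>\<^bsub>AB\<^esub> t \<bullet> w" for w
    using w commute_tensorI[OF algAB algAB alg_hom_id(2)[OF algHH] w l r] by (simp add: central_def)
  have AB: "central HH (embAB z)" if z: "central AB z" for z
  proof (rule *)
    show "embAB z \<in> carrier HH" by (rule alg_homD(1)[OF emb_homs(1) centralD(1)[OF z]])
    show "embAB z \<bullet> pure_tensor K AB AB t \<one>\<^bsub>AB\<^esub> = pure_tensor K AB AB t \<one>\<^bsub>AB\<^esub> \<bullet> embAB z"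
      if "t \<in> carrier AB" for t
    proof (rule central_image_commutes[OF A(3) B(3) A(3) B(3) emb_homs(1) inl z _ _ that], goal_cases)
      case (1 a)
      then show ?case
        by (intro disjI1 bexI[of _ "pure_tensor K A B a \<one>\<^bsub>B\<^esub>"]) (simp_all add: p one e[symmetric] pc tensor_algebra_one)
    next
      case (2 b)
      then show ?case by (intro disjI2) (simp add: p p' e m cl one comm)
    qed
    show "embAB z \<bullet> pure_tensor K AB AB \<one>\<^bsub>AB\<^esub> t = pure_tensor K AB AB \<one>\<^bsub>AB\<^esub> t \<bullet> embAB z"
      if "t \<in> carrier AB" for t
    proof (rule central_image_commutes[OF A(3) B(3) A(3) B(3) emb_homs(1) inr z _ _ that], goal_cases)
      case (1 a)
      then show ?case by (intro disjI2) (simp add: p p' e m cl one comm)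
    next
      case (2 b)
      then show ?case
        by (intro disjI1 bexI[of _ "pure_tensor K A B \<one>\<^bsub>A\<^esub> b"]) (simp_all add: p one e[symmetric] pc tensor_algebra_one)
    qed
  qed
  then show "central AB z \<Longrightarrow> central HH (embAB z)" .
  show "central HH (embBA w)" if w: "central BA w"
    using central_flip[OF algAB algAB AB[OF central_flip[OF B(3) A(3) w]]]
      flip_tensor_map[OF inA_hom inB_hom centralD(1)[OF central_flip[OF B(3) A(3) w]]]
      flip_flip[OF B(3) A(3) centralD(1)[OF w]] by simp
qed

end

context quasitriangular_tensor
begin

text \<open>\<open>flipG\<close> is \<open>G\<^sup>o\<^sup>p\<close>, and \<open>Q\<close> is the weak R-matrix \<open>H' (G\<^sup>o\<^sup>p)\<^sup>-\<^sup>1\<close>.\<close>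

definition "flipG = flip K A B G"
definition "Q = H' \<otimes>\<^bsub>BA\<^esub> inv\<^bsub>BA\<^esub> flipG"

lemma flipG_Units: "flipG \<in> Units BA"
  unfolding flipG_def by (rule alg_hom_Units(1)[OF flip_alg_hom[OF A(3) B(3)] G_Units])

lemma flipG_central: "central BA flipG"
  unfolding flipG_def by (rule central_flip[OF A(3) B(3) G_central])

lemma Q_weak: "weak_R_matrix K B A Q"
  unfolding Q_def flipG_def
  by (intro weak_R_matrix_mult weak_R_matrix_flip_inv bialgA bialgB weak_components H'_central)

lemma Q_central: "central BA Q"
  unfolding Q_def
  by (intro central_mult central_inv BA.A.monoid_axioms H'_central flipG_central flipG_Units)

lemma emb_flipG: "embBA flipG = flip K AB AB (embAB G)"
  unfolding flipG_def by (rule flip_tensor_map[OF inA_hom inB_hom component_carriers(1), symmetric])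

lemma emb_G_Units: "embAB G \<in> Units HH" and emb_flipG_Units: "embBA flipG \<in> Units HH"
  by (rule alg_hom_Units(1)[OF emb_homs(1) G_Units] alg_hom_Units(1)[OF emb_homs(2) flipG_Units])+

lemma R_tensor_eq:
  "R_tensor K A B R1 R2 Q
    = embBA H' \<bullet> inv\<^bsub>HH\<^esub> (embBA flipG) \<bullet> (embAA R1 \<bullet> embBB R2)"
proof -
  let ?AA = "tensor_algebra K A A" and ?BB = "tensor_algebra K B B"
  note AA = tensor_algebra_is_k_algebra[OF A(3) A(3)] and BB = tensor_algebra_is_k_algebra[OF B(3) B(3)]
  interpret AA: k_algebra K ?AA by (rule AA)
  interpret BB: k_algebra K ?BB by (rule BB)
  note mf = alg_homD[OF middle_flip_alg_hom[OF A(3) A(3) B(3) B(3)]]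
  note c = component_carriers
  have "pure_tensor K ?AA ?BB R1 R2
      = pure_tensor K ?AA ?BB R1 \<one>\<^bsub>?BB\<^esub> \<otimes>\<^bsub>tensor_algebra K ?AA ?BB\<^esub> pure_tensor K ?AA ?BB \<one>\<^bsub>?AA\<^esub> R2"
    using c by (simp add: pure_tensor_mult[OF AA BB])
  then have "middle_flip K A A B B (pure_tensor K ?AA ?BB R1 R2) = embAA R1 \<bullet> embBB R2"
    using c by (simp add: mf(4) pure_tensor_closed_algebra[OF AA BB] middle_flip_left middle_flip_right)
  moreover have "embBA Q = embBA H' \<bullet> inv\<^bsub>HH\<^esub> (embBA flipG)"
    unfolding Q_def
    using c flipG_Units alg_hom_Units(2)[OF emb_homs(2) flipG_Units] by (simp add: alg_homD(4)[OF emb_homs(2)])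
  moreover have "inB = pure_tensor K A B \<one>\<^bsub>A\<^esub>" "inA = (\<lambda>a. pure_tensor K A B a \<one>\<^bsub>B\<^esub>)"
    by (simp_all add: fun_eq_iff inA_def inB_def)
  ultimately show ?thesis by (simp add: R_tensor_def Let_def)
qed

text \<open>\<open>R_tensor\<close> is the product of \<open>S\<close> with two central weak R-matrices of \<open>(H, H)\<close>: the inverse
  of \<open>W = embAB G\<close> and the inverse of the flip of \<open>W\<close>.\<close>

lemma R_tensor_quasitriangular: "quasitriangular K H (R_tensor K A B R1 R2 Q)"
proof -
  let ?W = "embAB G" and ?R = "embAA R1 \<bullet> embBB R2"
  let ?V = "inv\<^bsub>HH\<^esub> ?W" and ?V' = "inv\<^bsub>HH\<^esub> (embBA flipG)"
  have Ww: "weak_R_matrix K H H ?W"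
    using weak_R_matrix_image[OF bialgA bialgB tensor_counital tensor_counital inA_bialg_hom
        inB_bialg_hom weak_components(1)] by (simp add: tensor_bialgebra_simps)
  have Wc: "central HH ?W" by (rule embAB_central[OF G_central])
  have Vw: "weak_R_matrix K H H ?V"
    using weak_R_matrix_inv[OF tensor_counital tensor_counital Ww] Wc by (simp add: tensor_bialgebra_simps)
  have V'w: "weak_R_matrix K H H ?V'"
    using weak_R_matrix_flip_inv[OF tensor_counital tensor_counital Ww]
    by (simp add: tensor_bialgebra_simps emb_flipG)
  have Vc: "central HH ?V" by (rule central_inv[OF HH.A.monoid_axioms Wc emb_G_Units])
  have V'c: "central HH ?V'"
    by (rule central_inv[OF HH.A.monoid_axioms embBA_central[OF flipG_central] emb_flipG_Units])
  have hc: "central HH (embBA H')" by (rule embBA_central[OF H'_central])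
  note k = emb_carriers HH.A.m_closed[OF emb_carriers(3,4)] centralD(1)[OF Vc] centralD(1)[OF V'c]
  have "R_tensor K A B R1 R2 Q = ?V' \<bullet> embBA H' \<bullet> ?R"
    unfolding R_tensor_eq centralD(2)[OF hc k(7)] ..
  also have "\<dots> = ?V' \<bullet> (embBA H' \<bullet> ?R)" by (intro HH.A.m_assoc k)
  also have "embBA H' \<bullet> ?R = ?R \<bullet> embBA H'" by (rule centralD(2)[OF hc k(5)])
  also have "?R \<bullet> embBA H' = ?V \<bullet> ?W \<bullet> (?R \<bullet> embBA H')"
    using emb_G_Units k by simp
  also have "\<dots> = ?V \<bullet> (?W \<bullet> ?R \<bullet> embBA H')"
    using k by (simp add: HH.A.m_assoc)
  finally have "R_tensor K A B R1 R2 Q = ?V' \<bullet> (?V \<bullet> S)"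
    unfolding S_factorization[symmetric] .
  moreover have "quasitriangular K H (?V' \<bullet> (?V \<bullet> S))"
    using quasitriangular_mult[OF tensor_counital V'w _ quasitriangular_mult[OF tensor_counital Vw _ quasi]]
      Vc V'c by (simp add: tensor_bialgebra_simps)
  ultimately show ?thesis by simp
qed

text \<open>Both hexagon identities of the weak R-matrix \<open>G\<close> together compute its coproduct in \<open>H\<close>:
  \<open>\<Delta>(G) = G\<^sub>1\<^sub>4 (G \<otimes> G) G\<^sub>3\<^sub>2\<close>.\<close>

lemma comult_G:
  "comult H G = embAB G \<bullet> pure_tensor K AB AB G G \<bullet> embBA flipG"
proof -
  let ?p = "pure_tensor K AB AB"
  let ?AA = "tensor_algebra K A A" and ?BB = "tensor_algebra K B B"
  note AA = tensor_algebra_is_k_algebra[OF A(3) A(3)] and BB = tensor_algebra_is_k_algebra[OF B(3) B(3)]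
  note idA = alg_hom_id(1)[OF A(3)] and idB = alg_hom_id(1)[OF B(3)]
  note idAA = alg_hom_id(1)[OF AA] and idBB = alg_hom_id(1)[OF BB]
  note iA = alg_hom_pure_left[OF A(3) A(3)] alg_hom_pure_right[OF A(3) A(3)]
  note iB = alg_hom_pure_left[OF B(3) B(3)] alg_hom_pure_right[OF B(3) B(3)]
  note mf = middle_flip_alg_hom[OF A(3) A(3) B(3) B(3)] and mfp = middle_flip_pure[OF A(3) A(3) B(3) B(3)]
  note Gc = component_carriers(1)
  note l = leg_homs[OF bialgA bialgB]
  let ?l1 = "\<lambda>a. pure_tensor K A A a \<one>\<^bsub>A\<^esub>" and ?l2 = "pure_tensor K A A \<one>\<^bsub>A\<^esub>"
  let ?r1 = "\<lambda>b. pure_tensor K B B b \<one>\<^bsub>B\<^esub>" and ?r2 = "pure_tensor K B B \<one>\<^bsub>B\<^esub>"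
  let ?E = "tensor_map K ?AA ?BB id (comult B)"
  let ?T = "tensor_algebra K ?AA ?BB"
  note E = tensor_map_alg_hom[OF idAA B(1)]
  have split: "?E (tensor_map K ?AA B j id G)
      = tensor_map K ?AA ?BB j ?r2 G \<otimes>\<^bsub>?T\<^esub> tensor_map K ?AA ?BB j ?r1 G"
    if j: "alg_hom K A ?AA j" for j
  proof -
    note F = alg_homD[OF tensor_map_alg_hom[OF j idBB]]
    have "?E (tensor_map K ?AA B j id G)
        = tensor_map K ?AA ?BB j id (tensor_map K A ?BB id (comult B) G)"
      by (rule tensor_map_square[OF j idB idAA B(1) idA B(1) j idBB _ _ Gc]) simp_all
    also have "\<dots> = tensor_map K ?AA ?BB j id (tensor_map K A ?BB id ?r2 G) \<otimes>\<^bsub>?T\<^esub>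
        tensor_map K ?AA ?BB j id (tensor_map K A ?BB id ?r1 G)"
      unfolding weak_R_matrixD(2)[OF weak_components(1)]
      by (rule F(4)) (rule alg_homD(1)[OF l(2) Gc] alg_homD(1)[OF l(3) Gc])+
    also have "tensor_map K ?AA ?BB j id (tensor_map K A ?BB id ?r2 G) = tensor_map K ?AA ?BB j ?r2 G"
      by (rule tensor_map_compose_eq[OF idA iB(2) j idBB _ _ Gc]) simp_all
    also have "tensor_map K ?AA ?BB j id (tensor_map K A ?BB id ?r1 G) = tensor_map K ?AA ?BB j ?r1 G"
      by (rule tensor_map_compose_eq[OF idA iB(1) j idBB _ _ Gc]) simp_all
    finally show ?thesis .
  qed
  have "tensor_map K ?AA ?BB (comult A) (comult B) G = ?E (tensor_map K ?AA B (comult A) id G)"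
    by (rule tensor_map_compose_eq[OF A(1) idB idAA B(1) _ _ Gc, symmetric]) simp_all
  also have "\<dots> = ?E (tensor_map K ?AA B ?l1 id G) \<otimes>\<^bsub>?T\<^esub> ?E (tensor_map K ?AA B ?l2 id G)"
    unfolding weak_R_matrixD(3)[OF weak_components(1)]
    by (rule alg_homD(4)[OF E]) (rule alg_homD(1)[OF l(5) Gc] alg_homD(1)[OF l(6) Gc])+
  finally have D: "tensor_map K ?AA ?BB (comult A) (comult B) G
      = (tensor_map K ?AA ?BB ?l1 ?r2 G \<otimes>\<^bsub>?T\<^esub> tensor_map K ?AA ?BB ?l1 ?r1 G) \<otimes>\<^bsub>?T\<^esub>
        (tensor_map K ?AA ?BB ?l2 ?r2 G \<otimes>\<^bsub>?T\<^esub> tensor_map K ?AA ?BB ?l2 ?r1 G)"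
    unfolding split[OF iA(1)] split[OF iA(2)] .
  have car: "tensor_map K ?AA ?BB ?l1 ?r1 G \<in> carrier ?T" "tensor_map K ?AA ?BB ?l1 ?r2 G \<in> carrier ?T"
    "tensor_map K ?AA ?BB ?l2 ?r1 G \<in> carrier ?T" "tensor_map K ?AA ?BB ?l2 ?r2 G \<in> carrier ?T"
    by (rule alg_homD(1)[OF tensor_map_alg_hom[OF iA(1) iB(1)] Gc]
        alg_homD(1)[OF tensor_map_alg_hom[OF iA(1) iB(2)] Gc]
        alg_homD(1)[OF tensor_map_alg_hom[OF iA(2) iB(1)] Gc]
        alg_homD(1)[OF tensor_map_alg_hom[OF iA(2) iB(2)] Gc])+
  interpret T: k_algebra K ?T by (rule tensor_algebra_is_k_algebra[OF AA BB])
  let ?m = "middle_flip K A A B B"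
  note p = tensor_map_pure[OF iA(1) iB(1)] tensor_map_pure[OF iA(1) iB(2)]
    tensor_map_pure[OF iA(2) iB(1)] tensor_map_pure[OF iA(2) iB(2)]
  note ext = alg_hom_tensor_ext[OF A(3) B(3) alg_hom_compose[OF tensor_map_alg_hom mf] _ _ _ Gc]
  have 12: "?m (tensor_map K ?AA ?BB ?l1 ?r2 G) = embAB G"
    by (rule ext[OF iA(1) iB(2) emb_homs(1)])
      (simp_all add: p mfp tensor_map_pure[OF inA_hom inB_hom] inA_def inB_def)
  have 11: "?m (tensor_map K ?AA ?BB ?l1 ?r1 G) = ?p G \<one>\<^bsub>AB\<^esub>"
    by (rule ext[OF iA(1) iB(1) alg_hom_pure_left[OF algAB algAB]]) (simp_all add: p mfp tensor_algebra_one)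
  have 22: "?m (tensor_map K ?AA ?BB ?l2 ?r2 G) = ?p \<one>\<^bsub>AB\<^esub> G"
    by (rule ext[OF iA(2) iB(2) alg_hom_pure_right[OF algAB algAB]]) (simp_all add: p mfp tensor_algebra_one)
  have 21: "?m (tensor_map K ?AA ?BB ?l2 ?r1 G) = embBA flipG"
    unfolding flipG_def
    by (rule ext[OF iA(2) iB(1) alg_hom_compose[OF flip_alg_hom[OF A(3) B(3)] emb_homs(2)]])
      (simp_all add: p mfp tensor_map_pure[OF inB_hom inA_hom] flip_pure[OF A(3) B(3)] inA_def inB_def)
  note pc = pure_tensor_closed_algebra[OF algAB algAB]
  note vc = alg_homD(1)[OF emb_homs(2) BA.A.Units_closed[OF flipG_Units]]
  have "comult H G = (embAB G \<bullet> ?p G \<one>\<^bsub>AB\<^esub>) \<bullet>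
      (?p \<one>\<^bsub>AB\<^esub> G \<bullet> embBA flipG)"
    unfolding comult_tensor D
    by (simp add: alg_homD(4)[OF mf] car 12 11 22 21)
  also have "\<dots> = embAB G \<bullet> (?p G \<one>\<^bsub>AB\<^esub> \<bullet> ?p \<one>\<^bsub>AB\<^esub> G) \<bullet> embBA flipG"
    using emb_carriers(1) vc Gc pc by (simp add: HH.A.m_assoc)
  finally show ?thesis using Gc by (simp add: pure_tensor_mult[OF algAB algAB])
qed

text \<open>Since \<open>G\<^sub>1\<^sub>4\<close>, \<open>G \<otimes> G\<close> and \<open>G\<^sub>3\<^sub>2\<close> are central, multiplication by \<open>G \<otimes> G\<close> and
  \<open>\<Delta>(G)\<^sup>-\<^sup>1\<close> just replaces the factor \<open>G\<^sub>1\<^sub>4\<close> of \<open>S\<close> by the inverse of \<open>G\<^sub>3\<^sub>2\<close>.\<close>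

lemma gauge_S: "gauge_transform K H G S = R_tensor K A B R1 R2 Q"
proof -
  let ?g = "pure_tensor K AB AB G G" and ?R = "embAA R1 \<bullet> embBB R2"
  note Gc = component_carriers(1)
  note pc = pure_tensor_closed_algebra[OF algAB algAB]
  have g: "central HH ?g"
    using commute_tensorI[OF algAB algAB alg_hom_id(2)[OF algHH] pc[OF Gc Gc]]
    by (simp add: central_def pc Gc pure_tensor_mult[OF algAB algAB] centralD(2)[OF G_central])
  have Du: "comult H G \<in> Units HH" and Di: "comult H (inv\<^bsub>AB\<^esub> G) = inv\<^bsub>HH\<^esub> (comult H G)"
    by (rule alg_hom_Units[OF comult_hom G_Units])+
  have "?g \<bullet> S = R_tensor K A B R1 R2 Q \<bullet> comult H G"
    unfolding R_tensor_eq comult_G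
    by (subst S_factorization, rule central_rearrange[OF HH.A.monoid_axioms])
      (use emb_flipG_Units emb_carriers g in
        \<open>auto intro: embAB_central embBA_central G_central flipG_central H'_central\<close>)
  moreover have "R_tensor K A B R1 R2 Q \<in> carrier HH"
    using emb_carriers emb_flipG_Units by (simp add: R_tensor_eq)
  ultimately have "?g \<bullet> S \<bullet> inv\<^bsub>HH\<^esub> (comult H G) = R_tensor K A B R1 R2 Q"
    using Du HH.A.Units_closed[OF Du] by (simp add: HH.A.m_assoc)
  then show ?thesis by (simp add: gauge_transform_def Let_def tensor_bialgebra_simps Di)
qed

lemma cohomologous_R_tensor: "cohomologous K H S (R_tensor K A B R1 R2 Q)"
  unfolding cohomologous_def
  using quasitriangular_imp_twist[OF tensor_counital quasi]
    quasitriangular_imp_twist[OF tensor_counital R_tensor_quasitriangular] gauge_S G_Units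
  by (auto simp: tensor_bialgebra_simps)

end

theorem proposition3p11:
  fixes K :: "('k, 'm) ring_scheme"
    and H\<^sub>1 :: "('k, 'a) bialg" and H\<^sub>2 :: "('k, 'b) bialg"
    and S :: "('k, ('k, 'a, 'b) tens, ('k, 'a, 'b) tens) tens"
  defines "H \<equiv> tensor_bialgebra K H\<^sub>1 H\<^sub>2"
    and "Id_\<epsilon> \<equiv> apply_right K H\<^sub>1 (counit H\<^sub>2)"
    and "\<epsilon>_Id \<equiv> apply_left K H\<^sub>2 (counit H\<^sub>1)"
  defines "G \<equiv> tensor_map K H\<^sub>1 H\<^sub>2 Id_\<epsilon> \<epsilon>_Id S"
    and "H' \<equiv> tensor_map K H\<^sub>2 H\<^sub>1 \<epsilon>_Id Id_\<epsilon> S"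
  defines "R\<^sub>1 \<equiv> tensor_map K H\<^sub>1 H\<^sub>1 Id_\<epsilon> Id_\<epsilon> S"
    and "R\<^sub>2 \<equiv> tensor_map K H\<^sub>2 H\<^sub>2 \<epsilon>_Id \<epsilon>_Id S"
    and "Q \<equiv> H' \<otimes>\<^bsub>tensor_algebra K H\<^sub>2 H\<^sub>1\<^esub> inv\<^bsub>tensor_algebra K H\<^sub>2 H\<^sub>1\<^esub> (flip K H\<^sub>1 H\<^sub>2 G)"
  assumes "bialgebra K H\<^sub>1" and "bialgebra K H\<^sub>2"
    and "quasitriangular K H S"
  shows "flip K H\<^sub>1 H\<^sub>2 G \<in> Units (tensor_algebra K H\<^sub>2 H\<^sub>1)
    \<and> quasitriangular K H\<^sub>1 R\<^sub>1
    \<and> quasitriangular K H\<^sub>2 R\<^sub>2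
    \<and> weak_R_matrix K H\<^sub>2 H\<^sub>1 Q \<and> central (tensor_algebra K H\<^sub>2 H\<^sub>1) Q
    \<and> quasitriangular K H (R_tensor K H\<^sub>1 H\<^sub>2 R\<^sub>1 R\<^sub>2 Q)
    \<and> cohomologous K H S (R_tensor K H\<^sub>1 H\<^sub>2 R\<^sub>1 R\<^sub>2 Q)"
proof -
  interpret T: quasitriangular_tensor K H\<^sub>1 H\<^sub>2 S
    using assms by unfold_locales (auto simp: H_def intro: bialgebra_counital)
  have pr: "Id_\<epsilon> = T.prA" "\<epsilon>_Id = T.prB"
    by (simp_all add: Id_\<epsilon>_def \<epsilon>_Id_def T.prA_def T.prB_def)
  have defs: "G = T.G" "H' = T.H'" "R\<^sub>1 = T.R1" "R\<^sub>2 = T.R2"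
    unfolding G_def H'_def R\<^sub>1_def R\<^sub>2_def pr T.G_def T.H'_def T.R1_def T.R2_def by simp_all
  have "Q = T.Q" by (simp add: Q_def T.Q_def T.flipG_def defs)
  then show ?thesis
    using T.flipG_Units T.quasitriangular_R1 T.quasitriangular_R2 T.Q_weak T.Q_central
      T.R_tensor_quasitriangular T.cohomologous_R_tensor
    by (simp add: defs T.flipG_def H_def)
qed

end
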